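(* Let $(u,\omega)$ be a functional vorticity solution of the incompressible Euler equations on $\mathbb{T}^3\times(0,T)$ such that $u\in L^3((0,T);B^{2/3+}_{3,\infty}(\mathbb{T}^3))$. Then the (global) helicity is conserved, i.e. $\mathcal{H}(t)=\langle\omega(\cdot,t),u(\cdot,t)\rangle_{H^{-1/2}\times H^{1/2}}$ satisfies $\mathcal{H}(t_1)=\mathcal{H}(t_2)$ for almost every $t_1,t_2\in(0,T)$.
   Context: $\mathbb{T}^3$ is the three-dimensional torus, $T>0$. $\mathcal{D}$ denotes $C_c^\infty$; $B^s_{p,q}$ are Besov spaces. $f\in L^r((0,T);X^{s+})$ means there is $\epsilon_0>0$ with $f\in L^r((0,T);X^{s+\epsilon_0})$ (so $B^{2/3+}_{3,\infty}$ means $B^{2/3+\epsilon_0}_{3,\infty}$ for some $\epsilon_0>0$). $(a\otimes b)_{ij}=a_ib_j$, $(\nabla\psi)_{ij}=\partial_i\psi_j$. $\langle\cdot,\cdot\rangle$ is the spatial distributional duality bracket. Functional vorticity solution: a pair $(u,\omega)$ with $u\in L^\infty((0,T);H^{1/2+}(\mathbb{T}^3))$, $\omega=\nabla\times u$, $\nabla\cdot u=\nabla\cdot\omega=0$ in the sense of distributions, and for all $\psi\in\mathcal{D}(\mathbb{T}^3\times(0,T);\mathbb{R}^3)$ $$\int_0^T\langle\omega,\partial_t\psi\rangle dt+\int_0^T\langle u\otimes\omega-\omega\otimes u,\nabla\psi\rangle dt=0,$$ where the products $u\otimes\omega$, $\omega\otimes u$ are understood in the sense of Bony's paraproducts, i.e.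 as the continuous extension of the pointwise product (equivalently as limits of products of mollified functions). *)

theory Defs
  imports "HOL-Analysis.Analysis"
begin

text \<open>
  The torus is \<open>\<real>\<^sup>3 / \<int>\<^sup>3\<close>: functions on it are 1-periodic functions on \<open>real^3\<close>, integrated over the
  unit cube. Elements of the function spaces are distributions on the torus, given as
  functionals on smooth periodic functions; only their values on such functions matter.
\<close>

section \<open>Test functions and distributions on the torus\<close>

fun iter_deriv :: "'a list \<Rightarrow> ('a::real_normed_vector \<Rightarrow> 'b::real_normed_vector) \<Rightarrow> 'a \<Rightarrow> 'b" where
  "iter_deriv [] f = f"
| "iter_deriv (v # vs) f = (\<lambda>x. frechet_derivative (iter_deriv vs f) (at x) v)"

text \<open>All iterated directional derivatives exist and are again differentiable (hence continuous).\<close>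

definition smooth :: "('a::real_normed_vector \<Rightarrow> 'b::real_normed_vector) \<Rightarrow> bool" where
  "smooth f \<longleftrightarrow> (\<forall>vs x. iter_deriv vs f differentiable (at x))"

definition torus_test :: "(real^3 \<Rightarrow> real) \<Rightarrow> bool" where
  "torus_test \<phi> \<longleftrightarrow> smooth \<phi> \<and> (\<forall>x i. \<phi> (x + axis i 1) = \<phi> x)"

type_synonym functional = "(real^3 \<Rightarrow> real) \<Rightarrow> real"

text \<open>The last conjunct is continuity in the topology of uniform convergence of all derivatives:
  the functional is bounded by a multiple of some \<open>C\<^sup>m\<close> norm.\<close>

definition torus_distribution :: "functional \<Rightarrow> bool" where
  "torus_distribution f \<longleftrightarrow>
     (\<forall>\<phi> \<psi> a b. torus_test \<phi> \<longrightarrow> torus_test \<psi> \<longrightarrow>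
        f (\<lambda>x. a * \<phi> x + b * \<psi> x) = a * f \<phi> + b * f \<psi>) \<and>
     (\<exists>C m. \<forall>\<phi> M. torus_test \<phi> \<longrightarrow>
        (\<forall>vs x. set vs \<subseteq> Basis \<longrightarrow> length vs \<le> m \<longrightarrow> \<bar>iter_deriv vs \<phi> x\<bar> \<le> M) \<longrightarrow>
        \<bar>f \<phi>\<bar> \<le> C * M)"

definition dist_eq :: "functional \<Rightarrow> functional \<Rightarrow> bool" where
  "dist_eq f g \<longleftrightarrow> (\<forall>\<phi>. torus_test \<phi> \<longrightarrow> f \<phi> = g \<phi>)"

definition dist_partial :: "3 \<Rightarrow> functional \<Rightarrow> functional" where
  "dist_partial j f = (\<lambda>\<phi>. - f (\<lambda>x. frechet_derivative \<phi> (at x) (axis j 1)))"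

definition dist_div :: "functional^3 \<Rightarrow> functional" where
  "dist_div f = (\<lambda>\<phi>. \<Sum>j\<in>UNIV. dist_partial j (f $ j) \<phi>)"

definition dist_curl :: "functional^3 \<Rightarrow> functional^3" where
  "dist_curl f = (\<chi> i.
     if i = 1 then dist_partial 2 (f $ 3) - dist_partial 3 (f $ 2)
     else if i = 2 then dist_partial 3 (f $ 1) - dist_partial 1 (f $ 3)
     else dist_partial 1 (f $ 2) - dist_partial 2 (f $ 1))"

section \<open>Fourier coefficients and Littlewood-Paley blocks\<close>

definition freq :: "int^3 \<Rightarrow> real^3" where
  "freq k = (\<chi> i. of_int (k $ i))"

text \<open>\<open>f\<close> applied to \<open>x \<mapsto> exp (-2 \<pi> i k \<bullet> x)\<close>, split into real and imaginary part because
  test functions are real-valued.\<close>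

definition fourier_coeff :: "functional \<Rightarrow> int^3 \<Rightarrow> complex" where
  "fourier_coeff f k =
     Complex (f (\<lambda>x. cos (2 * pi * (freq k \<bullet> x)))) (- f (\<lambda>x. sin (2 * pi * (freq k \<bullet> x))))"

text \<open>The function that generates the dyadic partition of unity
  \<open>\<theta>(\<xi>) + (\<Sum>n. \<theta>(\<xi> / 2\<^sup>n\<^sup>+\<^sup>1) - \<theta>(\<xi> / 2\<^sup>n)) = 1\<close>. Different choices give equivalent Besov norms.\<close>

definition dyadic_cutoff :: "(real^3 \<Rightarrow> real) \<Rightarrow> bool" where
  "dyadic_cutoff \<theta> \<longleftrightarrow> smooth \<theta> \<and> (\<forall>\<xi>. 0 \<le> \<theta> \<xi> \<and> \<theta> \<xi> \<le> 1) \<and>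
     (\<forall>\<xi> \<eta>. norm \<xi> = norm \<eta> \<longrightarrow> \<theta> \<xi> = \<theta> \<eta>) \<and>
     (\<forall>\<xi>. norm \<xi> \<le> 1 \<longrightarrow> \<theta> \<xi> = 1) \<and> (\<forall>\<xi>. norm \<xi> \<ge> 3/2 \<longrightarrow> \<theta> \<xi> = 0)"

text \<open>The Fourier multiplier \<open>\<theta>(D / 2\<^sup>n)\<close>. The sum is finite, and for real distributions and even
  \<open>\<theta>\<close> taking real parts term by term does not change it.\<close>

definition low_freq :: "(real^3 \<Rightarrow> real) \<Rightarrow> nat \<Rightarrow> functional \<Rightarrow> real^3 \<Rightarrow> real" where
  "low_freq \<theta> n f x =
     (\<Sum>k\<in>{k. \<theta> (freq k /\<^sub>R 2 ^ n) \<noteq> 0}.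
        \<theta> (freq k /\<^sub>R 2 ^ n) * Re (fourier_coeff f k * cis (2 * pi * (freq k \<bullet> x))))"

text \<open>Blocks are numbered from 0, the low-frequency block being \<open>lp_block \<theta> 0\<close>
  (often written \<open>\<Delta>\<close> with index \<open>-1\<close>). Thus \<open>low_freq \<theta> n\<close> is the sum of the blocks \<open>0, \<dots>, n\<close>.\<close>

fun lp_block :: "(real^3 \<Rightarrow> real) \<Rightarrow> nat \<Rightarrow> functional \<Rightarrow> real^3 \<Rightarrow> real" where
  "lp_block \<theta> 0 f = low_freq \<theta> 0 f"
| "lp_block \<theta> (Suc n) f = (\<lambda>x. low_freq \<theta> (Suc n) f x - low_freq \<theta> n f x)"

abbreviation cell :: "(real^3) set" where
  "cell \<equiv> cbox 0 One"

section \<open>Sobolev and Besov spaces of vector fields\<close>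

definition sobolev :: "real \<Rightarrow> (functional^3) set" where
  "sobolev s = {f. (\<forall>i. torus_distribution (f $ i)) \<and>
     (\<forall>i. (\<lambda>k. (1 + (norm (freq k))\<^sup>2) powr s * (cmod (fourier_coeff (f $ i) k))\<^sup>2) summable_on UNIV)}"

definition sobolev_norm :: "real \<Rightarrow> functional^3 \<Rightarrow> real" where
  "sobolev_norm s f = sqrt (\<Sum>i\<in>UNIV. \<Sum>\<^sub>\<infinity>k.
     (1 + (norm (freq k))\<^sup>2) powr s * (cmod (fourier_coeff (f $ i) k))\<^sup>2)"

definition Lp_norm :: "real \<Rightarrow> (real^3 \<Rightarrow> real^3) \<Rightarrow> real" where
  "Lp_norm p F = (LINT x:cell|lborel. norm (F x) powr p) powr (1 / p)"

definition besov_weight :: "(real^3 \<Rightarrow> real) \<Rightarrow> real \<Rightarrow> real \<Rightarrow> functional^3 \<Rightarrow> nat \<Rightarrow> real" where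
  "besov_weight \<theta> s p f n = 2 powr (real n * s) * Lp_norm p (\<lambda>x. \<chi> i. lp_block \<theta> n (f $ i) x)"

text \<open>The space \<open>B\<close> with smoothness \<open>s\<close>, integrability \<open>p\<close> and third index \<open>\<infinity>\<close>.\<close>

definition besov_inf :: "(real^3 \<Rightarrow> real) \<Rightarrow> real \<Rightarrow> real \<Rightarrow> (functional^3) set" where
  "besov_inf \<theta> s p = {f. (\<forall>i. torus_distribution (f $ i)) \<and> bdd_above (range (besov_weight \<theta> s p f))}"

definition besov_inf_norm :: "(real^3 \<Rightarrow> real) \<Rightarrow> real \<Rightarrow> real \<Rightarrow> functional^3 \<Rightarrow> real" where
  "besov_inf_norm \<theta> s p f = (SUP n. besov_weight \<theta> s p f n)"

section \<open>Bochner spaces\<close>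

text \<open>The spaces above are not types with a norm, so strong measurability, in a space \<open>X\<close> with
  norm \<open>N\<close>, is written out as approximation by simple functions.\<close>

definition simple_map :: "real \<Rightarrow> 'v set \<Rightarrow> (real \<Rightarrow> 'v) \<Rightarrow> bool" where
  "simple_map T X s \<longleftrightarrow> finite (s ` {0<..<T}) \<and> s ` {0<..<T} \<subseteq> X \<and>
     (\<forall>v. {t \<in> {0<..<T}. s t = v} \<in> sets lebesgue)"

definition strongly_measurable :: "real \<Rightarrow> 'v::minus set \<Rightarrow> ('v \<Rightarrow> real) \<Rightarrow> (real \<Rightarrow> 'v) \<Rightarrow> bool" where
  "strongly_measurable T X N u \<longleftrightarrow> (AE t in lebesgue_on {0<..<T}. u t \<in> X) \<and>
     (\<exists>s. (\<forall>n::nat. simple_map T X (s n)) \<and>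
          (AE t in lebesgue_on {0<..<T}. (\<lambda>n. N (s n t - u t)) \<longlonglongrightarrow> 0))"

definition bochner_Lr ::
    "real \<Rightarrow> real \<Rightarrow> 'v::minus set \<Rightarrow> ('v \<Rightarrow> real) \<Rightarrow> (real \<Rightarrow> 'v) set" where
  "bochner_Lr r T X N = {u. strongly_measurable T X N u \<and>
     integrable (lebesgue_on {0<..<T}) (\<lambda>t. N (u t) powr r)}"

definition bochner_Linf ::
    "real \<Rightarrow> 'v::minus set \<Rightarrow> ('v \<Rightarrow> real) \<Rightarrow> (real \<Rightarrow> 'v) set" where
  "bochner_Linf T X N = {u. strongly_measurable T X N u \<and>
     (\<exists>C. AE t in lebesgue_on {0<..<T}. N (u t) \<le> C)}"

section \<open>Products of distributions\<close>

text \<open>Bony's decomposition \<open>f g = T\<^sub>f g + T\<^sub>g f + R(f,g)\<close>, tested against \<open>\<phi>\<close>. The paraproduct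
  \<open>T\<^sub>f g\<close> pairs block \<open>n\<close> of \<open>g\<close> with the blocks \<open>\<le> n - 2\<close> of \<open>f\<close>, and \<open>R(f,g)\<close> collects the pairs of
  blocks whose indices differ by at most one (for \<open>n = 0\<close> the truncated \<open>n - 1\<close> is \<open>0\<close>, as it
  should be).\<close>

definition paraproduct :: "(real^3 \<Rightarrow> real) \<Rightarrow> functional \<Rightarrow> functional \<Rightarrow> functional" where
  "paraproduct \<theta> f g \<phi> =
     (\<Sum>n. LINT x:cell|lborel. low_freq \<theta> n f x * lp_block \<theta> (n + 2) g x * \<phi> x)"

definition bony_remainder :: "(real^3 \<Rightarrow> real) \<Rightarrow> functional \<Rightarrow> functional \<Rightarrow> functional" where
  "bony_remainder \<theta> f g \<phi> =
     (\<Sum>n. LINT x:cell|lborel. (\<Sum>m = n - 1..n + 1. lp_block \<theta> m f x) * lp_block \<theta> n g x * \<phi> x)"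

definition bony_product :: "(real^3 \<Rightarrow> real) \<Rightarrow> functional \<Rightarrow> functional \<Rightarrow> functional" where
  "bony_product \<theta> f g \<phi> = paraproduct \<theta> f g \<phi> + paraproduct \<theta> g f \<phi> + bony_remainder \<theta> f g \<phi>"

definition bony_tensor :: "(real^3 \<Rightarrow> real) \<Rightarrow> functional^3 \<Rightarrow> functional^3 \<Rightarrow> functional^3^3" where
  "bony_tensor \<theta> a b = (\<chi> i j. bony_product \<theta> (a $ i) (b $ j))"

section \<open>Functional vorticity solutions and helicity\<close>

text \<open>Smooth vector fields with compact support in \<open>\<real>\<^sup>3 / \<int>\<^sup>3 \<times> (0,T)\<close>, extended by zero to all times.\<close>

definition spacetime_test :: "real \<Rightarrow> ((real^3) \<times> real \<Rightarrow> real^3) \<Rightarrow> bool" where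
  "spacetime_test T \<psi> \<longleftrightarrow> smooth \<psi> \<and> (\<forall>x t i. \<psi> (x + axis i 1, t) = \<psi> (x, t)) \<and>
     (\<exists>a b. 0 < a \<and> a < b \<and> b < T \<and> (\<forall>x t. t \<notin> {a..b} \<longrightarrow> \<psi> (x, t) = 0))"

definition time_deriv :: "((real^3) \<times> real \<Rightarrow> real^3) \<Rightarrow> real \<Rightarrow> real^3 \<Rightarrow> real^3" where
  "time_deriv \<psi> t x = frechet_derivative \<psi> (at (x, t)) (0, 1)"

text \<open>\<open>(\<nabla>\<psi>)\<^sub>i\<^sub>j = \<partial>\<^sub>i \<psi>\<^sub>j\<close>\<close>

definition space_grad :: "((real^3) \<times> real \<Rightarrow> real^3) \<Rightarrow> real \<Rightarrow> real^3 \<Rightarrow> real^3^3" where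
  "space_grad \<psi> t x = (\<chi> i j. frechet_derivative \<psi> (at (x, t)) (axis i 1, 0) $ j)"

definition bracket_vec :: "functional^3 \<Rightarrow> (real^3 \<Rightarrow> real^3) \<Rightarrow> real" where
  "bracket_vec f \<Phi> = (\<Sum>i\<in>UNIV. (f $ i) (\<lambda>x. \<Phi> x $ i))"

definition bracket_mat :: "functional^3^3 \<Rightarrow> (real^3 \<Rightarrow> real^3^3) \<Rightarrow> real" where
  "bracket_mat F \<Phi> = (\<Sum>i\<in>UNIV. \<Sum>j\<in>UNIV. (F $ i $ j) (\<lambda>x. \<Phi> x $ i $ j))"

text \<open>The distributional identities in space are required for almost every time.\<close>

definition functional_vorticity_solution ::
    "(real^3 \<Rightarrow> real) \<Rightarrow> real \<Rightarrow> (real \<Rightarrow> functional^3) \<Rightarrow> (real \<Rightarrow> functional^3) \<Rightarrow> bool" where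
  "functional_vorticity_solution \<theta> T u \<omega> \<longleftrightarrow>
     (\<exists>\<epsilon>>0. u \<in> bochner_Linf T (sobolev (1/2 + \<epsilon>)) (sobolev_norm (1/2 + \<epsilon>))) \<and>
     (AE t in lebesgue_on {0<..<T}. \<forall>i. dist_eq (\<omega> t $ i) (dist_curl (u t) $ i)) \<and>
     (AE t in lebesgue_on {0<..<T}. dist_eq (dist_div (u t)) (\<lambda>\<phi>. 0)) \<and>
     (AE t in lebesgue_on {0<..<T}. dist_eq (dist_div (\<omega> t)) (\<lambda>\<phi>. 0)) \<and>
     (\<forall>\<psi>. spacetime_test T \<psi> \<longrightarrow>
        (LINT t|lebesgue_on {0<..<T}. bracket_vec (\<omega> t) (time_deriv \<psi> t)) +
        (LINT t|lebesgue_on {0<..<T}.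
           bracket_mat (bony_tensor \<theta> (u t) (\<omega> t) - bony_tensor \<theta> (\<omega> t) (u t)) (space_grad \<psi> t)) = 0)"

text \<open>The duality of \<open>H\<^sup>-\<^sup>s\<close> and \<open>H\<^sup>s\<close> extending the \<open>L\<^sup>2\<close> inner product; the series
  converges absolutely on these spaces and is real.\<close>

definition sobolev_pairing :: "functional^3 \<Rightarrow> functional^3 \<Rightarrow> real" where
  "sobolev_pairing f g =
     (\<Sum>i\<in>UNIV. Re (\<Sum>\<^sub>\<infinity>k. fourier_coeff (f $ i) k * cnj (fourier_coeff (g $ i) k)))"

definition helicity :: "(real \<Rightarrow> functional^3) \<Rightarrow> (real \<Rightarrow> functional^3) \<Rightarrow> real \<Rightarrow> real" where
  "helicity u \<omega> t = sobolev_pairing (\<omega> t) (u t)"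

end

theory Submission
  imports Defs "HOL-Computational_Algebra.Polynomial"
begin

text \<open>
  Tested with single Fourier modes, the weak formulation says that every Fourier coefficient of \<open>\<omega>\<close>
  is absolutely continuous in time, with derivative the coefficient of \<open>curl (u \<times> \<omega>)\<close>. Let \<open>S\<close> be a
  Fourier multiplier whose symbol has bounded support and whose kernel is nonnegative. The helicity
  of \<open>S u\<close> is then a finite quadratic form in these coefficients, and its time derivative is twice
  the flux \<open>\<integral> S(u \<times> \<omega>) \<bullet> S \<omega>\<close>. As \<open>S u\<close> is divergence-free, the flux only sees the commutator
  \<open>S(u \<otimes> u) - S u \<otimes> S u\<close> (Constantin, E and Titi), which is a variance of translates of \<open>u\<close>. If the
  Littlewood-Paley blocks satisfy \<open>\<parallel>\<Delta>\<^sub>n u\<parallel> \<le> B r\<^sup>n\<close> in \<open>L\<^sup>3\<close> with \<open>r = 2\<^sup>-\<^sup>s\<close>, then at scale \<open>2\<^sup>-\<^sup>q\<close> the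
  commutator is \<open>O(r\<^sup>2\<^sup>q)\<close> in \<open>L\<^sup>3\<^sup>/\<^sup>2\<close> and \<open>\<nabla>S \<omega>\<close> is \<open>O((4 r)\<^sup>q)\<close> in \<open>L\<^sup>3\<close>. The flux is therefore
  \<open>O(B\<^sup>3 (4 r\<^sup>3)\<^sup>q)\<close>, and \<open>4 r\<^sup>3 < 1\<close> precisely when \<open>s > 2/3\<close>.
\<close>

section \<open>Smooth functions\<close>

text \<open>The mollifier must meet two demands at once: a nonnegative kernel, so that the
  commutator is a variance and only second moments of the shifts enter, and a symbol of bounded
  support, so that the truncated helicity is a finite sum whose terms can be differentiated in time.
  The given cutoff \<open>\<theta>\<close> need not have a nonnegative kernel, so two truncations
  coexist: \<open>\<theta>\<close> sorts frequencies into blocks, and a separate symbol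
  \<open>lam\<close> mollifies. Convolutions are discretised: sampled at enough roots of unity, a
  kernel acts on trigonometric polynomials of bounded degree as a finite weighted sum of
  translations, and translations preserve the \<open>L^3\<close> norm. Bernstein's inequality and
  the variance formula are both of this kind. The flux is therefore estimated for Littlewood-Paley
  truncations of \<open>u\<close>, uniformly in the truncation, and the bound is passed to the
  limit. This limit and the evaluation of Bony's products rest on \<open>H^(1/2)\<close>: half of
  the derivative in \<open>\<omega>\<close> can be moved onto \<open>u\<close>, so the convolution
  of their coefficients converges absolutely at each frequency.\<close>

lemma iter_deriv_snoc:
  "iter_deriv (vs @ [v]) f = iter_deriv vs (\<lambda>x. frechet_derivative f (at x) v)"
  by (induction vs) auto

text \<open>\<open>iter_deriv\<close> adds each new derivative on the outside, so all iterates stay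
  in a set that is closed under directional derivatives. Smoothness of an explicit function thus
  reduces to exhibiting such a set.\<close>

lemma smooth_coinduct:
  assumes "f \<in> S" and diff: "\<And>g x. g \<in> S \<Longrightarrow> g differentiable (at x)"
    and deriv: "\<And>g v. g \<in> S \<Longrightarrow> (\<lambda>x. frechet_derivative g (at x) v) \<in> S"
  shows "smooth f"
proof -
  have "iter_deriv vs f \<in> S" for vs
    by (induction vs) (auto simp: assms)
  then show ?thesis by (auto simp: smooth_def diff)
qed

lemma smooth_imp_differentiable: "smooth f \<Longrightarrow> f differentiable (at x)"
  unfolding smooth_def by (metis iter_deriv.simps(1))

lemma smooth_frechet_derivative: "smooth f \<Longrightarrow> smooth (\<lambda>x. frechet_derivative f (at x) v)"
  unfolding smooth_def by (metis iter_deriv_snoc)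

lemma smooth_intro:
  assumes "\<And>x. f differentiable (at x)" "\<And>v. smooth (\<lambda>x. frechet_derivative f (at x) v)"
  shows "smooth f"
  unfolding smooth_def
proof (intro allI)
  fix vs x show "iter_deriv vs f differentiable at x"
    by (cases vs rule: rev_cases)
      (use assms in \<open>auto simp: smooth_def iter_deriv_snoc\<close>)
qed

lemma smooth_has_derivative: "smooth f \<Longrightarrow> (f has_derivative frechet_derivative f (at x)) (at x)"
  using frechet_derivative_works smooth_imp_differentiable by blast

lemma smooth_const [simp]: "smooth (\<lambda>x. c)"
  by (rule smooth_coinduct[where S = "range (\<lambda>c x. c)"]) auto

lemma smooth_add: assumes "smooth f" "smooth g" shows "smooth (\<lambda>x. f x + g x)"
proof (rule smooth_coinduct[where S = "{\<lambda>x. f x + g x | f g. smooth f \<and> smooth g}"])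
  fix h :: "'a \<Rightarrow> 'b" and v assume "h \<in> {\<lambda>x. f x + g x | f g. smooth f \<and> smooth g}"
  then obtain f g where h: "h = (\<lambda>x. f x + g x)" and s: "smooth f" "smooth g" by auto
  have d: "(h has_derivative (\<lambda>v. frechet_derivative f (at x) v + frechet_derivative g (at x) v)) (at x)" for x
    unfolding h by (intro has_derivative_add smooth_has_derivative s)
  show "h differentiable (at x)" for x using d differentiable_def by blast
  have "(\<lambda>x. frechet_derivative h (at x) v)
      = (\<lambda>x. frechet_derivative f (at x) v + frechet_derivative g (at x) v)"
    by (rule ext) (simp flip: frechet_derivative_at[OF d])
  then show "(\<lambda>x. frechet_derivative h (at x) v) \<in> {\<lambda>x. f x + g x | f g. smooth f \<and> smooth g}"
    using s[THEN smooth_frechet_derivative, of v]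
    by (intro CollectI exI[of _ "\<lambda>x. frechet_derivative f (at x) v"] exI[of _ "\<lambda>x. frechet_derivative g (at x) v"]) simp
qed (use assms in auto)

text \<open>Differentiating a product gives a sum of two products by the Leibniz rule, so sums are
  adjoined to obtain a set closed under differentiation.\<close>

inductive_set smooth_products :: "('a::real_normed_vector \<Rightarrow> 'b::real_normed_vector) set" where
  base: "smooth f \<Longrightarrow> smooth g \<Longrightarrow> (\<lambda>x. f x *\<^sub>R g x) \<in> smooth_products"
| add: "f \<in> smooth_products \<Longrightarrow> g \<in> smooth_products \<Longrightarrow> (\<lambda>x. f x + g x) \<in> smooth_products"

lemma smooth_products_derivative:
  assumes "h \<in> smooth_products"
  shows "h differentiable (at x) \<and> (\<lambda>x. frechet_derivative h (at x) v) \<in> smooth_products"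
  using assms
proof (induction arbitrary: x rule: smooth_products.induct)
  case (base f g)
  have d: "((\<lambda>x. f x *\<^sub>R g x) has_derivative
      (\<lambda>v. f x *\<^sub>R frechet_derivative g (at x) v + frechet_derivative f (at x) v *\<^sub>R g x)) (at x)" for x
    by (intro has_derivative_scaleR smooth_has_derivative base)
  have "(\<lambda>x. frechet_derivative (\<lambda>x. f x *\<^sub>R g x) (at x) v)
      = (\<lambda>x. f x *\<^sub>R frechet_derivative g (at x) v + frechet_derivative f (at x) v *\<^sub>R g x)"
    by (rule ext) (simp flip: frechet_derivative_at[OF d])
  moreover have "\<dots> \<in> smooth_products"
    by (intro smooth_products.intros base smooth_frechet_derivative)
  ultimately show ?case using differentiableI[OF d] by simp
next
  case (add f g)
  have d: "((\<lambda>x. f x + g x) has_derivative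
      (\<lambda>v. frechet_derivative f (at x) v + frechet_derivative g (at x) v)) (at x)" for x
    by (intro has_derivative_add iffD1[OF frechet_derivative_works] conjunct1[OF add.IH(1)] conjunct1[OF add.IH(2)])
  have eq: "(\<lambda>x. frechet_derivative (\<lambda>x. f x + g x) (at x) v)
      = (\<lambda>x. frechet_derivative f (at x) v + frechet_derivative g (at x) v)"
  proof
    show "frechet_derivative (\<lambda>x. f x + g x) (at x) v
        = frechet_derivative f (at x) v + frechet_derivative g (at x) v" for x
      by (simp flip: frechet_derivative_at[OF d])
  qed
  show ?case
    unfolding eq
  proof
    show "(\<lambda>a. f a + g a) differentiable at x"
      using d by (rule differentiableI)
  qed (intro smooth_products.add conjunct2[OF add.IH(1)] conjunct2[OF add.IH(2)])
qed

lemma smooth_scaleR: assumes "smooth f" "smooth g" shows "smooth (\<lambda>x. f x *\<^sub>R g x)"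
  by (rule smooth_coinduct[where S = smooth_products])
    (intro smooth_products.base assms conjunct1[OF smooth_products_derivative]
      conjunct2[OF smooth_products_derivative]; assumption)+

lemma smooth_mult:
  fixes f g :: "'a::real_normed_vector \<Rightarrow> real"
  shows "smooth f \<Longrightarrow> smooth g \<Longrightarrow> smooth (\<lambda>x. f x * g x)"
  using smooth_scaleR[of f g] by simp

lemma smooth_compose_affine:
  assumes L: "bounded_linear L" and "smooth g"
  shows "smooth (\<lambda>x. g (L x + c))"
proof (rule smooth_coinduct[where S = "{\<lambda>x. g (L x + c) | g. smooth g}"])
  fix h v assume "h \<in> {\<lambda>x. g (L x + c) | g. smooth g}"
  then obtain g where h: "h = (\<lambda>x. g (L x + c))" and s: "smooth g" by auto
  have d: "(h has_derivative (\<lambda>v. frechet_derivative g (at (L x + c)) (L v))) (at x)" for x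
    unfolding h
    using diff_chain_at[OF has_derivative_add_const[OF bounded_linear_imp_has_derivative[OF L]]
        smooth_has_derivative[OF s]] by (simp add: o_def)
  show "h differentiable (at x)" for x using d differentiable_def by blast
  have "(\<lambda>x. frechet_derivative h (at x) v) = (\<lambda>x. frechet_derivative g (at (L x + c)) (L v))"
    by (rule ext) (simp flip: frechet_derivative_at[OF d])
  then show "(\<lambda>x. frechet_derivative h (at x) v) \<in> {\<lambda>x. g (L x + c) | g. smooth g}"
    using smooth_frechet_derivative[OF s, of "L v"] by (intro CollectI exI[of _ "\<lambda>y. frechet_derivative g (at y) (L v)"]) simp
qed (use assms in auto)

lemma smooth_compose_linear:
  assumes "bounded_linear L" and "smooth g"
  shows "smooth (\<lambda>x. g (L x))"
  using smooth_compose_affine[OF assms, of 0] by simp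

lemma frechet_derivative_real:
  fixes f :: "real \<Rightarrow> real"
  assumes "(f has_real_derivative f') (at x)"
  shows "frechet_derivative f (at x) v = f' * v"
  using frechet_derivative_at[OF assms[unfolded has_field_derivative_def]] by metis

lemma smooth_antiderivative:
  fixes f :: "real \<Rightarrow> real"
  assumes d: "\<And>x. (f has_real_derivative f' x) (at x)" and "smooth f'"
  shows "smooth f"
proof (rule smooth_intro)
  show "f differentiable (at x)" for x
    using d[of x] real_differentiable_def by blast
  show "smooth (\<lambda>x. frechet_derivative f (at x) v)" for v
    using smooth_mult[OF assms(2) smooth_const[of v]] frechet_derivative_real[OF d] by simp
qed

lemma smooth_sin_cos: fixes a b :: real shows "smooth (\<lambda>x. a * cos x + b * sin x)"
proof (rule smooth_coinduct[where S = "{\<lambda>x. a * cos x + b * sin x | a b :: real. True}"])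
  fix h :: "real \<Rightarrow> real" and v assume "h \<in> {\<lambda>x. a * cos x + b * sin x | a b. True}"
  then obtain a b where h: "h = (\<lambda>x. a * cos x + b * sin x)" by auto
  have d: "(h has_real_derivative (b * cos x - a * sin x)) (at x)" for x
    unfolding h by (auto intro!: derivative_eq_intros)
  show "h differentiable (at x)" for x using d[of x] real_differentiable_def by blast
  have "(\<lambda>x. frechet_derivative h (at x) v) = (\<lambda>x. (b * v) * cos x + (- a * v) * sin x)"
    by (rule ext) (simp add: frechet_derivative_real[OF d] algebra_simps)
  then show "(\<lambda>x. frechet_derivative h (at x) v) \<in> {\<lambda>x. a * cos x + b * sin x | a b. True}"
    by blast
qed auto

section \<open>Bump functions\<close>

text \<open>For \<open>p = 1\<close> this is the classical flat function \<open>exp (- 1/t)\<close>.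
  Allowing a polynomial in \<open>1/t\<close> as a factor makes the family closed under
  differentiation.\<close>

definition flat :: "real poly \<Rightarrow> real \<Rightarrow> real" where
  "flat p t = (if t > 0 then poly p (1 / t) * exp (- (1 / t)) else 0)"

lemma poly_times_exp_tendsto_0: "((\<lambda>y::real. poly p y * exp (- y)) \<longlongrightarrow> 0) at_top"
proof -
  have "((\<lambda>y::real. \<Sum>i\<le>degree p. coeff p i * (y ^ i / exp y)) \<longlongrightarrow> (\<Sum>i\<le>degree p. coeff p i * 0)) at_top"
    by (intro tendsto_intros tendsto_power_div_exp_0)
  then show ?thesis
    by (simp add: poly_altdef sum_distrib_right exp_minus divide_inverse mult.assoc)
qed

lemma flat_has_derivative:
  "(flat p has_real_derivative flat (monom 1 2 * (p - pderiv p)) t) (at t)"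
proof -
  consider "t > 0" | "t < 0" | "t = 0" by linarith
  then show ?thesis
  proof cases
    case 1
    have "((\<lambda>t. poly p (1 / t) * exp (- (1 / t))) has_real_derivative
        flat (monom 1 2 * (p - pderiv p)) t) (at t)"
      using 1 by (auto intro!: derivative_eq_intros simp: flat_def poly_monom field_simps power2_eq_square)
    then show ?thesis
      by (rule has_field_derivative_transform_within_open[where S = "{0<..}"]) (use 1 in \<open>auto simp: flat_def\<close>)
  next
    case 2
    have "((\<lambda>t. 0) has_real_derivative flat (monom 1 2 * (p - pderiv p)) t) (at t)"
      using 2 by (auto simp: flat_def)
    then show ?thesis
      by (rule has_field_derivative_transform_within_open[where S = "{..<0}"]) (use 2 in \<open>auto simp: flat_def\<close>)
  next
    \<comment> \<open>At the origin the right difference quotient becomes, in the variable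
      \<open>1/y\<close>, a polynomial times a decaying exponential at infinity;
      \<open>pCons 0 p\<close> absorbs the division by \<open>y\<close>.\<close>
    case 3
    have "((\<lambda>y. flat p y / y) \<longlongrightarrow> 0) (at_right 0)"
    proof (rule Lim_transform_eventually)
      show "((\<lambda>y::real. poly (pCons 0 p) (inverse y) * exp (- inverse y)) \<longlongrightarrow> 0) (at_right 0)"
        by (rule filterlim_compose[OF poly_times_exp_tendsto_0 filterlim_inverse_at_top_right])
      show "eventually (\<lambda>y. poly (pCons 0 p) (inverse y) * exp (- inverse y) = flat p y / y) (at_right 0)"
        by (auto simp: eventually_at_right[of 0 1] flat_def field_simps intro!: exI[of _ 1])
    qed
    moreover have "((\<lambda>y. flat p y / y) \<longlongrightarrow> 0) (at_left 0)"
      by (rule Lim_transform_eventually[OF tendsto_const])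
        (auto simp: eventually_at_left[of "-1" 0] flat_def intro!: exI[of _ "-1"])
    ultimately have "((\<lambda>y. flat p y / y) \<longlongrightarrow> 0) (at 0)"
      using filterlim_split_at by blast
    then show ?thesis
      using 3 by (simp add: has_field_derivative_iff flat_def)
  qed
qed

lemma smooth_flat: "smooth (flat p)"
proof (rule smooth_coinduct[where S = "range flat"])
  fix g :: "real \<Rightarrow> real" and v assume "g \<in> range flat"
  then obtain p where g: "g = flat p" by auto
  show "g differentiable (at x)" for x
    using flat_has_derivative real_differentiable_def g by blast
  have "(\<lambda>x. frechet_derivative g (at x) v) = flat (smult v (monom 1 2 * (p - pderiv p)))"
    unfolding g by (rule ext) (simp add: frechet_derivative_real[OF flat_has_derivative], simp add: flat_def)
  then show "(\<lambda>x. frechet_derivative g (at x) v) \<in> range flat" by blast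
qed auto

text \<open>The factor \<open>Suc n\<close> steepens both edges: inside the interval the exponents
  tend to 0 and the bump to 1. The bumps are thus smooth approximations of the indicator, dominated
  by 1.\<close>

definition bump :: "real \<Rightarrow> real \<Rightarrow> nat \<Rightarrow> real \<Rightarrow> real" where
  "bump a b n t = flat 1 (real (Suc n) * (t - a)) * flat 1 (real (Suc n) * (b - t))"

lemma smooth_bump: "smooth (bump a b n)"
proof -
  have "smooth (\<lambda>t. flat 1 (c * t + d))" for c d
    by (rule smooth_compose_affine[OF bounded_linear_mult_right smooth_flat])
  from this[of "real (Suc n)" "- real (Suc n) * a"] this[of "- real (Suc n)" "real (Suc n) * b"]
  show ?thesis unfolding bump_def[abs_def]
    by (intro smooth_mult) (simp_all add: algebra_simps)
qed

lemma bump_eq_0: "t \<notin> {a<..<b} \<Longrightarrow> bump a b n t = 0"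
  by (auto simp: bump_def flat_def zero_less_mult_iff)

lemma bump_bounds: "0 \<le> bump a b n t" "bump a b n t \<le> 1"
  by (auto simp: bump_def flat_def zero_less_mult_iff mult_le_one)

lemma bump_tendsto: "(\<lambda>n. bump a b n t) \<longlonglongrightarrow> indicator {a<..<b} t"
proof (cases "t \<in> {a<..<b}")
  case True
  have *: "(\<lambda>n. exp (- (1 / (real (Suc n) * c)))) \<longlonglongrightarrow> exp (- 0)" for c :: real
  proof (intro tendsto_intros)
    have "(\<lambda>n. inverse (real (Suc n)) * (1 / c)) \<longlonglongrightarrow> 0 * (1 / c)"
      by (intro tendsto_intros LIMSEQ_inverse_real_of_nat)
    then show "(\<lambda>n. 1 / (real (Suc n) * c)) \<longlonglongrightarrow> 0"
      by (simp add: field_simps)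
  qed
  have "bump a b n t = exp (- (1 / (real (Suc n) * (t - a)))) * exp (- (1 / (real (Suc n) * (b - t))))" for n
    using True by (auto simp: bump_def flat_def)
  then show ?thesis
    using tendsto_mult[OF *[of "t - a"] *[of "b - t"]] True by simp
qed (simp add: bump_eq_0)

section \<open>The du Bois-Reymond lemma on an open time interval\<close>

lemma finite_measure_lebesgue_on_Ioo: "finite_measure (lebesgue_on {a<..<b::real})"
  by (intro finite_measure_lebesgue_on) (simp flip: box_real)

lemma integrable_lebesgue_on_Ioo:
  fixes f :: "real \<Rightarrow> 'a::{banach, second_countable_topology}"
  assumes "f \<in> borel_measurable (lebesgue_on {a<..<b})" "\<And>t. t \<in> {a<..<b} \<Longrightarrow> norm (f t) \<le> C"
  shows "integrable (lebesgue_on {a<..<b}) f"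
  by (rule finite_measure.integrable_const_bound[OF finite_measure_lebesgue_on_Ioo, where B = C])
    (use assms in auto)

lemma continuous_imp_measurable_lebesgue_on:
  fixes f :: "real \<Rightarrow> 'a::real_normed_vector"
  assumes "continuous_on UNIV f"
  shows "f \<in> borel_measurable (lebesgue_on S)"
  using borel_measurable_continuous_onI[OF assms]
  by (simp add: measurable_completion measurable_restrict_space1)

lemma indicator_measurable_lebesgue_on:
  assumes "A \<in> sets borel"
  shows "(indicator A :: real \<Rightarrow> real) \<in> borel_measurable (lebesgue_on S)"
proof -
  have "(indicator A :: real \<Rightarrow> real) \<in> borel_measurable borel" using assms by simp
  then show ?thesis by (simp add: measurable_completion measurable_restrict_space1)
qed

lemma smooth_imp_continuous_on: "smooth f \<Longrightarrow> continuous_on S f"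
  by (meson differentiable_imp_continuous_on differentiable_at_imp_differentiable_on smooth_imp_differentiable)

text \<open>A vanishing integral is what makes the antiderivative return to 0 to the right of the
  support.\<close>

lemma smooth_antiderivative_compact_support:
  fixes g :: "real \<Rightarrow> real"
  assumes g: "smooth g" and supp: "\<And>t. t \<notin> {a..b} \<Longrightarrow> g t = 0"
    and ab: "a \<le> b" and int: "integral {a..b} g = 0"
  obtains \<eta> where "smooth \<eta>" "\<And>t. (\<eta> has_real_derivative g t) (at t)" "\<And>t. t \<notin> {a..b} \<Longrightarrow> \<eta> t = 0"
proof -
  \<comment> \<open>Starting at \<open>a - 1\<close> keeps \<open>a\<close> interior to the range of
    integration, so the fundamental theorem gives a two-sided derivative there too.\<close>
  define \<eta> where "\<eta> t = integral {a-1..t} g" for t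
  have cont: "continuous_on S g" for S using smooth_imp_continuous_on[OF g] .
  have intg: "g integrable_on {c..d}" for c d by (rule integrable_continuous_real[OF cont])
  have left: "\<eta> t = 0" if "t < a" for t
  proof -
    have "integral {a-1..t} g = integral {a-1..t} (\<lambda>x. 0)"
      by (rule integral_cong) (use that supp in auto)
    then show ?thesis by (simp add: \<eta>_def)
  qed
  have right: "\<eta> t = 0" if "b < t" for t
  proof -
    have 1: "integral {a-1..t} g = integral {a-1..a} g + integral {a..t} g"
      using that ab by (intro Henstock_Kurzweil_Integration.integral_combine[symmetric] intg) auto
    have 2: "integral {a..t} g = integral {a..b} g + integral {b..t} g"
      using that ab by (intro Henstock_Kurzweil_Integration.integral_combine[symmetric] intg) auto
    have 3: "integral {a-1..a} g = integral {a-1..a} (\<lambda>x. 0)"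
      by (rule integral_spike[where S = "{a}"]) (use supp in auto)
    have 4: "integral {b..t} g = integral {b..t} (\<lambda>x. 0)"
      by (rule integral_spike[where S = "{b}"]) (use supp in auto)
    show ?thesis using 1 2 3 4 int by (simp add: \<eta>_def)
  qed
  have deriv: "(\<eta> has_real_derivative g t) (at t)" for t
  proof (cases "t < a")
    case True
    have "((\<lambda>t. 0) has_real_derivative g t) (at t)" using True supp[of t] by simp
    then show ?thesis
      by (rule has_field_derivative_transform_within_open[where S = "{..<a}"]) (use True left in auto)
  next
    case False
    have "(\<eta> has_real_derivative g t) (at t within {a-1..t+1})"
      unfolding \<eta>_def using False by (intro integral_has_real_derivative cont) auto
    then have "(\<eta> has_real_derivative g t) (at t within {a-1<..<t+1})"
      by (rule DERIV_subset) auto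
    then show ?thesis using False by (subst (asm) at_within_open) auto
  qed
  show ?thesis
    by (rule that[of \<eta>]) (use smooth_antiderivative[OF deriv g] deriv left right in force)+
qed

text \<open>The positive and the negative part of \<open>w\<close> are densities of two finite
  measures that agree on half-lines and hence everywhere; equal measures have almost everywhere
  equal densities.\<close>

lemma integral_eq_0_Ioi_imp_AE_0:
  fixes w :: "real \<Rightarrow> real"
  assumes w: "integrable lborel w" and 0: "\<And>x. (LINT t|lborel. indicator {x<..} t * w t) = 0"
  shows "AE t in lborel. w t = 0"
proof -
  have [measurable]: "w \<in> borel_measurable borel" using w by auto
  define P where "P = (\<lambda>t. ennreal (max 0 (w t)))"
  define N where "N = (\<lambda>t. ennreal (max 0 (- w t)))"
  have [measurable]: "P \<in> borel_measurable borel" "N \<in> borel_measurable borel"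
    by (simp_all add: P_def N_def)
  have ip: "integrable lborel (\<lambda>t. indicator {x<..} t * max 0 (w t))" for x
    by (rule Bochner_Integration.integrable_bound[OF w]) (auto simp: indicator_def)
  have inn: "integrable lborel (\<lambda>t. indicator {x<..} t * max 0 (- w t))" for x
    by (rule Bochner_Integration.integrable_bound[OF w]) (auto simp: indicator_def)
  have eP: "emeasure (density lborel P) {x<..} = ennreal (LINT t|lborel. indicator {x<..} t * max 0 (w t))" for x
    by (subst emeasure_density, simp, simp, subst nn_integral_eq_integral[symmetric, OF ip])
      (auto simp: P_def indicator_def intro!: nn_integral_cong)
  have eN: "emeasure (density lborel N) {x<..} = ennreal (LINT t|lborel. indicator {x<..} t * max 0 (- w t))" for x
    by (subst emeasure_density, simp, simp, subst nn_integral_eq_integral[symmetric, OF inn])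
      (auto simp: N_def indicator_def intro!: nn_integral_cong)
  have "(LINT t|lborel. indicator {x<..} t * max 0 (w t)) - (LINT t|lborel. indicator {x<..} t * max 0 (- w t))
      = (LINT t|lborel. indicator {x<..} t * w t)" for x
    by (subst Bochner_Integration.integral_diff[symmetric, OF ip inn])
      (auto simp: indicator_def max_def intro!: Bochner_Integration.integral_cong)
  then have eq: "emeasure (density lborel P) {x<..} = emeasure (density lborel N) {x<..}" for x
    unfolding eP eN using 0[of x] by (metis eq_iff_diff_eq_0)
  have "density lborel P = density lborel N"
    by (rule measure_eqI_lessThan) (auto simp: eq eN)
  then have "AE t in lborel. P t = N t"
    by (intro sigma_finite_measure.density_unique[OF sigma_finite_lborel]) auto
  then show ?thesis
    by eventually_elim (auto simp: P_def N_def max_def split: if_splits)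
qed

lemma AE_0_lebesgue_on_Ioo:
  fixes w :: "real \<Rightarrow> real"
  assumes T: "T > 0" and w: "w \<in> borel_measurable (lebesgue_on {0<..<T})"
    and bd: "\<And>t. t \<in> {0<..<T} \<Longrightarrow> \<bar>w t\<bar> \<le> C"
    and 0: "\<And>a b. 0 < a \<Longrightarrow> a < b \<Longrightarrow> b < T \<Longrightarrow> (LINT t|lebesgue_on {0<..<T}. indicator {a<..<b} t * w t) = 0"
  shows "AE t in lebesgue_on {0<..<T}. w t = 0"
proof -
  let ?M = "lebesgue_on {0<..<T}"
  have iw: "integrable ?M w" using bd by (intro integrable_lebesgue_on_Ioo[OF w]) auto
  have x0: "(LINT t|?M. indicator {x<..} t * w t) = 0" for x
  proof (rule LIMSEQ_unique)
    \<comment> \<open>When nonempty, these intervals have both end points inside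
      \<open>(0,T)\<close>. They exhaust the part of \<open>(0,T)\<close> to the right of
      \<open>x\<close>, which reduces half-lines to the intervals of the hypothesis.\<close>
    define a where "a n = max x (T / real (n + 2))" for n
    define b where "b n = T - T / real (n + 2)" for n
    have lim: "(\<lambda>n. T / real (n + 2)) \<longlonglongrightarrow> 0"
      using LIMSEQ_ignore_initial_segment[OF tendsto_divide_0[OF tendsto_const[of T] filterlim_real_at_infinity_sequentially], of 2]
      by simp
    show "(\<lambda>n. LINT t|?M. indicator {a n<..<b n} t * w t) \<longlonglongrightarrow> (LINT t|?M. indicator {x<..} t * w t)"
    proof (rule integral_dominated_convergence[where w = "\<lambda>t. \<bar>w t\<bar>"])
      show "AE t in ?M. (\<lambda>n. indicator {a n<..<b n} t * w t) \<longlonglongrightarrow> indicator {x<..} t * w t"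
      proof (rule AE_I2)
        fix t assume t: "t \<in> space ?M"
        have "eventually (\<lambda>n. T / real (n + 2) < min t (T - t)) sequentially"
          using order_tendstoD(2)[OF lim, of "min t (T - t)"] t by simp
        then have "eventually (\<lambda>n. indicator {a n<..<b n} t * w t = indicator {x<..} t * w t) sequentially"
          by eventually_elim (auto simp: a_def b_def indicator_def)
        then show "(\<lambda>n. indicator {a n<..<b n} t * w t) \<longlonglongrightarrow> indicator {x<..} t * w t"
          by (rule tendsto_eventually)
      qed
    next
      show "AE t in ?M. norm (indicator {a n<..<b n} t * w t) \<le> \<bar>w t\<bar>" for n
        by (simp add: indicator_def)
    qed (use iw w in \<open>auto intro!: borel_measurable_times indicator_measurable_lebesgue_on\<close>)
    have "(LINT t|?M. indicator {a n<..<b n} t * w t) = 0" for n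
    proof (cases "a n < b n")
      case True
      have "0 < T / real (n + 2)" using T by simp
      then have "0 < a n" "b n < T" unfolding a_def b_def by linarith+
      with True show ?thesis using 0 by blast
    qed simp
    then show "(\<lambda>n. LINT t|?M. indicator {a n<..<b n} t * w t) \<longlonglongrightarrow> 0" by simp
  qed
  \<comment> \<open>The half-line criterion concerns Borel functions, whereas \<open>w\<close> is
    only Lebesgue measurable; extension by zero and a Borel representative bridge the gap.\<close>
  define v where "v t = indicator {0<..<T} t * w t" for t
  have vm: "v \<in> borel_measurable (completion lborel)"
    using w unfolding v_def by (subst (asm) borel_measurable_restrict_space_iff) auto
  obtain v' where v': "v' \<in> borel_measurable lborel" and ae: "AE t in lborel. v t = v' t"
    using completion_ex_borel_measurable_real[OF vm] by auto
  have ae': "AE t in lebesgue. v t = v' t" using ae by (rule AE_completion)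
  have iv: "integrable lebesgue v"
    using iw unfolding v_def by (subst (asm) integrable_restrict_space) auto
  have v'l: "v' \<in> borel_measurable lebesgue" using v' measurable_completion by blast
  have iv': "integrable lborel v'"
    using Bochner_Integration.integrable_cong_AE_imp[OF iv v'l] ae' v'
    by (subst integrable_completion[symmetric]) (auto elim: AE_mp)
  have "AE t in lborel. v' t = 0"
  proof (rule integral_eq_0_Ioi_imp_AE_0[OF iv'])
    fix x
    have "(LINT t|lborel. indicator {x<..} t * v' t) = (LINT t|lebesgue. indicator {x<..} t * v' t)"
      using v' by (intro integral_completion[symmetric]) simp
    also have "\<dots> = (LINT t|lebesgue. indicator {x<..} t * v t)"
    proof (rule integral_cong_AE)
      have i: "(indicator {x<..} :: real \<Rightarrow> real) \<in> borel_measurable lebesgue"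
        using indicator_measurable_lebesgue_on[of "{x<..}" UNIV] by (simp add: lebesgue_on_UNIV_eq)
      show "(\<lambda>t. indicator {x<..} t * v' t) \<in> borel_measurable lebesgue"
        "(\<lambda>t. indicator {x<..} t * v t) \<in> borel_measurable lebesgue"
        using i v'l vm by auto
    qed (use ae' in \<open>auto elim: AE_mp\<close>)
    also have "\<dots> = (LINT t|?M. indicator {x<..} t * w t)"
      by (subst integral_restrict_space) (auto simp: v_def ac_simps)
    finally show "(LINT t|lborel. indicator {x<..} t * v' t) = 0" using x0 by simp
  qed
  then have "AE t in lebesgue. v' t = 0" by (rule AE_completion)
  with ae' have "AE t in lebesgue. v t = 0" by eventually_elim simp
  then show ?thesis
    by (subst AE_restrict_space_iff) (auto simp: v_def elim: AE_mp)
qed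

text \<open>The derivative is a second argument because du Bois-Reymond starts from a prescribed
  \<open>\<eta>'\<close> and constructs \<open>\<eta>\<close> from it.\<close>

definition time_test :: "real \<Rightarrow> (real \<Rightarrow> real) \<Rightarrow> (real \<Rightarrow> real) \<Rightarrow> bool" where
  "time_test T \<eta> \<eta>' \<longleftrightarrow> smooth \<eta> \<and> smooth \<eta>' \<and> (\<forall>t. (\<eta> has_real_derivative \<eta>' t) (at t)) \<and>
     (\<exists>a b. 0 < a \<and> a < b \<and> b < T \<and> (\<forall>t. t \<notin> {a..b} \<longrightarrow> \<eta> t = 0))"

text \<open>A combination of two bumps with total integral 0 is the derivative of a test function.
  Hence the weighted mean of \<open>v\<close> is the same for any two bumps, and sharpening the
  bumps to indicators gives the same mean over every interval.\<close>

theorem du_bois_reymond: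
  fixes v :: "real \<Rightarrow> real"
  assumes T: "T > 0" and v: "v \<in> borel_measurable (lebesgue_on {0<..<T})"
    and bd: "\<And>t. t \<in> {0<..<T} \<Longrightarrow> \<bar>v t\<bar> \<le> C"
    and 0: "\<And>\<eta> \<eta>'. time_test T \<eta> \<eta>' \<Longrightarrow> (LINT t|lebesgue_on {0<..<T}. v t * \<eta>' t) = 0"
  shows "\<exists>c. AE t in lebesgue_on {0<..<T}. v t = c"
proof -
  let ?M = "lebesgue_on {0<..<T}"
  interpret finite_measure ?M by (rule finite_measure_lebesgue_on_Ioo)
  have bm: "bump a b n \<in> borel_measurable ?M" for a b n
    by (intro continuous_imp_measurable_lebesgue_on smooth_imp_continuous_on smooth_bump)
  have ib: "integrable ?M (bump a b n)" for a b n
    by (rule integrable_lebesgue_on_Ioo[OF bm, where C = 1]) (simp add: bump_bounds)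
  have ivb: "integrable ?M (\<lambda>t. v t * bump a b n t)" for a b n
  proof (rule integrable_lebesgue_on_Ioo[of _ _ _ C])
    show "norm (v t * bump a b n t) \<le> C" if "t \<in> {0<..<T}" for t
      using mult_mono[OF bd[OF that] bump_bounds(2)[of a b n t]] bump_bounds(1)[of a b n t] bd[OF that]
      by (simp add: abs_mult)
  qed (use v bm in simp)
  have lim1: "(\<lambda>n. LINT t|?M. bump a b n t) \<longlonglongrightarrow> (LINT t|?M. indicator {a<..<b} t)" for a b
    by (rule integral_dominated_convergence[where w = "\<lambda>t. 1"])
      (auto simp: bump_tendsto bump_bounds bm intro!: indicator_measurable_lebesgue_on)
  have limv: "(\<lambda>n. LINT t|?M. v t * bump a b n t) \<longlonglongrightarrow> (LINT t|?M. v t * indicator {a<..<b} t)" for a b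
  proof (rule integral_dominated_convergence[where w = "\<lambda>t. \<bar>v t\<bar>"])
    show "integrable ?M (\<lambda>t. \<bar>v t\<bar>)"
      using bd by (intro integrable_abs integrable_lebesgue_on_Ioo[OF v]) auto
    show "AE t in ?M. norm (v t * bump a b n t) \<le> \<bar>v t\<bar>" for n
      using bump_bounds[of a b n] by (intro AE_I2) (simp add: abs_mult mult_left_le)
  qed (auto intro!: tendsto_intros bump_tendsto borel_measurable_times v bm indicator_measurable_lebesgue_on)
  have J: "integral {A..B} (bump a b n) = (LINT t|?M. bump a b n t)"
    if "0 < a" "b < T" "A \<le> a" "b \<le> B" "0 < A" "B < T" for a b n A B
  proof -
    have "(LINT t|?M. bump a b n t) = integral {0<..<T} (bump a b n)"
      by (rule lebesgue_integral_eq_integral[OF ib]) simp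
    also have "\<dots> = integral {A..B} (bump a b n)"
    proof (rule integral_spike_set; rule negligible_subset[of "{}"])
      have "bump a b n x = 0" if "x \<notin> {A..B}" for x
        using that \<open>A \<le> a\<close> \<open>b \<le> B\<close> by (intro bump_eq_0) auto
      then show "{x \<in> {0<..<T} - {A..B}. bump a b n x \<noteq> 0} \<subseteq> {}" by blast
    qed (use that in auto)
    finally show ?thesis by simp
  qed
  define J where "J a b n = (LINT t|?M. bump a b n t)" for a b n
  define K where "K a b n = (LINT t|?M. v t * bump a b n t)" for a b n
  have meas: "(LINT t|?M. indicator {a<..<b} t) = b - a" if "0 < a" "a < b" "b < T" for a b
  proof -
    have "(LINT t|?M. (indicator {a<..<b} t :: real)) = measure ?M ({a<..<b} \<inter> space ?M)"
      by (rule Bochner_Integration.integral_indicator)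
    also have "{a<..<b} \<inter> space ?M = {a<..<b}" using that by auto
    also have "measure ?M {a<..<b} = measure lebesgue {a<..<b}"
      using that by (intro measure_restrict_space) auto
    finally show ?thesis using that by simp
  qed
  have key: "J c d m * K a b n = J a b n * K c d m"
    if "0 < a" "a < b" "b < T" "0 < c" "c < d" "d < T" for a b c d m n
  proof -
    define A where "A = min a c" define B where "B = max b d"
    have AB: "0 < A" "A < B" "B < T" "A \<le> a" "A \<le> c" "b \<le> B" "d \<le> B"
      using that by (auto simp: A_def B_def)
    define g where "g t = J c d m * bump a b n t - J a b n * bump c d m t" for t
    have sg: "smooth g" unfolding g_def
      using smooth_add[OF smooth_mult[OF smooth_const[of "J c d m"] smooth_bump] smooth_mult[OF smooth_const[of "- J a b n"] smooth_bump]]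
      by simp
    have bi: "bump a b n integrable_on {A..B}" for a b n
      by (intro integrable_continuous_real smooth_imp_continuous_on smooth_bump)
    have bi': "(\<lambda>t. r * bump a b n t) integrable_on {A..B}" for a b n r
      using integrable_cmul[OF bi, of r a b n] by simp
    have "integral {A..B} g = integral {A..B} (\<lambda>t. J c d m * bump a b n t) - integral {A..B} (\<lambda>t. J a b n * bump c d m t)"
      unfolding g_def by (rule Henstock_Kurzweil_Integration.integral_diff[OF bi' bi'])
    also have "\<dots> = J c d m * integral {A..B} (bump a b n) - J a b n * integral {A..B} (bump c d m)"
      by simp
    also have "\<dots> = 0"
      using J[of a b A B n] J[of c d A B m] AB that by (simp add: J_def)
    finally have ig: "integral {A..B} g = 0" .
    have g0: "g t = 0" if "t \<notin> {A..B}" for t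
    proof -
      have "t \<notin> {a<..<b}" "t \<notin> {c<..<d}" using that AB by auto
      then show ?thesis unfolding g_def by (simp add: bump_eq_0)
    qed
    obtain \<eta> where "smooth \<eta>" "\<And>t. (\<eta> has_real_derivative g t) (at t)" "\<And>t. t \<notin> {A..B} \<Longrightarrow> \<eta> t = 0"
      using smooth_antiderivative_compact_support[OF sg g0 less_imp_le[OF AB(2)] ig] by metis
    then have "time_test T \<eta> g" unfolding time_test_def
      by (intro conjI allI sg exI[of _ A] exI[of _ B] AB impI) simp_all
    from 0[OF this] have "(LINT t|?M. J c d m * (v t * bump a b n t) - J a b n * (v t * bump c d m t)) = 0"
      by (simp add: g_def algebra_simps)
    then show ?thesis
      by (subst (asm) Bochner_Integration.integral_diff)
        (auto intro!: integrable_mult_right ivb simp: K_def)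
  qed
  \<comment> \<open>The mean of \<open>v\<close> over the reference interval
    \<open>(T/4, T/2)\<close>, which has length \<open>T/4\<close>.\<close>
  define c where "c = (LINT t|?M. v t * indicator {T/4<..<T/2} t) / (T / 4)"
  have "(LINT t|?M. indicator {a<..<b} t * (v t - c)) = 0" if ab: "0 < a" "a < b" "b < T" for a b
  proof -
    let ?a = "T/4" and ?b = "T/2"
    have q: "0 < ?a" "?a < ?b" "?b < T" using T by auto
    have "(\<lambda>n. J ?a ?b n * K a b n) \<longlonglongrightarrow> (?b - ?a) * (LINT t|?M. v t * indicator {a<..<b} t)"
      unfolding J_def K_def using lim1[of ?a ?b] unfolding meas[OF q] by (intro tendsto_mult limv)
    moreover have "(\<lambda>n. J a b n * K ?a ?b n) \<longlonglongrightarrow> (b - a) * (LINT t|?M. v t * indicator {?a<..<?b} t)"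
      unfolding J_def K_def using lim1[of a b] unfolding meas[OF ab] by (intro tendsto_mult limv)
    ultimately have "(?b - ?a) * (LINT t|?M. v t * indicator {a<..<b} t) = (b - a) * (LINT t|?M. v t * indicator {?a<..<?b} t)"
      by (simp only: key[OF ab q]) (rule LIMSEQ_unique)
    then have eq: "(LINT t|?M. v t * indicator {a<..<b} t) = (b - a) * c"
      using T by (simp add: c_def field_simps)
    have "(LINT t|?M. indicator {a<..<b} t * (v t - c)) = (LINT t|?M. v t * indicator {a<..<b} t - c * indicator {a<..<b} t)"
      by (simp add: algebra_simps)
    also have "\<dots> = (LINT t|?M. v t * indicator {a<..<b} t) - (LINT t|?M. c * indicator {a<..<b} t)"
    proof (rule Bochner_Integration.integral_diff)
      have im: "(indicator {a<..<b} :: real \<Rightarrow> real) \<in> borel_measurable ?M"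
        by (rule indicator_measurable_lebesgue_on) simp
      show "integrable ?M (\<lambda>t. v t * indicator {a<..<b} t)"
      proof (rule integrable_lebesgue_on_Ioo[of _ _ _ C])
        show "norm (v t * indicator {a<..<b} t) \<le> C" if "t \<in> {0<..<T}" for t
          using bd[OF that] by (auto simp: indicator_def)
      qed (use v im in simp)
      show "integrable ?M (\<lambda>t. c * indicator {a<..<b} t)"
        using im by (intro integrable_lebesgue_on_Ioo[of _ _ _ "\<bar>c\<bar>"] borel_measurable_times)
          (simp_all add: abs_mult mult_left_le)
    qed
    also have "\<dots> = 0" using meas[OF ab] eq by simp
    finally show ?thesis .
  qed
  then have "AE t in ?M. v t - c = 0"
  proof (intro AE_0_lebesgue_on_Ioo[OF T])
    show "\<bar>v t - c\<bar> \<le> C + \<bar>c\<bar>" if "t \<in> {0<..<T}" for t using bd[OF that] by linarith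
  qed (use v in auto)
  then show ?thesis by auto
qed

section \<open>Indefinite integrals of bounded functions\<close>

definition ivl_int :: "real \<Rightarrow> real \<Rightarrow> real \<Rightarrow> (real \<Rightarrow> 'a::{banach, second_countable_topology}) \<Rightarrow> 'a" where
  "ivl_int T s t g = (LINT \<tau>|lebesgue_on {0<..<T}. indicator {s<..t} \<tau> *\<^sub>R g \<tau>)"

definition bounded_meas :: "real \<Rightarrow> (real \<Rightarrow> 'a::{banach, second_countable_topology}) \<Rightarrow> bool" where
  "bounded_meas T g \<longleftrightarrow> g \<in> borel_measurable (lebesgue_on {0<..<T}) \<and> (\<exists>C. \<forall>t\<in>{0<..<T}. norm (g t) \<le> C)"

text \<open>Expresses that \<open>h\<close> is Lipschitz on \<open>(0,T)\<close> with weak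
  derivative \<open>g\<close>. The integral form is used because \<open>g\<close> is only bounded
  and measurable, so \<open>h\<close> need not be differentiable at every time.\<close>

definition primitive :: "real \<Rightarrow> (real \<Rightarrow> 'a::{banach, second_countable_topology}) \<Rightarrow> (real \<Rightarrow> 'a) \<Rightarrow> bool" where
  "primitive T h g \<longleftrightarrow> bounded_meas T g \<and>
     (\<forall>s t. 0 < s \<longrightarrow> s \<le> t \<longrightarrow> t < T \<longrightarrow> h t - h s = ivl_int T s t g)"

lemma bounded_measE:
  assumes "bounded_meas T g"
  obtains C where "g \<in> borel_measurable (lebesgue_on {0<..<T})" "0 \<le> C" "\<And>t. t \<in> {0<..<T} \<Longrightarrow> norm (g t) \<le> C"
proof -
  from assms obtain C where "g \<in> borel_measurable (lebesgue_on {0<..<T})" "\<And>t. t \<in> {0<..<T} \<Longrightarrow> norm (g t) \<le> C"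
    unfolding bounded_meas_def by blast
  then show ?thesis using that[of "\<bar>C\<bar>"] by force
qed

lemma bounded_measI:
  assumes "g \<in> borel_measurable (lebesgue_on {0<..<T})" "\<And>t. 0 < t \<Longrightarrow> t < T \<Longrightarrow> norm (g t) \<le> C"
  shows "bounded_meas T g"
  unfolding bounded_meas_def using assms by (intro conjI exI[of _ C]) auto

lemma bounded_meas_integrable: "bounded_meas T g \<Longrightarrow> integrable (lebesgue_on {0<..<T}) g"
  by (elim bounded_measE) (rule integrable_lebesgue_on_Ioo)

lemma bounded_meas_add:
  assumes "bounded_meas T f" "bounded_meas T g"
  shows "bounded_meas T (\<lambda>t. f t + g t)"
proof -
  obtain C where C: "f \<in> borel_measurable (lebesgue_on {0<..<T})" "0 \<le> C" "\<And>t. t \<in> {0<..<T} \<Longrightarrow> norm (f t) \<le> C"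
    using assms(1) by (elim bounded_measE) (rule that; blast)
  obtain D where D: "g \<in> borel_measurable (lebesgue_on {0<..<T})" "0 \<le> D" "\<And>t. t \<in> {0<..<T} \<Longrightarrow> norm (g t) \<le> D"
    using assms(2) by (elim bounded_measE) (rule that; blast)
  show ?thesis
  proof (rule bounded_measI[where C = "C + D"])
    show "norm (f t + g t) \<le> C + D" if "0 < t" "t < T" for t
      using that C D by (intro norm_triangle_le add_mono) simp_all
  qed (use C D in simp)
qed

lemma bounded_meas_mult:
  fixes f g :: "real \<Rightarrow> 'a::{banach, second_countable_topology, real_normed_algebra}"
  assumes "bounded_meas T f" "bounded_meas T g"
  shows "bounded_meas T (\<lambda>t. f t * g t)"
proof -
  obtain C where C: "f \<in> borel_measurable (lebesgue_on {0<..<T})" "0 \<le> C" "\<And>t. t \<in> {0<..<T} \<Longrightarrow> norm (f t) \<le> C"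
    using assms(1) by (elim bounded_measE) (rule that; blast)
  obtain D where D: "g \<in> borel_measurable (lebesgue_on {0<..<T})" "0 \<le> D" "\<And>t. t \<in> {0<..<T} \<Longrightarrow> norm (g t) \<le> D"
    using assms(2) by (elim bounded_measE) (rule that; blast)
  show ?thesis
  proof (rule bounded_measI[where C = "C * D"])
    show "norm (f t * g t) \<le> C * D" if "0 < t" "t < T" for t
      using that C D by (intro order_trans[OF norm_mult_ineq] mult_mono) simp_all
  qed (use C D in simp)
qed

lemma bounded_meas_bounded_linear:
  assumes "bounded_linear L" "bounded_meas T f"
  shows "bounded_meas T (\<lambda>t. L (f t))"
proof -
  interpret bounded_linear L by fact
  obtain K where K: "0 \<le> K" "\<And>x. norm (L x) \<le> norm x * K" using nonneg_bounded by blast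
  obtain C where C: "f \<in> borel_measurable (lebesgue_on {0<..<T})" "0 \<le> C" "\<And>t. t \<in> {0<..<T} \<Longrightarrow> norm (f t) \<le> C"
    using assms(2) by (elim bounded_measE) (rule that; blast)
  show ?thesis
  proof (rule bounded_measI[where C = "C * K"])
    show "(\<lambda>t. L (f t)) \<in> borel_measurable (lebesgue_on {0<..<T})"
      using borel_measurable_continuous_onI[OF linear_continuous_on[OF assms(1)]] C(1)
      by (rule measurable_compose[rotated])
    show "norm (L (f t)) \<le> C * K" if "0 < t" "t < T" for t
      using K(2)[of "f t"] mult_right_mono[OF C(3) K(1), of t] that by force
  qed
qed

lemma bounded_meas_const: "bounded_meas T (\<lambda>t. c)"
  by (rule bounded_measI[where C = "norm c"]) auto

lemma bounded_meas_continuous: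
  fixes f :: "real \<Rightarrow> 'a::{banach, second_countable_topology}"
  assumes "continuous_on UNIV f"
  shows "bounded_meas T f"
proof -
  have "bounded (f ` {0..T})"
    using assms by (intro compact_imp_bounded compact_continuous_image) (auto intro: continuous_on_subset)
  then obtain C where "\<forall>x\<in>{0..T}. norm (f x) \<le> C" unfolding bounded_iff by auto
  then show ?thesis
    by (intro bounded_measI[where C = C] continuous_imp_measurable_lebesgue_on assms) auto
qed

lemma ivl_int_integrable:
  assumes "bounded_meas T g"
  shows "integrable (lebesgue_on {0<..<T}) (\<lambda>\<tau>. indicator {s<..t} \<tau> *\<^sub>R g \<tau>)"
proof (rule Bochner_Integration.integrable_bound[OF bounded_meas_integrable[OF assms]])
  show "(\<lambda>\<tau>. indicator {s<..t} \<tau> *\<^sub>R g \<tau>) \<in> borel_measurable (lebesgue_on {0<..<T})"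
    using assms unfolding bounded_meas_def
    by (intro borel_measurable_scaleR indicator_measurable_lebesgue_on) auto
qed (auto simp: indicator_def)

lemma ivl_int_add: "bounded_meas T f \<Longrightarrow> bounded_meas T g \<Longrightarrow>
    ivl_int T s t (\<lambda>\<tau>. f \<tau> + g \<tau>) = ivl_int T s t f + ivl_int T s t g"
  unfolding ivl_int_def scaleR_add_right by (intro Bochner_Integration.integral_add ivl_int_integrable)

lemma ivl_int_diff: "bounded_meas T f \<Longrightarrow> bounded_meas T g \<Longrightarrow>
    ivl_int T s t (\<lambda>\<tau>. f \<tau> - g \<tau>) = ivl_int T s t f - ivl_int T s t g"
  unfolding ivl_int_def scaleR_diff_right by (intro Bochner_Integration.integral_diff ivl_int_integrable)

lemma ivl_int_bounded_linear:
  assumes "bounded_linear L" "bounded_meas T f"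
  shows "ivl_int T s t (\<lambda>\<tau>. L (f \<tau>)) = L (ivl_int T s t f)"
  unfolding ivl_int_def
  by (subst integral_bounded_linear[OF assms(1) ivl_int_integrable[OF assms(2)], symmetric])
    (simp add: bounded_linear.linear[OF assms(1)] linear_cmul)

lemma ivl_int_split:
  assumes "bounded_meas T g" "s \<le> t" "t \<le> r"
  shows "ivl_int T s t g + ivl_int T t r g = ivl_int T s r g"
  unfolding ivl_int_def
  by (subst Bochner_Integration.integral_add[symmetric, OF ivl_int_integrable ivl_int_integrable, OF assms(1,1)])
    (use assms in \<open>auto simp: indicator_def intro!: Bochner_Integration.integral_cong\<close>)

lemma measure_ivl:
  fixes s t T :: real
  shows "0 \<le> s \<Longrightarrow> s \<le> t \<Longrightarrow> t < T \<Longrightarrow> (LINT \<tau>|lebesgue_on {0<..<T}. indicator {s<..t} \<tau>) = t - s"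
proof -
  assume st: "0 \<le> s" "s \<le> t" "t < T"
  have "(LINT \<tau>|lebesgue_on {0<..<T}. (indicator {s<..t} \<tau> :: real))
      = measure (lebesgue_on {0<..<T}) ({s<..t} \<inter> space (lebesgue_on {0<..<T}))"
    by (rule Bochner_Integration.integral_indicator)
  also have "{s<..t} \<inter> space (lebesgue_on {0<..<T}) = {s<..t}" using st by (fastforce simp: set_eq_iff)
  also have "measure (lebesgue_on {0<..<T}) {s<..t} = measure lebesgue {s<..t}"
    using st by (intro measure_restrict_space) auto
  finally show ?thesis using st by simp
qed

lemma norm_ivl_int_le:
  assumes g: "bounded_meas T g" and st: "0 \<le> s" "s \<le> t" "t < T"
    and K: "\<And>\<tau>. s < \<tau> \<Longrightarrow> \<tau> \<le> t \<Longrightarrow> norm (g \<tau>) \<le> K"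
  shows "norm (ivl_int T s t g) \<le> K * (t - s)"
proof -
  have "norm (ivl_int T s t g) \<le> (LINT \<tau>|lebesgue_on {0<..<T}. indicator {s<..t} \<tau> * K)"
    unfolding ivl_int_def
  proof (rule Bochner_Integration.integral_norm_bound_integral[OF ivl_int_integrable[OF g]])
    show "integrable (lebesgue_on {0<..<T}) (\<lambda>\<tau>. indicator {s<..t} \<tau> * K)"
      using ivl_int_integrable[OF bounded_meas_const[of T K]] by simp
  qed (use K in \<open>auto simp: indicator_def\<close>)
  also have "\<dots> = K * (t - s)" using measure_ivl[OF st] by simp
  finally show ?thesis .
qed

lemma primitive_lipschitz:
  assumes "primitive T h g"
  obtains C where "0 \<le> C" "\<And>s t. s \<in> {0<..<T} \<Longrightarrow> t \<in> {0<..<T} \<Longrightarrow> norm (h t - h s) \<le> C * \<bar>t - s\<bar>"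
proof -
  have g: "bounded_meas T g" using assms by (simp add: primitive_def)
  then obtain C where C: "0 \<le> C" "\<And>t. t \<in> {0<..<T} \<Longrightarrow> norm (g t) \<le> C" by (elim bounded_measE) (rule that; blast)
  have le: "norm (h t - h s) \<le> C * \<bar>t - s\<bar>" if "0 < s" "s \<le> t" "t < T" for s t
  proof -
    have "h t - h s = ivl_int T s t g" using assms that by (simp add: primitive_def)
    then show ?thesis using norm_ivl_int_le[OF g, of s t C] C(2) that by simp
  qed
  show ?thesis
  proof (rule that[OF C(1)])
    show "norm (h t - h s) \<le> C * \<bar>t - s\<bar>" if "s \<in> {0<..<T}" "t \<in> {0<..<T}" for s t
    proof (cases "s \<le> t")
      case False
      then show ?thesis using le[of t s] that by (simp add: norm_minus_commute[of "h t"] abs_minus_commute[of t])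
    qed (use le that in auto)
  qed
qed

lemma primitive_bounded_meas:
  assumes "primitive T h g"
  shows "bounded_meas T h"
proof -
  obtain C where C: "0 \<le> C" "\<And>s t. s \<in> {0<..<T} \<Longrightarrow> t \<in> {0<..<T} \<Longrightarrow> norm (h t - h s) \<le> C * \<bar>t - s\<bar>"
    by (rule primitive_lipschitz[OF assms]) (rule that; blast)
  have "continuous_on {0<..<T} h"
  proof (rule lipschitz_on_continuous_on[where L = C])
    show "C-lipschitz_on {0<..<T} h"
      using C by (intro lipschitz_onI) (auto simp: dist_norm)
  qed
  then have m: "h \<in> borel_measurable (lebesgue_on {0<..<T})"
    by (rule continuous_imp_measurable_on_sets_lebesgue) simp
  show ?thesis
  proof (rule bounded_measI[OF m])
    show "norm (h t) \<le> norm (h (T/2)) + C * T" if "0 < t" "t < T" for t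
    proof -
      have "norm (h t) \<le> norm (h (T/2)) + norm (h t - h (T/2))" by (metis norm_triangle_sub)
      also have "norm (h t - h (T/2)) \<le> C * \<bar>t - T/2\<bar>" using C(2)[of "T/2" t] that by simp
      also have "\<dots> \<le> C * T" using that by (intro mult_left_mono C) auto
      finally show ?thesis by simp
    qed
  qed
qed

lemma primitive_const: "primitive T (\<lambda>t. c) (\<lambda>t. 0)"
  by (simp add: primitive_def bounded_meas_const ivl_int_def)

lemma primitive_add:
  assumes "primitive T h g" "primitive T h' g'"
  shows "primitive T (\<lambda>t. h t + h' t) (\<lambda>t. g t + g' t)"
  unfolding primitive_def
proof (intro conjI allI impI)
  have b: "bounded_meas T g" "bounded_meas T g'" using assms by (simp_all add: primitive_def)
  then show "bounded_meas T (\<lambda>t. g t + g' t)" by (rule bounded_meas_add)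
  fix s t assume st: "0 < s" "s \<le> t" "t < T"
  have "h t + h' t - (h s + h' s) = (h t - h s) + (h' t - h' s)" by (simp add: algebra_simps)
  also have "\<dots> = ivl_int T s t g + ivl_int T s t g'" using assms st by (simp add: primitive_def)
  also have "\<dots> = ivl_int T s t (\<lambda>t. g t + g' t)" by (rule ivl_int_add[OF b, symmetric])
  finally show "h t + h' t - (h s + h' s) = ivl_int T s t (\<lambda>t. g t + g' t)" .
qed

lemma primitive_sum:
  assumes "\<And>i. i \<in> A \<Longrightarrow> primitive T (h i) (g i)"
  shows "primitive T (\<lambda>t. \<Sum>i\<in>A. h i t) (\<lambda>t. \<Sum>i\<in>A. g i t)"
  using assms by (induction A rule: infinite_finite_induct) (simp_all add: primitive_const primitive_add)

lemma primitive_bounded_linear: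
  assumes L: "bounded_linear L" and h: "primitive T h g"
  shows "primitive T (\<lambda>t. L (h t)) (\<lambda>t. L (g t))"
  unfolding primitive_def
proof (intro conjI allI impI)
  show "bounded_meas T (\<lambda>t. L (g t))"
    by (rule bounded_meas_bounded_linear[OF L]) (use h in \<open>simp add: primitive_def\<close>)
  show "L (h t) - L (h s) = ivl_int T s t (\<lambda>t. L (g t))" if "0 < s" "s \<le> t" "t < T" for s t
  proof -
    have g: "bounded_meas T g" and hg: "h t - h s = ivl_int T s t g" using h that by (simp_all add: primitive_def)
    have "L (h t) - L (h s) = L (h t - h s)"
      by (rule linear_diff[OF bounded_linear.linear[OF L], symmetric])
    also have "\<dots> = ivl_int T s t (\<lambda>t. L (g t))"
      unfolding hg by (rule ivl_int_bounded_linear[OF L g, symmetric])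
    finally show ?thesis .
  qed
qed

lemma primitive_ivl_int:
  assumes "bounded_meas T g"
  shows "primitive T (\<lambda>t. ivl_int T 0 t g) g"
  unfolding primitive_def
proof (intro conjI allI impI assms)
  show "ivl_int T 0 t g - ivl_int T 0 s g = ivl_int T s t g" if "0 < s" "s \<le> t" for s t
    using ivl_int_split[OF assms, of 0 s t] that by (simp add: diff_eq_eq add.commute)
qed

text \<open>Quadratic increments force the derivative to be 0 at every point.\<close>

lemma quadratic_increments_imp_constant:
  fixes Q :: "real \<Rightarrow> 'a::real_normed_vector"
  assumes Q: "\<And>x y. x \<in> {s..r} \<Longrightarrow> y \<in> {s..r} \<Longrightarrow> x \<le> y \<Longrightarrow> norm (Q y - Q x) \<le> K * (y - x)^2"
    and "s \<le> r"
  shows "Q r = Q s"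
proof -
  have Q': "norm (Q y - Q x) \<le> \<bar>K\<bar> * \<bar>y - x\<bar> ^ 2" if "x \<in> {s..r}" "y \<in> {s..r}" for x y
  proof -
    have "norm (Q y - Q x) \<le> K * (y - x)^2"
    proof (cases "x \<le> y")
      case False
      with Q[OF that(2,1)] show ?thesis by (simp add: norm_minus_commute[of "Q y"] power2_commute[of y])
    qed (use Q that in blast)
    also have "\<dots> \<le> \<bar>K\<bar> * (y - x)^2" by (intro mult_right_mono) auto
    finally show ?thesis by simp
  qed
  have "(Q has_derivative (\<lambda>h. 0)) (at x within {s..r})" if x: "x \<in> {s..r}" for x
    unfolding has_derivative_within_alt
  proof (intro conjI allI impI)
    fix e :: real assume e: "0 < e"
    show "\<exists>d>0. \<forall>y\<in>{s..r}. norm (y - x) < d \<longrightarrow> norm (Q y - Q x - 0) \<le> e * norm (y - x)"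
    proof (intro exI[of _ "e / (\<bar>K\<bar> + 1)"] conjI ballI impI)
      fix y assume y: "y \<in> {s..r}" and d: "norm (y - x) < e / (\<bar>K\<bar> + 1)"
      have "(\<bar>K\<bar> + 1) * \<bar>y - x\<bar> \<le> e" using d by (simp add: field_simps)
      then have "\<bar>K\<bar> * \<bar>y - x\<bar> \<le> e" by (simp add: algebra_simps)
      from mult_right_mono[OF this, of "\<bar>y - x\<bar>"]
      show "norm (Q y - Q x - 0) \<le> e * norm (y - x)"
        using Q'[OF x y] by (simp add: power2_eq_square algebra_simps)
    qed (use e in auto)
  qed simp
  then obtain c where "\<forall>x\<in>{s..r}. Q x = c"
    using has_derivative_zero_constant[of "{s..r}" Q] by auto
  then show ?thesis using \<open>s \<le> r\<close> by auto
qed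

text \<open>Replacing \<open>h1 \<tau>\<close> by \<open>h1 t\<close> and \<open>h2 \<tau>\<close>
  by \<open>h2 s\<close> in the integrand costs \<open>O(t - s)\<close> by Lipschitz continuity, so
  the increment of the product differs from the integral by \<open>O((t - s)^2)\<close>. A function
  with such increments is constant. This is the product rule without almost everywhere
  differentiability of Lipschitz functions.\<close>

lemma primitive_mult:
  fixes h1 h2 :: "real \<Rightarrow> 'a::{banach, second_countable_topology, real_normed_algebra}"
  assumes p1: "primitive T h1 g1" and p2: "primitive T h2 g2"
  shows "primitive T (\<lambda>t. h1 t * h2 t) (\<lambda>t. h1 t * g2 t + g1 t * h2 t)"
proof -
  have g1: "bounded_meas T g1" and g2: "bounded_meas T g2" using p1 p2 by (simp_all add: primitive_def)
  have h1: "bounded_meas T h1" and h2: "bounded_meas T h2" using p1 p2 primitive_bounded_meas by blast+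
  define G where "G = (\<lambda>t. h1 t * g2 t + g1 t * h2 t)"
  have G: "bounded_meas T G" unfolding G_def by (intro bounded_meas_add bounded_meas_mult g1 g2 h1 h2)
  obtain C1 where C1: "0 \<le> C1" "\<And>s t. s \<in> {0<..<T} \<Longrightarrow> t \<in> {0<..<T} \<Longrightarrow> norm (h1 t - h1 s) \<le> C1 * \<bar>t - s\<bar>"
    by (rule primitive_lipschitz[OF p1]) (rule that; blast)
  obtain C2 where C2: "0 \<le> C2" "\<And>s t. s \<in> {0<..<T} \<Longrightarrow> t \<in> {0<..<T} \<Longrightarrow> norm (h2 t - h2 s) \<le> C2 * \<bar>t - s\<bar>"
    by (rule primitive_lipschitz[OF p2]) (rule that; blast)
  obtain D1 where D1: "0 \<le> D1" "\<And>t. t \<in> {0<..<T} \<Longrightarrow> norm (g1 t) \<le> D1" using g1 by (elim bounded_measE) (rule that; blast)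
  obtain D2 where D2: "0 \<le> D2" "\<And>t. t \<in> {0<..<T} \<Longrightarrow> norm (g2 t) \<le> D2" using g2 by (elim bounded_measE) (rule that; blast)
  have inc: "norm ((h1 t * h2 t - h1 s * h2 s) - ivl_int T s t G) \<le> (C1 * D2 + D1 * C2) * (t - s)^2"
    if st: "0 < s" "s \<le> t" "t < T" for s t
  proof -
    have i1: "h1 t - h1 s = ivl_int T s t g1" and i2: "h2 t - h2 s = ivl_int T s t g2"
      using p1 p2 st by (auto simp: primitive_def)
    have "h1 t * h2 t - h1 s * h2 s = h1 t * (h2 t - h2 s) + (h1 t - h1 s) * h2 s"
      by (simp add: algebra_simps)
    also have "\<dots> = ivl_int T s t (\<lambda>\<tau>. h1 t * g2 \<tau>) + ivl_int T s t (\<lambda>\<tau>. g1 \<tau> * h2 s)"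
      unfolding i1 i2
      by (simp add: ivl_int_bounded_linear[OF bounded_linear_mult_right g2] ivl_int_bounded_linear[OF bounded_linear_mult_left g1])
    also have "\<dots> = ivl_int T s t (\<lambda>\<tau>. h1 t * g2 \<tau> + g1 \<tau> * h2 s)"
      by (intro ivl_int_add[symmetric] bounded_meas_mult bounded_meas_const g1 g2)
    finally have "(h1 t * h2 t - h1 s * h2 s) - ivl_int T s t G
        = ivl_int T s t (\<lambda>\<tau>. (h1 t * g2 \<tau> + g1 \<tau> * h2 s) - G \<tau>)"
      by (subst ivl_int_diff) (auto intro!: bounded_meas_add bounded_meas_mult bounded_meas_const g1 g2 G)
    also have "norm \<dots> \<le> ((C1 * D2 + D1 * C2) * (t - s)) * (t - s)"
    proof (rule norm_ivl_int_le)
      have "bounded_meas T (\<lambda>\<tau>. (h1 t * g2 \<tau> + g1 \<tau> * h2 s) + (-1) *\<^sub>R G \<tau>)"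
        by (intro bounded_meas_add bounded_meas_mult bounded_meas_const g1 g2
            bounded_meas_bounded_linear[OF bounded_linear_scaleR_right] G)
      then show "bounded_meas T (\<lambda>\<tau>. (h1 t * g2 \<tau> + g1 \<tau> * h2 s) - G \<tau>)" by simp
      fix \<tau> assume \<tau>: "s < \<tau>" "\<tau> \<le> t"
      have in': "\<tau> \<in> {0<..<T}" "s \<in> {0<..<T}" "t \<in> {0<..<T}" using \<tau> st by auto
      have "(h1 t * g2 \<tau> + g1 \<tau> * h2 s) - G \<tau> = (h1 t - h1 \<tau>) * g2 \<tau> + g1 \<tau> * (h2 s - h2 \<tau>)"
        by (simp add: G_def algebra_simps)
      also have "norm \<dots> \<le> norm (h1 t - h1 \<tau>) * norm (g2 \<tau>) + norm (g1 \<tau>) * norm (h2 s - h2 \<tau>)"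
        by (intro norm_triangle_le add_mono norm_mult_ineq)
      also have "\<dots> \<le> (C1 * (t - s)) * D2 + D1 * (C2 * (t - s))"
      proof (intro add_mono mult_mono)
        show "norm (h1 t - h1 \<tau>) \<le> C1 * (t - s)"
          using C1(2)[OF in'(1,3)] mult_left_mono[OF _ C1(1), of "\<bar>t - \<tau>\<bar>" "t - s"] \<tau> by force
        show "norm (h2 s - h2 \<tau>) \<le> C2 * (t - s)"
          using C2(2)[OF in'(1,2)] mult_left_mono[OF _ C2(1), of "\<bar>s - \<tau>\<bar>" "t - s"] \<tau> by force
      qed (use C1 C2 D1 D2 in' st in auto)
      finally show "norm ((h1 t * g2 \<tau> + g1 \<tau> * h2 s) - G \<tau>) \<le> (C1 * D2 + D1 * C2) * (t - s)"
        by (simp add: algebra_simps)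
    qed (use st in auto)
    finally show ?thesis by (simp add: power2_eq_square algebra_simps)
  qed
  have "h1 r * h2 r - h1 s * h2 s = ivl_int T s r G" if sr: "0 < s" "s \<le> r" "r < T" for s r
  proof -
    define Q where "Q x = h1 x * h2 x - ivl_int T s x G" for x
    have "Q r = Q s"
    proof (rule quadratic_increments_imp_constant[OF _ sr(2)])
      fix x y assume xy: "x \<in> {s..r}" "y \<in> {s..r}" "x \<le> y"
      then have "Q y - Q x = (h1 y * h2 y - h1 x * h2 x) - ivl_int T x y G"
        using ivl_int_split[OF G, of s x y] by (simp add: Q_def algebra_simps)
      then show "norm (Q y - Q x) \<le> (C1 * D2 + D1 * C2) * (y - x)^2" using inc[of x y] xy sr by simp
    qed
    then show ?thesis by (simp add: Q_def ivl_int_def algebra_simps)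
  qed
  then show ?thesis using G unfolding primitive_def G_def by blast
qed

lemma primitive_smooth:
  assumes d: "\<And>t. (\<eta> has_real_derivative \<eta>' t) (at t)" and "smooth \<eta>'"
  shows "primitive T \<eta> \<eta>'"
  unfolding primitive_def
proof (intro conjI allI impI)
  show bm: "bounded_meas T \<eta>'" by (intro bounded_meas_continuous smooth_imp_continuous_on assms)
  fix s t assume st: "0 < s" "s \<le> t" "t < T"
  have "(\<eta>' has_integral (\<eta> t - \<eta> s)) {s..t}"
    using st d by (intro fundamental_theorem_of_calculus)
      (auto simp: has_real_derivative_iff_has_vector_derivative intro: has_vector_derivative_at_within)
  then have "integral {s..t} \<eta>' = \<eta> t - \<eta> s" by (rule integral_unique)
  moreover have "ivl_int T s t \<eta>' = integral {0<..<T} (\<lambda>\<tau>. indicator {s<..t} \<tau> *\<^sub>R \<eta>' \<tau>)"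
    unfolding ivl_int_def by (rule lebesgue_integral_eq_integral[OF ivl_int_integrable[OF bm]]) simp
  moreover have "\<dots> = integral UNIV (\<lambda>\<tau>. indicator {s<..t} \<tau> *\<^sub>R \<eta>' \<tau>)"
    by (rule integral_spike_set; rule negligible_subset[of "{}"])
      (use st in \<open>auto simp: indicator_def\<close>)
  moreover have "\<dots> = integral UNIV (\<lambda>x. if x \<in> {s..t} then \<eta>' x else 0)"
    by (rule integral_spike[where S = "{s}"]) auto
  moreover have "\<dots> = integral {s..t} \<eta>'" by (rule integral_restrict_UNIV)
  ultimately show "\<eta> t - \<eta> s = ivl_int T s t \<eta>'" by simp
qed

text \<open>The product rule for \<open>\<eta> * P\<close>, with \<open>P\<close> an antiderivative
  of \<open>g\<close>, turns the weak equation into orthogonality of \<open>h - P\<close> to every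
  \<open>\<eta>'\<close>, which is the situation of du Bois-Reymond.\<close>

lemma weak_derivative_imp_primitive:
  fixes h g :: "real \<Rightarrow> real"
  assumes T: "T > 0" and h: "bounded_meas T h" and g: "bounded_meas T g"
    and weak: "\<And>\<eta> \<eta>'. time_test T \<eta> \<eta>' \<Longrightarrow>
      (LINT t|lebesgue_on {0<..<T}. \<eta>' t * h t) + (LINT t|lebesgue_on {0<..<T}. \<eta> t * g t) = 0"
  obtains h' where "primitive T h' g" "AE t in lebesgue_on {0<..<T}. h t = h' t"
proof -
  let ?M = "lebesgue_on {0<..<T}"
  define P where "P t = ivl_int T 0 t g" for t
  have P: "primitive T P g" unfolding P_def by (rule primitive_ivl_int[OF g])
  have bP: "bounded_meas T P" by (rule primitive_bounded_meas[OF P])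
  have "bounded_meas T (\<lambda>t. h t + (-1) *\<^sub>R P t)"
    by (intro bounded_meas_add h bounded_meas_bounded_linear[OF bounded_linear_scaleR_right] bP)
  then have bv: "bounded_meas T (\<lambda>t. h t - P t)" by simp
  then obtain C where C: "(\<lambda>t. h t - P t) \<in> borel_measurable ?M" "0 \<le> C" "\<And>t. t \<in> {0<..<T} \<Longrightarrow> norm (h t - P t) \<le> C"
    by (elim bounded_measE) (rule that; blast)
  have "\<exists>c. AE t in ?M. h t - P t = c"
  proof (rule du_bois_reymond[OF T C(1)])
    show "\<bar>h t - P t\<bar> \<le> C" if "t \<in> {0<..<T}" for t using C(3)[OF that] by simp
    fix \<eta> \<eta>' assume tt: "time_test T \<eta> \<eta>'"
    then obtain a b where ab: "0 < a" "a < b" "b < T" and supp: "\<And>t. t \<notin> {a..b} \<Longrightarrow> \<eta> t = 0"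
      and s: "smooth \<eta>'" and d: "\<And>t. (\<eta> has_real_derivative \<eta>' t) (at t)" and s0: "smooth \<eta>"
      unfolding time_test_def by blast
    have supp': "\<eta>' t = 0" if "t \<notin> {a..b}" for t
    proof (rule DERIV_unique[OF d])
      have "((\<lambda>t. 0) has_real_derivative 0) (at t)" by simp
      then show "(\<eta> has_real_derivative 0) (at t)"
        by (rule has_field_derivative_transform_within_open[where S = "- {a..b}"])
          (use that supp in auto)
    qed
    have b\<eta>: "bounded_meas T \<eta>" "bounded_meas T \<eta>'"
      using s s0 by (auto intro!: bounded_meas_continuous smooth_imp_continuous_on)
    have pr: "primitive T (\<lambda>t. \<eta> t * P t) (\<lambda>t. \<eta> t * g t + \<eta>' t * P t)"
      by (intro primitive_mult primitive_smooth d s P)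
    \<comment> \<open>Both times lie outside \<open>{a..b}\<close>, where \<open>\<eta>\<close>
      vanishes, so the boundary terms are 0.\<close>
    define s0 where "s0 = a / 2" define t0 where "t0 = (b + T) / 2"
    have st: "0 < s0" "s0 \<le> t0" "t0 < T" "s0 < a" "b < t0" using ab by (auto simp: s0_def t0_def)
    have "ivl_int T s0 t0 (\<lambda>t. \<eta> t * g t + \<eta>' t * P t) = \<eta> t0 * P t0 - \<eta> s0 * P s0"
      using pr st unfolding primitive_def by auto
    also have "\<dots> = 0" using supp[of t0] supp[of s0] st by simp
    also have "ivl_int T s0 t0 (\<lambda>t. \<eta> t * g t + \<eta>' t * P t) = (LINT t|?M. \<eta> t * g t + \<eta>' t * P t)"
      unfolding ivl_int_def
    proof (rule Bochner_Integration.integral_cong)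
      show "indicator {s0<..t0} x *\<^sub>R (\<eta> x * g x + \<eta>' x * P x) = \<eta> x * g x + \<eta>' x * P x" for x
        using st supp[of x] supp'[of x] by (cases "x \<in> {a..b}") (auto simp: indicator_def)
    qed simp
    also have "\<dots> = (LINT t|?M. \<eta> t * g t) + (LINT t|?M. \<eta>' t * P t)"
      by (intro Bochner_Integration.integral_add bounded_meas_integrable bounded_meas_mult b\<eta> g bP)
    finally have "(LINT t|?M. \<eta> t * g t) + (LINT t|?M. \<eta>' t * P t) = 0" .
    moreover have "(LINT t|?M. (h t - P t) * \<eta>' t) = (LINT t|?M. \<eta>' t * h t - \<eta>' t * P t)"
      by (simp add: algebra_simps)
    moreover have "\<dots> = (LINT t|?M. \<eta>' t * h t) - (LINT t|?M. \<eta>' t * P t)"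
      by (intro Bochner_Integration.integral_diff bounded_meas_integrable bounded_meas_mult b\<eta> h bP)
    ultimately show "(LINT t|?M. (h t - P t) * \<eta>' t) = 0" using weak[OF tt] by simp
  qed
  then obtain c where c: "AE t in ?M. h t - P t = c" by blast
  show ?thesis
  proof (rule that[of "\<lambda>t. P t + c"])
    show "primitive T (\<lambda>t. P t + c) g" using primitive_add[OF P primitive_const[of T c]] by simp
    show "AE t in ?M. h t = P t + c" using c by eventually_elim simp
  qed
qed

section \<open>Periodic functions on the unit cell\<close>

definition periodic :: "(real^3 \<Rightarrow> 'a) \<Rightarrow> bool" where
  "periodic f \<longleftrightarrow> (\<forall>x i. f (x + axis i 1) = f x)"

lemma periodic_int:
  assumes "periodic f"
  shows "f (x + axis i (of_int m)) = f x"
proof -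
  have ax: "axis i (a + b) = axis i a + (axis i b :: real^3)" for a b by (simp add: axis_def vec_eq_iff)
  have nat: "f (x + axis i (real n)) = f x" for x n
  proof (induction n)
    case 0
    have "axis i (real 0) = (0 :: real^3)" by (simp add: axis_def vec_eq_iff)
    then show ?case by (metis add.right_neutral)
  next
    case (Suc n)
    have "f (x + axis i (real (Suc n))) = f ((x + axis i (real n)) + axis i 1)"
      using ax[of "real n" 1] by (simp add: ac_simps)
    then show ?case using assms Suc by (simp add: periodic_def)
  qed
  show ?thesis
  proof (cases "m \<ge> 0")
    case True
    then show ?thesis using nat[of x "nat m"] by simp
  next
    case False
    have "axis i (of_int m) + axis i (real (nat (- m))) = (0 :: real^3)"
      using False by (simp add: axis_def vec_eq_iff)
    then have "f x = f (x + axis i (of_int m) + axis i (real (nat (- m))))"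
      by (simp add: add.assoc)
    then show ?thesis using nat[of "x + axis i (of_int m)" "nat (- m)"] by simp
  qed
qed

lemma continuous_integrable_cbox:
  fixes f :: "'a::euclidean_space \<Rightarrow> 'b::banach"
  shows "continuous_on UNIV f \<Longrightarrow> f integrable_on cbox a b"
  by (rule integrable_continuous) (rule continuous_on_subset, auto)

lemma One_nth: "(\<Sum>b\<in>Basis. (b :: real^'n) $ i) = 1"
  using inner_sum_Basis[of "axis i 1 :: real^'n"] by (simp add: axis_in_Basis_iff inner_axis)

text \<open>The cell is cut at height \<open>t\<close> and the shifted cell at height 1. They share
  one piece, and the remaining pieces are translates of each other by one period.\<close>

lemma integral_shift_axis_unit:
  fixes f :: "real^3 \<Rightarrow> 'b::banach"
  assumes c: "continuous_on UNIV f" and p: "periodic f" and t: "0 \<le> t" "t \<le> 1"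
  shows "integral cell (\<lambda>x. f (x + axis i t)) = integral cell f"
proof -
  let ?e = "axis i t :: real^3" and ?E = "axis i 1 :: real^3"
  have E: "?E \<in> Basis" by (simp add: axis_in_Basis_iff)
  define b :: "real^3" where "b = (\<chi> j. if j = i then t else 1)"
  have One: "(One :: real^3) = (\<chi> j. 1)" by (simp add: vec_eq_iff One_nth)
  define I1 where "I1 = integral (cbox ?e One) f"
  define I2 where "I2 = integral (cbox 0 b) f"
  have h1: "(f has_integral I1) (cbox ?e One)" and h2: "(f has_integral I2) (cbox 0 b)"
    unfolding I1_def I2_def using continuous_integrable_cbox[OF c] by (simp_all add: integrable_integral)
  have axn: "(axis i r :: real^3) $ j = (if j = i then r else 0)" for r j by (simp add: axis_def)
  have inE: "x \<bullet> ?E = x $ i" for x :: "real^3" by (simp add: inner_axis)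
  have s1: "cell \<inter> {x. x \<bullet> ?E \<le> t} = cbox 0 b"
    using t unfolding One by (auto simp: mem_box_cart b_def inE split: if_splits; smt (verit))
  have s2: "cell \<inter> {x. x \<bullet> ?E \<ge> t} = cbox ?e One"
    using t unfolding One by (auto simp: mem_box_cart inE axn split: if_splits; smt (verit))
  have "(f has_integral (I2 + I1)) cell"
    by (rule has_integral_split[OF _ _ E, where c = t]) (use h1 h2 s1 s2 in auto)
  then have r: "integral cell f = I2 + I1" by (rule integral_unique)
  have "(\<lambda>x. f (x + ?E)) = f" using p by (auto simp: periodic_def)
  then have "((f \<circ> (+) ?E) has_integral I2) (cbox 0 b)"
    using h2 by (simp add: o_def add.commute)
  then have h3: "(f has_integral I2) (cbox (0 + ?E) (b + ?E))"
    by (simp only: has_integral_shift_cbox_iff)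
  have s3: "cbox (0 + ?e) (One + ?e) \<inter> {x. x \<bullet> ?E \<le> 1} = cbox ?e One"
    using t unfolding One by (auto simp: mem_box_cart inE axn split: if_splits; smt (verit))
  have s4: "cbox (0 + ?e) (One + ?e) \<inter> {x. x \<bullet> ?E \<ge> 1} = cbox (0 + ?E) (b + ?E)"
    using t unfolding One by (auto simp: mem_box_cart b_def inE axn split: if_splits; smt (verit))
  have "(f has_integral (I1 + I2)) (cbox (0 + ?e) (One + ?e))"
    by (rule has_integral_split[OF _ _ E, where c = 1]) (use h1 h3 s3 s4 in auto)
  then have "((f \<circ> (+) ?e) has_integral (I1 + I2)) cell"
    by (simp only: has_integral_shift_cbox_iff)
  then have "integral cell (\<lambda>x. f (x + ?e)) = I1 + I2"
    by (intro integral_unique) (simp add: o_def add.commute)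
  then show ?thesis using r by (simp add: add.commute)
qed

lemma integral_shift_axis:
  fixes f :: "real^3 \<Rightarrow> 'b::banach"
  assumes c: "continuous_on UNIV f" and p: "periodic f"
  shows "integral cell (\<lambda>x. f (x + axis i t)) = integral cell f"
proof -
  have "axis i t = axis i (frac t) + (axis i (of_int \<lfloor>t\<rfloor>) :: real^3)"
    by (simp add: axis_def vec_eq_iff frac_def)
  then have "f (x + axis i t) = f (x + axis i (frac t))" for x
    using periodic_int[OF p, of "x + axis i (frac t)" i "\<lfloor>t\<rfloor>"] by (simp add: add.assoc)
  then show ?thesis
    using integral_shift_axis_unit[OF c p, of "frac t" i] frac_lt_1[of t] by (simp add: less_imp_le)
qed

lemma vec3_axis_sum: "(y :: real^3) = axis 1 (y $ 1) + axis 2 (y $ 2) + axis 3 (y $ 3)"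
  by (simp add: vec_eq_iff forall_3 axis_def)

lemma continuous_on_shift:
  "continuous_on UNIV f \<Longrightarrow> continuous_on UNIV (\<lambda>x::'a::real_normed_vector. f (x + y))"
  by (rule continuous_on_compose2[of UNIV f]) (auto intro: continuous_intros)

lemma periodic_shift: "periodic f \<Longrightarrow> periodic (\<lambda>x. f (x + y))"
  unfolding periodic_def by (metis add.assoc add.commute)

lemma integral_shift:
  fixes f :: "real^3 \<Rightarrow> 'b::banach"
  assumes c: "continuous_on UNIV f" and p: "periodic f"
  shows "integral cell (\<lambda>x. f (x + y)) = integral cell f"
proof -
  have "f (x + y) = f (x + axis 1 (y $ 1) + axis 2 (y $ 2) + axis 3 (y $ 3))" for x
    using vec3_axis_sum[of y] by (simp add: add.assoc)
  then have "integral cell (\<lambda>x. f (x + y)) = integral cell (\<lambda>x. f (x + axis 1 (y $ 1) + axis 2 (y $ 2) + axis 3 (y $ 3)))"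
    by simp
  also have "\<dots> = integral cell (\<lambda>x. f (x + axis 2 (y $ 2) + axis 3 (y $ 3)))"
    by (rule integral_shift_axis[of "\<lambda>x. f (x + axis 2 (y $ 2) + axis 3 (y $ 3))"])
      (intro continuous_on_shift[of "\<lambda>x. f (x + axis 3 (y $ 3))"] continuous_on_shift c
        periodic_shift[of "\<lambda>x. f (x + axis 3 (y $ 3))"] periodic_shift p)+
  also have "\<dots> = integral cell (\<lambda>x. f (x + axis 3 (y $ 3)))"
    by (rule integral_shift_axis[of "\<lambda>x. f (x + axis 3 (y $ 3))"])
      (intro continuous_on_shift c periodic_shift p)+
  also have "\<dots> = integral cell f" by (rule integral_shift_axis[OF c p])
  finally show ?thesis .
qed

section \<open>The \<open>L\<^sup>3\<close> norm on the cell\<close>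

text \<open>The only exponent that occurs is 3, since the flux is trilinear. The functions measured
  are continuous, so the gauge integral over the cell serves.\<close>

definition n3 :: "(real^3 \<Rightarrow> complex) \<Rightarrow> real" where
  "n3 f = root 3 (integral cell (\<lambda>x. norm (f x) ^ 3))"

lemma n3_nonneg: "continuous_on UNIV f \<Longrightarrow> 0 \<le> n3 f"
  unfolding n3_def by (intro real_root_ge_zero integral_nonneg continuous_integrable_cbox continuous_intros) auto

lemma n3_cube: "continuous_on UNIV f \<Longrightarrow> n3 f ^ 3 = integral cell (\<lambda>x. norm (f x) ^ 3)"
  unfolding n3_def
  by (intro real_root_pow_pos2 integral_nonneg continuous_integrable_cbox continuous_intros) auto

lemma n3_leI:
  assumes "continuous_on UNIV f" "0 \<le> K" "integral cell (\<lambda>x. norm (f x) ^ 3) \<le> K ^ 3"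
  shows "n3 f \<le> K"
  using assms n3_cube[OF assms(1)] power_le_imp_le_base[of "n3 f" 2 K] by (simp add: numeral_eq_Suc)

lemma n3_mono:
  assumes "continuous_on UNIV f" "continuous_on UNIV g" "\<And>x. norm (f x) \<le> norm (g x)"
  shows "n3 f \<le> n3 g"
proof (rule n3_leI[OF assms(1) n3_nonneg[OF assms(2)]])
  show "integral cell (\<lambda>x. norm (f x) ^ 3) \<le> n3 g ^ 3"
    unfolding n3_cube[OF assms(2)]
    by (intro integral_le continuous_integrable_cbox continuous_intros assms power_mono) auto
qed

lemma measure_cell: "measure lborel cell = 1"
  by (simp add: content_cbox_if_cart One_nth)

lemma n3_le_bound:
  assumes "continuous_on UNIV f" "\<And>x. norm (f x) \<le> K" "0 \<le> K"
  shows "n3 f \<le> K"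
proof (rule n3_leI[OF assms(1,3)])
  have "integral cell (\<lambda>x. norm (f x) ^ 3) \<le> integral cell (\<lambda>x. K ^ 3)"
    by (intro integral_le continuous_integrable_cbox continuous_intros assms power_mono) auto
  then show "integral cell (\<lambda>x. norm (f x) ^ 3) \<le> K ^ 3" using measure_cell by simp
qed

lemma n3_cmult: "n3 (\<lambda>x. c * f x) = norm c * n3 f"
  by (simp add: n3_def norm_mult power_mult_distrib real_root_mult odd_real_root_power_cancel)

lemma n3_shift: "continuous_on UNIV f \<Longrightarrow> periodic f \<Longrightarrow> n3 (\<lambda>x. f (x + y)) = n3 f"
  unfolding n3_def
  by (subst integral_shift[of "\<lambda>x. norm (f x) ^ 3"]) (auto intro!: continuous_intros simp: periodic_def)

lemma am_gm_3: "0 \<le> a \<Longrightarrow> 0 \<le> b \<Longrightarrow> 0 \<le> c \<Longrightarrow> a * b * c \<le> (a ^ 3 + b ^ 3 + c ^ 3) / (3::real)"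
proof -
  assume "0 \<le> a" "0 \<le> b" "0 \<le> c"
  then have "0 \<le> (a + b + c) * ((a - b)^2 + (b - c)^2 + (c - a)^2)" by simp
  then show ?thesis by (simp add: algebra_simps power2_eq_square power3_eq_cube)
qed

text \<open>After normalising by the three norms, the arithmetic-geometric mean inequality holds
  pointwise and integrates to at most 1. The \<open>e\<close> added to each norm avoids division by
  zero and is sent to 0.\<close>

lemma holder3_real:
  assumes c: "continuous_on UNIV f" "continuous_on UNIV g" "continuous_on UNIV h"
  shows "integral cell (\<lambda>x. norm (f x) * norm (g x) * norm (h x)) \<le> n3 f * n3 g * n3 h"
proof -
  note n = n3_nonneg[OF c(1)] n3_nonneg[OF c(2)] n3_nonneg[OF c(3)]
  have le: "integral cell (\<lambda>x. norm (f x) * norm (g x) * norm (h x)) \<le> (n3 f + e) * (n3 g + e) * (n3 h + e)"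
    if e: "0 < e" for e
  proof -
    define A B C where "A = n3 f + e" and "B = n3 g + e" and "C = n3 h + e"
    have ABC: "A > 0" "B > 0" "C > 0" "n3 f \<le> A" "n3 g \<le> B" "n3 h \<le> C"
      using n e by (auto simp: A_def B_def C_def)
    have 1: "n3 f ^ 3 / A ^ 3 \<le> 1" "n3 g ^ 3 / B ^ 3 \<le> 1" "n3 h ^ 3 / C ^ 3 \<le> 1"
      using ABC n by (auto intro!: power_mono)
    have ig: "(\<lambda>x. norm (f x) ^ 3 / r) integrable_on cell" "(\<lambda>x. norm (g x) ^ 3 / r) integrable_on cell"
      "(\<lambda>x. norm (h x) ^ 3 / r) integrable_on cell" for r
      using c by (auto intro!: continuous_integrable_cbox continuous_intros simp: divide_inverse)
    have pt: "norm (f x) * norm (g x) * norm (h x)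
        \<le> A * B * C / 3 * (norm (f x) ^ 3 / A ^ 3 + norm (g x) ^ 3 / B ^ 3 + norm (h x) ^ 3 / C ^ 3)" for x
      using am_gm_3[of "norm (f x) / A" "norm (g x) / B" "norm (h x) / C"] ABC
      by (simp add: field_simps power_divide)
    have "integral cell (\<lambda>x. norm (f x) * norm (g x) * norm (h x))
        \<le> integral cell (\<lambda>x. A * B * C / 3 * (norm (f x) ^ 3 / A ^ 3 + norm (g x) ^ 3 / B ^ 3 + norm (h x) ^ 3 / C ^ 3))"
    proof (rule integral_le)
      show "(\<lambda>x. A * B * C / 3 * (norm (f x) ^ 3 / A ^ 3 + norm (g x) ^ 3 / B ^ 3 + norm (h x) ^ 3 / C ^ 3)) integrable_on cell"
        using integrable_cmul[OF integrable_add[OF integrable_add[OF ig(1,2)] ig(3)], of "A * B * C / 3"] by simp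
      show "(\<lambda>x. norm (f x) * norm (g x) * norm (h x)) integrable_on cell"
        using c by (intro continuous_integrable_cbox continuous_intros)
    qed (rule pt)
    also have "\<dots> = A * B * C / 3 * (n3 f ^ 3 / A ^ 3 + n3 g ^ 3 / B ^ 3 + n3 h ^ 3 / C ^ 3)"
      using ig by (simp add: integral_add integrable_add n3_cube c)
    also have "\<dots> \<le> A * B * C / 3 * 3"
    proof (rule mult_left_mono)
      show "n3 f ^ 3 / A ^ 3 + n3 g ^ 3 / B ^ 3 + n3 h ^ 3 / C ^ 3 \<le> 3" using 1 by linarith
    qed (use ABC in auto)
    finally show ?thesis by (simp add: A_def B_def C_def)
  qed
  show ?thesis
  proof (rule tendsto_le[OF _ _ tendsto_const])
    have "((\<lambda>e. (n3 f + e) * (n3 g + e) * (n3 h + e)) \<longlongrightarrow> (n3 f + 0) * (n3 g + 0) * (n3 h + 0)) (at_right 0)"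
      by (intro tendsto_intros)
    then show "((\<lambda>e. (n3 f + e) * (n3 g + e) * (n3 h + e)) \<longlongrightarrow> n3 f * n3 g * n3 h) (at_right 0)" by simp
    show "eventually (\<lambda>e. integral cell (\<lambda>x. norm (f x) * norm (g x) * norm (h x)) \<le> (n3 f + e) * (n3 g + e) * (n3 h + e)) (at_right 0)"
      using eventually_at_right_less[of "0::real"] by eventually_elim (rule le)
  qed simp
qed

lemma holder3:
  assumes c: "continuous_on UNIV f" "continuous_on UNIV g" "continuous_on UNIV h"
  shows "norm (integral cell (\<lambda>x. f x * g x * h x)) \<le> n3 f * n3 g * n3 h"
proof -
  have "norm (integral cell (\<lambda>x. f x * g x * h x)) \<le> integral cell (\<lambda>x. norm (f x) * norm (g x) * norm (h x))"
    by (rule integral_norm_bound_integral)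
      (use c in \<open>auto intro!: continuous_integrable_cbox continuous_intros simp: norm_mult\<close>)
  then show ?thesis using holder3_real[OF c] by linarith
qed

text \<open>With \<open>h = f + g\<close>, the pointwise bound of \<open>|h|^3\<close> by
  \<open>(|f| + |g|) |h|^2\<close> and Hoelder's inequality leave a common factor
  \<open>n3 h ^ 2\<close>, which cancels.\<close>

lemma n3_add:
  assumes c: "continuous_on UNIV f" "continuous_on UNIV g"
  shows "n3 (\<lambda>x. f x + g x) \<le> n3 f + n3 g"
proof -
  define h where "h = (\<lambda>x. f x + g x)"
  have ch: "continuous_on UNIV h" unfolding h_def using c by (intro continuous_intros)
  note n = n3_nonneg[OF c(1)] n3_nonneg[OF c(2)] n3_nonneg[OF ch]
  have i: "(\<lambda>x. norm (f x) * norm (h x) * norm (h x)) integrable_on cell"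
    "(\<lambda>x. norm (g x) * norm (h x) * norm (h x)) integrable_on cell"
    "(\<lambda>x. norm (h x) ^ 3) integrable_on cell"
    using c ch by (auto intro!: continuous_integrable_cbox continuous_intros)
  have "n3 h ^ 3 = integral cell (\<lambda>x. norm (h x) ^ 3)" by (rule n3_cube[OF ch])
  also have "\<dots> \<le> integral cell (\<lambda>x. norm (f x) * norm (h x) * norm (h x) + norm (g x) * norm (h x) * norm (h x))"
  proof (intro integral_le i integrable_add)
    fix x
    have "norm (h x) * norm (h x) ^ 2 \<le> (norm (f x) + norm (g x)) * norm (h x) ^ 2"
      by (intro mult_right_mono) (auto simp: h_def norm_triangle_ineq)
    then show "norm (h x) ^ 3 \<le> norm (f x) * norm (h x) * norm (h x) + norm (g x) * norm (h x) * norm (h x)"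
      by (simp add: algebra_simps power2_eq_square power3_eq_cube)
  qed
  also have "\<dots> = integral cell (\<lambda>x. norm (f x) * norm (h x) * norm (h x)) + integral cell (\<lambda>x. norm (g x) * norm (h x) * norm (h x))"
    by (rule integral_add[OF i(1,2)])
  also have "\<dots> \<le> n3 f * n3 h * n3 h + n3 g * n3 h * n3 h"
    by (intro add_mono holder3_real c ch)
  finally have "n3 h * (n3 h * n3 h) \<le> (n3 f + n3 g) * (n3 h * n3 h)"
    by (simp add: power3_eq_cube algebra_simps)
  then have "n3 h \<le> n3 f + n3 g"
    using n by (cases "n3 h = 0") (auto simp: mult_le_cancel_right)
  then show ?thesis by (simp add: h_def)
qed

lemma n3_zero: "n3 (\<lambda>x. 0) = 0" by (simp add: n3_def)

lemma n3_sum: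
  assumes "finite A" "\<And>i. i \<in> A \<Longrightarrow> continuous_on UNIV (f i)"
  shows "n3 (\<lambda>x. \<Sum>i\<in>A. f i x) \<le> (\<Sum>i\<in>A. n3 (f i))"
  using assms
proof (induction A rule: finite_induct)
  case (insert a A)
  have "n3 (\<lambda>x. \<Sum>i\<in>insert a A. f i x) = n3 (\<lambda>x. f a x + (\<Sum>i\<in>A. f i x))" using insert by simp
  also have "\<dots> \<le> n3 (f a) + n3 (\<lambda>x. \<Sum>i\<in>A. f i x)"
    using insert by (intro n3_add continuous_on_sum) auto
  finally show ?case using insert by force
qed (simp add: n3_zero)

section \<open>Trigonometric polynomials\<close>

definition fexp :: "int^3 \<Rightarrow> real^3 \<Rightarrow> complex" where
  "fexp k x = cis (2 * pi * (freq k \<bullet> x))"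

lemma freq_add: "freq (k + l) = freq k + freq l" by (simp add: freq_def vec_eq_iff)
lemma freq_uminus: "freq (- k) = - freq k" by (simp add: freq_def vec_eq_iff)
lemma freq_0 [simp]: "freq 0 = 0" by (simp add: freq_def vec_eq_iff)

lemma fexp_add_freq: "fexp (k + l) x = fexp k x * fexp l x"
  by (simp add: fexp_def freq_add inner_add_left distrib_left cis_mult)

lemma fexp_add: "fexp k (x + y) = fexp k x * fexp k y"
  by (simp add: fexp_def inner_add_right distrib_left cis_mult)

lemma fexp_0 [simp]: "fexp 0 x = 1" by (simp add: fexp_def)

lemma fexp_uminus: "fexp (- k) x = cnj (fexp k x)" by (simp add: fexp_def freq_uminus cis_cnj)

lemma norm_fexp [simp]: "norm (fexp k x) = 1" by (simp add: fexp_def)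

lemma continuous_on_fexp: "continuous_on S (fexp k)"
  unfolding fexp_def[abs_def] cis_conv_exp by (intro continuous_intros)

lemma fexp_axis: "fexp k (axis i t) = cis (2 * pi * (real_of_int (k $ i) * t))"
  by (simp add: fexp_def inner_axis freq_def)

lemma cis_2pi_int: "cis (2 * pi * real_of_int m) = 1"
  using cis_multiple_2pi[of "real_of_int m"] by (simp add: mult.commute)

lemma periodic_fexp: "periodic (fexp k)"
  by (simp add: periodic_def fexp_add fexp_axis cis_2pi_int)

lemma integral_fexp: "integral cell (fexp k) = (if k = 0 then 1 else 0)"
proof (cases "k = 0")
  case True
  have "fexp 0 = (\<lambda>x. 1)" by auto
  then show ?thesis using True measure_cell by simp
next
  case False
  then obtain i where i: "k $ i \<noteq> 0" by (auto simp: vec_eq_iff)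
  \<comment> \<open>A translation by half a period along a coordinate with
    \<open>k $ i \<noteq> 0\<close> flips the sign of the exponential but preserves its
    integral.\<close>
  have "fexp k (x + axis i (1 / (2 * real_of_int (k $ i)))) = - fexp k x" for x
    using i by (simp add: fexp_add fexp_axis)
  then have "integral cell (\<lambda>x. - fexp k x) = integral cell (fexp k)"
    using integral_shift[OF continuous_on_fexp periodic_fexp, of k "axis i (1 / (2 * real_of_int (k $ i)))"] by simp
  then show ?thesis using False by simp
qed

text \<open>Cubes rather than balls, to match kernels that are built coordinate by
  coordinate.\<close>

definition freq_box :: "nat \<Rightarrow> (int^3) set" where
  "freq_box N = {k. \<forall>i. \<bar>k $ i\<bar> \<le> int N}"

lemma finite_freq_box: "finite (freq_box N)"
proof (rule finite_subset)
  let ?I = "{- int N..int N}"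
  show "freq_box N \<subseteq> (\<lambda>(a, b, c). vector [a, b, c]) ` (?I \<times> ?I \<times> ?I)"
  proof
    fix k assume k: "k \<in> freq_box N"
    have "k = vector [k $ 1, k $ 2, k $ 3]" by (simp add: vec_eq_iff forall_3)
    moreover have "- int N \<le> k $ i \<and> k $ i \<le> int N" for i
      using k unfolding freq_box_def by (auto simp: abs_le_iff minus_le_iff)
    ultimately show "k \<in> (\<lambda>(a, b, c). vector [a, b, c]) ` (?I \<times> ?I \<times> ?I)"
      by (intro image_eqI[of _ _ "(k $ 1, k $ 2, k $ 3)"]) auto
  qed
qed simp

lemma freq_box_mono: "m \<le> n \<Longrightarrow> freq_box m \<subseteq> freq_box n"
  by (auto simp: freq_box_def intro: order_trans)

lemma freq_box_uminus [simp]: "- k \<in> freq_box N \<longleftrightarrow> k \<in> freq_box N"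
  by (simp add: freq_box_def)

text \<open>The degree is kept apart from the coefficients, so that blocks of different bands share
  one \<open>N\<close> and add up as coefficient functions.\<close>

definition trig :: "nat \<Rightarrow> (int^3 \<Rightarrow> complex) \<Rightarrow> real^3 \<Rightarrow> complex" where
  "trig N c x = (\<Sum>k\<in>freq_box N. c k * fexp k x)"

lemma continuous_on_trig [continuous_intros]: "continuous_on S (trig N c)"
  unfolding trig_def[abs_def] by (intro continuous_intros continuous_on_fexp)

lemma periodic_trig: "periodic (trig N c)"
  using periodic_fexp unfolding periodic_def trig_def by simp

lemma trig_add: "trig N (\<lambda>k. c k + d k) x = trig N c x + trig N d x"
  by (simp add: trig_def algebra_simps sum.distrib)

lemma trig_sum: "trig N (\<lambda>k. \<Sum>i\<in>A. c i k) x = (\<Sum>i\<in>A. trig N (c i) x)"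
  unfolding trig_def sum_distrib_right by (rule sum.swap)

lemma trig_cmult: "trig N (\<lambda>k. r * c k) x = r * trig N c x"
  by (simp add: trig_def sum_distrib_left mult.assoc)

lemma trig_shift: "trig N c (x + y) = trig N (\<lambda>k. fexp k y * c k) x"
  unfolding trig_def by (intro sum.cong refl) (simp add: fexp_add mult_ac)

text \<open>Orthogonality keeps the triples of frequencies with sum 0. As \<open>c\<close> vanishes
  off the box, the third frequency is summed out without a side condition.\<close>

lemma integral_trig3:
  assumes c: "\<And>k. k \<notin> freq_box N \<Longrightarrow> c k = 0"
  shows "integral cell (\<lambda>x. trig N a x * trig N b x * trig N c x)
    = (\<Sum>k\<in>freq_box N. \<Sum>l\<in>freq_box N. a k * b l * c (- (k + l)))"
proof -
  let ?F = "freq_box N"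
  have "trig N a x * trig N b x * trig N c x
      = (\<Sum>k\<in>?F. \<Sum>l\<in>?F. \<Sum>m\<in>?F. (a k * b l * c m) * fexp (k + l + m) x)" for x
  proof -
    have ab: "trig N a x * trig N b x = (\<Sum>k\<in>?F. \<Sum>l\<in>?F. (a k * fexp k x) * (b l * fexp l x))"
      unfolding trig_def by (rule sum_product)
    show ?thesis
      unfolding ab trig_def[of N c] sum_distrib_right unfolding sum_distrib_left fexp_add_freq
      by (intro sum.cong refl) (simp add: mult_ac)
  qed
  then have "integral cell (\<lambda>x. trig N a x * trig N b x * trig N c x)
      = integral cell (\<lambda>x. \<Sum>k\<in>?F. \<Sum>l\<in>?F. \<Sum>m\<in>?F. (a k * b l * c m) * fexp (k + l + m) x)"
    by simp
  also have "\<dots> = (\<Sum>k\<in>?F. \<Sum>l\<in>?F. \<Sum>m\<in>?F. (a k * b l * c m) * (if k + l + m = 0 then 1 else 0))"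
  proof -
    have i: "(\<lambda>x. z * fexp k x) integrable_on cell" for z k
      by (intro continuous_integrable_cbox continuous_intros continuous_on_fexp)
    show ?thesis
      by (simp add: integral_sum finite_freq_box i integrable_sum integral_fexp)
  qed
  also have "\<dots> = (\<Sum>k\<in>?F. \<Sum>l\<in>?F. a k * b l * c (- (k + l)))"
  proof (intro sum.cong refl)
    fix k l
    have "(\<Sum>m\<in>?F. (a k * b l * c m) * (if k + l + m = 0 then 1 else 0))
        = (\<Sum>m\<in>?F. if m = - (k + l) then a k * b l * c m else 0)"
    proof (intro sum.cong refl)
      fix m
      have "k + l + m = 0 \<longleftrightarrow> m = - (k + l)" by (metis add.commute eq_neg_iff_add_eq_0)
      then show "(a k * b l * c m) * (if k + l + m = 0 then 1 else 0) = (if m = - (k + l) then a k * b l * c m else 0)"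
        by simp
    qed
    also have "\<dots> = a k * b l * c (- (k + l))"
      using c[of "- (k + l)"] finite_freq_box[of N] by (auto simp: sum.delta simp del: freq_box_uminus)
    finally show "(\<Sum>m\<in>?F. (a k * b l * c m) * (if k + l + m = 0 then 1 else 0)) = a k * b l * c (- (k + l))" .
  qed
  finally show ?thesis .
qed

section \<open>Discrete kernels\<close>

lemma root_unity_sum:
  assumes "\<bar>m\<bar> < int R"
  shows "(\<Sum>r<R. cis (2 * pi * (real_of_int m * (real r / real R)))) = (if m = 0 then of_nat R else 0)"
proof (cases "m = 0")
  case False
  have R: "R > 0" using assms by auto
  define z where "z = cis (2 * pi * (real_of_int m / real R))"
  have zr: "cis (2 * pi * (real_of_int m * (real r / real R))) = z ^ r" for r
    unfolding z_def Complex.DeMoivre by (rule arg_cong[where f = cis]) simp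
  have "z ^ R = 1"
  proof -
    have "z ^ R = cis (2 * pi * real_of_int m)"
      unfolding z_def Complex.DeMoivre by (rule arg_cong[where f = cis]) (use R in simp)
    then show ?thesis using cis_2pi_int by simp
  qed
  moreover have "z \<noteq> 1"
  proof
    assume "z = 1"
    then have "cos (2 * pi * (real_of_int m / real R)) = 1" unfolding z_def by (metis cis.sel(1) one_complex.sel(1))
    then obtain n :: int where "2 * pi * (real_of_int m / real R) = real_of_int n * 2 * pi"
      unfolding cos_one_2pi_int by blast
    then have "real_of_int m = real_of_int n * real R" using R by (simp add: field_simps)
    then have "m = n * int R" by (metis of_int_eq_iff of_int_mult of_int_of_nat_eq)
    moreover have "n \<noteq> 0" using False calculation by auto
    ultimately have "int R \<le> \<bar>m\<bar>"
      using mult_right_mono[of 1 "\<bar>n\<bar>" "int R"] by (simp add: abs_mult)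
    then show False using assms by simp
  qed
  ultimately have "(\<Sum>r<R. z ^ r) = 0" by (subst geometric_sum) auto
  then show ?thesis using False zr by simp
qed simp

definition autocorr :: "nat \<Rightarrow> (int \<Rightarrow> real) \<Rightarrow> int \<Rightarrow> real" where
  "autocorr n a d = (\<Sum>j\<in>{- int n..int n}. a j * a (j + d))"

text \<open>The squared modulus of the trigonometric sum with coefficients \<open>a\<close>, sampled
  at multiples of \<open>1/R\<close>. It is nonnegative, and for large \<open>R\<close> its discrete
  Fourier coefficients are the autocorrelation of \<open>a\<close>.\<close>

definition sampled_kernel :: "nat \<Rightarrow> (int \<Rightarrow> real) \<Rightarrow> nat \<Rightarrow> nat \<Rightarrow> real" where
  "sampled_kernel n a R r =
     (norm (\<Sum>j\<in>{- int n..int n}. complex_of_real (a j) * cis (2 * pi * (real_of_int j * (real r / real R)))))\<^sup>2 / real R"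

lemma sampled_kernel_nonneg: "0 \<le> sampled_kernel n a R r"
  by (simp add: sampled_kernel_def)

text \<open>Expanding the square produces the frequencies \<open>j - j' + d\<close>, all smaller
  than \<open>R\<close> in modulus. The sampling therefore aliases nothing and selects
  \<open>j' = j + d\<close>.\<close>

lemma sampled_kernel_coeff:
  assumes a: "\<And>j. \<bar>j\<bar> > int n \<Longrightarrow> a j = 0" and R: "\<bar>d\<bar> + 2 * int n < int R"
  shows "(\<Sum>r<R. complex_of_real (sampled_kernel n a R r) * cis (2 * pi * (real_of_int d * (real r / real R))))
    = complex_of_real (autocorr n a d)"
proof -
  let ?J = "{- int n..int n}"
  define \<zeta> where "\<zeta> m r = cis (2 * pi * (real_of_int m * (real r / real R)))" for m r
  have \<zeta>_add: "\<zeta> (m + m') r = \<zeta> m r * \<zeta> m' r" for m m' r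
    by (simp add: \<zeta>_def cis_mult algebra_simps add_divide_distrib)
  have \<zeta>_cnj: "cnj (\<zeta> m r) = \<zeta> (- m) r" for m r by (simp add: \<zeta>_def cis_cnj)
  have R0: "R > 0" using R by auto
  have "complex_of_real (sampled_kernel n a R r) * \<zeta> d r
      = (\<Sum>j\<in>?J. \<Sum>j'\<in>?J. (a j * a j' / real R) * \<zeta> (j - j' + d) r)" for r
  proof -
    have "complex_of_real (sampled_kernel n a R r)
      = (\<Sum>j\<in>?J. complex_of_real (a j) * \<zeta> j r) * cnj (\<Sum>j\<in>?J. complex_of_real (a j) * \<zeta> j r) / of_nat R"
      unfolding sampled_kernel_def complex_norm_square[symmetric] by (simp add: \<zeta>_def)
    also have "\<dots> * \<zeta> d r = (\<Sum>j\<in>?J. \<Sum>j'\<in>?J. (a j * a j' / real R) * (\<zeta> j r * \<zeta> (- j') r * \<zeta> d r))"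
      unfolding cnj_sum complex_cnj_mult complex_cnj_complex_of_real \<zeta>_cnj sum_product
      unfolding sum_divide_distrib unfolding sum_distrib_right
      by (intro sum.cong refl) (simp add: field_simps)
    finally show ?thesis by (simp add: \<zeta>_add[symmetric])
  qed
  then have "(\<Sum>r<R. complex_of_real (sampled_kernel n a R r) * \<zeta> d r)
      = (\<Sum>r<R. \<Sum>j\<in>?J. \<Sum>j'\<in>?J. (a j * a j' / real R) * \<zeta> (j - j' + d) r)" by simp
  also have "\<dots> = (\<Sum>j\<in>?J. \<Sum>r<R. \<Sum>j'\<in>?J. (a j * a j' / real R) * \<zeta> (j - j' + d) r)"
    by (rule sum.swap)
  also have "\<dots> = (\<Sum>j\<in>?J. \<Sum>j'\<in>?J. \<Sum>r<R. (a j * a j' / real R) * \<zeta> (j - j' + d) r)"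
    by (intro sum.cong refl) (rule sum.swap)
  also have "\<dots> = (\<Sum>j\<in>?J. \<Sum>j'\<in>?J. (if j' = j + d then complex_of_real (a j * a j') else 0))"
  proof (intro sum.cong refl)
    fix j j' assume "j \<in> ?J" "j' \<in> ?J"
    then have "\<bar>j - j' + d\<bar> < int R" using R by auto
    from root_unity_sum[OF this]
    have "(\<Sum>r<R. \<zeta> (j - j' + d) r) = (if j' = j + d then of_nat R else 0)"
      unfolding \<zeta>_def by auto
    then show "(\<Sum>r<R. (a j * a j' / real R) * \<zeta> (j - j' + d) r) = (if j' = j + d then complex_of_real (a j * a j') else 0)"
      unfolding sum_distrib_left[symmetric] using R0 by simp
  qed
  also have "\<dots> = (\<Sum>j\<in>?J. complex_of_real (a j * a (j + d)))"
  proof (intro sum.cong refl)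
    fix j
    show "(\<Sum>j'\<in>?J. (if j' = j + d then complex_of_real (a j * a j') else 0)) = complex_of_real (a j * a (j + d))"
      using a[of "j + d"] by (cases "j + d \<in> ?J") (auto simp: sum.delta)
  qed
  also have "\<dots> = complex_of_real (autocorr n a d)" by (simp add: autocorr_def)
  finally show ?thesis unfolding \<zeta>_def .
qed

lemma sampled_kernel_sum:
  assumes a: "\<And>j. \<bar>j\<bar> > int n \<Longrightarrow> a j = 0" and R: "2 * int n < int R"
  shows "(\<Sum>r<R. sampled_kernel n a R r) = autocorr n a 0"
  using sampled_kernel_coeff[where d = 0, OF a, where R = R] R by (simp flip: of_real_sum)

section \<open>Bernstein's inequality\<close>

lemma axis_zero: "axis i 0 = (0 :: real^3)" by (simp add: axis_def vec_eq_iff)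

text \<open>The normalised indicator of \<open>n\<close> consecutive integers; its autocorrelation
  is the triangle that is the symbol of the Fejer kernel.\<close>

definition fejer :: "nat \<Rightarrow> int \<Rightarrow> real" where
  "fejer n j = (if 0 \<le> j \<and> j < int n then 1 / sqrt (real n) else 0)"

lemma autocorr_fejer:
  assumes "n > 0"
  shows "autocorr n (fejer n) d = max 0 (real n - \<bar>real_of_int d\<bar>) / real n"
proof -
  have "autocorr n (fejer n) d = (\<Sum>j\<in>{- int n..int n}. if j \<in> {max 0 (- d)..<min (int n) (int n - d)} then 1 / real n else 0)"
    unfolding autocorr_def by (intro sum.cong refl) (use assms in \<open>auto simp: fejer_def\<close>)
  also have "\<dots> = (\<Sum>j\<in>{max 0 (- d)..<min (int n) (int n - d)}. 1 / real n)"
    by (rule sum.mono_neutral_cong_right) auto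
  also have "\<dots> = real (nat (min (int n) (int n - d) - max 0 (- d))) / real n" by simp
  also have "real (nat (min (int n) (int n - d) - max 0 (- d))) = max 0 (real n - \<bar>real_of_int d\<bar>)"
    by (cases "d \<ge> 0") (auto simp: max_def min_def)
  finally show ?thesis .
qed

text \<open>Two triangles centred at \<open>n\<close> and \<open>- n\<close>, subtracted and scaled
  by \<open>n\<close>, coincide on \<open>[-n, n]\<close> with the identity function. A nonnegative
  kernel has total mass equal to its symbol at 0, here 1, so the weights have mass at most
  \<open>2 n\<close>.\<close>

lemma bernstein_interpolation:
  assumes n: "n > 0"
  obtains R :: nat and \<beta> :: "nat \<Rightarrow> complex" where "(\<Sum>r<R. norm (\<beta> r)) \<le> 2 * real n"
    "\<And>k. \<bar>k\<bar> \<le> int n \<Longrightarrow> (\<Sum>r<R. \<beta> r * cis (2 * pi * (real_of_int k * (real r / real R)))) = of_int k"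
proof
  \<comment> \<open>The shift by \<open>n\<close> produces frequencies up to \<open>2 n\<close>;
    aliasing is excluded once \<open>R > 2 n + 2 n\<close>.\<close>
  define R where "R = 5 * n"
  define \<zeta> where "\<zeta> m r = cis (2 * pi * (real_of_int m * (real r / real R)))" for m r
  define \<beta> where "\<beta> r = of_nat n * complex_of_real (sampled_kernel n (fejer n) R r) * (\<zeta> (- int n) r - \<zeta> (int n) r)" for r
  have \<zeta>_add: "\<zeta> (m + m') r = \<zeta> m r * \<zeta> m' r" for m m' r
    by (simp add: \<zeta>_def cis_mult algebra_simps add_divide_distrib)
  have a: "fejer n j = 0" if "\<bar>j\<bar> > int n" for j using that by (auto simp: fejer_def)
  have "norm (\<beta> r) \<le> real n * sampled_kernel n (fejer n) R r * 2" for r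
    unfolding \<beta>_def norm_mult using norm_triangle_ineq4[of "\<zeta> (- int n) r" "\<zeta> (int n) r"]
    by (intro mult_mono) (auto simp: sampled_kernel_nonneg \<zeta>_def)
  then have "(\<Sum>r<R. norm (\<beta> r)) \<le> (\<Sum>r<R. real n * sampled_kernel n (fejer n) R r * 2)" by (rule sum_mono)
  also have "\<dots> = 2 * real n * (\<Sum>r<R. sampled_kernel n (fejer n) R r)" by (simp add: sum_distrib_left mult_ac)
  also have "\<dots> = 2 * real n"
    using n by (subst sampled_kernel_sum[OF a]) (auto simp: R_def autocorr_fejer)
  finally show "(\<Sum>r<R. norm (\<beta> r)) \<le> 2 * real n" .
  fix k assume k: "\<bar>k\<bar> \<le> int n"
  have c: "(\<Sum>r<R. complex_of_real (sampled_kernel n (fejer n) R r) * \<zeta> d r) = complex_of_real (autocorr n (fejer n) d)"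
    if "\<bar>d\<bar> \<le> 2 * int n" for d
    unfolding \<zeta>_def by (rule sampled_kernel_coeff[OF a]) (use that n in \<open>auto simp: R_def\<close>)
  have "(\<Sum>r<R. \<beta> r * \<zeta> k r) = of_nat n * ((\<Sum>r<R. complex_of_real (sampled_kernel n (fejer n) R r) * \<zeta> (- int n + k) r)
      - (\<Sum>r<R. complex_of_real (sampled_kernel n (fejer n) R r) * \<zeta> (int n + k) r))"
    unfolding \<beta>_def \<zeta>_add sum_distrib_left sum_subtractf[symmetric]
    by (intro sum.cong refl) (simp add: algebra_simps)
  also have "\<dots> = complex_of_real (real n * (autocorr n (fejer n) (- int n + k) - autocorr n (fejer n) (int n + k)))"
    using k by (simp add: c)
  also have "real n * (autocorr n (fejer n) (- int n + k) - autocorr n (fejer n) (int n + k)) = real_of_int k"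
    using n k by (auto simp: autocorr_fejer field_simps max_def)
  finally show "(\<Sum>r<R. \<beta> r * cis (2 * pi * (real_of_int k * (real r / real R)))) = of_int k"
    by (simp add: \<zeta>_def)
qed

text \<open>On this band a partial derivative is a finite combination of translations with total
  mass \<open>2 n\<close>, and each translation preserves the norm. The factor \<open>2 pi i\<close>
  of the derivative is left out of the symbol.\<close>

lemma bernstein:
  assumes n: "n > 0" and c: "\<And>k. k \<notin> freq_box n \<Longrightarrow> c k = 0"
  shows "n3 (trig N (\<lambda>k. of_int (k $ i) * c k)) \<le> 2 * real n * n3 (trig N c)"
proof -
  obtain R :: nat and \<beta> where \<beta>: "(\<Sum>r<R. norm (\<beta> r)) \<le> 2 * real n"
    "\<And>k. \<bar>k\<bar> \<le> int n \<Longrightarrow> (\<Sum>r<R. \<beta> r * cis (2 * pi * (real_of_int k * (real r / real R)))) = of_int k"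
    using bernstein_interpolation[OF n] by metis
  have "trig N (\<lambda>k. of_int (k $ i) * c k) x = (\<Sum>r<R. \<beta> r * trig N c (x + axis i (real r / real R)))" for x
  proof -
    have "of_int (k $ i) * c k = (\<Sum>r<R. \<beta> r * (fexp k (axis i (real r / real R)) * c k))" for k
    proof (cases "k \<in> freq_box n")
      case True
      then have "\<bar>k $ i\<bar> \<le> int n" by (simp add: freq_box_def)
      from \<beta>(2)[OF this] show ?thesis
        by (simp add: fexp_axis mult.assoc[symmetric] flip: sum_distrib_right)
    qed (simp add: c)
    then show ?thesis by (simp add: trig_sum trig_cmult trig_shift)
  qed
  then have "n3 (trig N (\<lambda>k. of_int (k $ i) * c k)) = n3 (\<lambda>x. \<Sum>r<R. \<beta> r * trig N c (x + axis i (real r / real R)))"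
    by presburger
  also have "\<dots> \<le> (\<Sum>r<R. n3 (\<lambda>x. \<beta> r * trig N c (x + axis i (real r / real R))))"
    by (intro n3_sum continuous_on_mult continuous_on_const continuous_on_shift continuous_on_trig) auto
  also have "\<dots> = (\<Sum>r<R. norm (\<beta> r) * n3 (trig N c))"
    by (simp add: n3_cmult n3_shift[OF continuous_on_trig periodic_trig])
  also have "\<dots> \<le> 2 * real n * n3 (trig N c)"
    unfolding sum_distrib_right[symmetric] by (intro mult_right_mono \<beta> n3_nonneg continuous_on_trig)
  finally show ?thesis .
qed

section \<open>Increments of band-limited functions\<close>

lemma cis_linear_error: "norm (cis a - 1 - \<i> * complex_of_real a) \<le> a\<^sup>2"
proof -
  have "\<bar>sin a - a\<bar> \<le> a\<^sup>2 / 2"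
    using Maclaurin_sin_bound[of a 2] by (simp add: eval_nat_numeral sin_coeff_def)
  moreover have "\<bar>cos a - 1\<bar> \<le> a\<^sup>2 / 2"
  proof -
    have "cos a - 1 = - 2 * (sin (a / 2))\<^sup>2" using cos_double_sin[of "a / 2"] by simp
    moreover have "(sin (a / 2))\<^sup>2 \<le> (a / 2)\<^sup>2" using abs_sin_x_le_abs_x[of "a / 2"] by (metis abs_le_square_iff)
    ultimately show ?thesis by (simp add: power2_eq_square)
  qed
  ultimately show ?thesis
    using cmod_le[of "cis a - 1 - \<i> * complex_of_real a"] by simp
qed

text \<open>A mean value inequality obtained without differentiating under the integral. One step of
  size \<open>\<tau>\<close> is bounded by its linear term up to \<open>M \<tau>^2\<close>. Cutting
  \<open>t\<close> into \<open>m\<close> equal steps, translation invariance adds the linear terms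
  to full size while the errors total \<open>M t^2 / m\<close>, which tends to 0. Bernstein's
  inequality bounds the linear term.\<close>

lemma trig_diff_axis:
  assumes n: "n > 0" and c: "\<And>k. k \<notin> freq_box n \<Longrightarrow> c k = 0"
  shows "n3 (\<lambda>x. trig N c (x + axis i t) - trig N c x) \<le> 4 * pi * real n * \<bar>t\<bar> * n3 (trig N c)"
proof -
  define p where "p = trig N c"
  have cp: "continuous_on UNIV (\<lambda>x. p (x + y))" for y
    unfolding p_def by (intro continuous_on_shift continuous_on_trig)
  have cp0: "continuous_on UNIV p" unfolding p_def by (rule continuous_on_trig)
  define M where "M = (\<Sum>k\<in>freq_box N. norm (c k) * (2 * pi * real_of_int (k $ i))\<^sup>2)"
  have M: "0 \<le> M" unfolding M_def by (intro sum_nonneg) auto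
  define q where "q = trig N (\<lambda>k. of_int (k $ i) * c k)"
  have small: "n3 (\<lambda>x. p (x + axis i \<tau>) - p x) \<le> 2 * pi * \<bar>\<tau>\<bar> * n3 q + M * \<tau>\<^sup>2" for \<tau>
  proof -
    define e where "e x = p (x + axis i \<tau>) - p x - (2 * pi * \<tau> * \<i>) * q x" for x
    have ce: "continuous_on UNIV e" unfolding e_def q_def
      by (intro continuous_intros cp cp0 continuous_on_trig)
    have "norm (e x) \<le> M * \<tau>\<^sup>2" for x
    proof -
      have "e x = (\<Sum>k\<in>freq_box N. c k * fexp k x * (cis (2 * pi * (real_of_int (k $ i) * \<tau>)) - 1 - \<i> * complex_of_real (2 * pi * (real_of_int (k $ i) * \<tau>))))"
        unfolding e_def p_def q_def trig_shift unfolding trig_def sum_distrib_left sum_subtractf[symmetric]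
        by (intro sum.cong refl) (simp add: fexp_axis algebra_simps)
      also have "norm \<dots> \<le> (\<Sum>k\<in>freq_box N. norm (c k) * (2 * pi * (real_of_int (k $ i) * \<tau>))\<^sup>2)"
        by (rule order_trans[OF norm_sum], rule sum_mono)
          (simp only: norm_mult norm_fexp mult_1_right, rule mult_left_mono[OF cis_linear_error], simp)
      also have "\<dots> = M * \<tau>\<^sup>2"
        unfolding M_def sum_distrib_right by (intro sum.cong refl) (simp add: power_mult_distrib)
      finally show ?thesis .
    qed
    then have "n3 e \<le> M * \<tau>\<^sup>2" using M by (intro n3_le_bound ce) auto
    moreover have "n3 (\<lambda>x. (2 * pi * \<tau> * \<i>) * q x) = 2 * pi * \<bar>\<tau>\<bar> * n3 q"
      by (subst n3_cmult) (simp add: norm_mult)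
    moreover have "n3 (\<lambda>x. (2 * pi * \<tau> * \<i>) * q x + e x) \<le> n3 (\<lambda>x. (2 * pi * \<tau> * \<i>) * q x) + n3 e"
      by (intro n3_add ce continuous_intros) (simp add: q_def continuous_on_trig)
    moreover have "(\<lambda>x. (2 * pi * \<tau> * \<i>) * q x + e x) = (\<lambda>x. p (x + axis i \<tau>) - p x)"
      by (simp add: e_def)
    ultimately show ?thesis by simp
  qed
  have ax: "axis i (a + b) = axis i a + (axis i b :: real^3)" for a b by (simp add: axis_def vec_eq_iff)
  have tele: "n3 (\<lambda>x. p (x + axis i (real m * \<tau>)) - p x) \<le> real m * n3 (\<lambda>x. p (x + axis i \<tau>) - p x)" for m \<tau>
  proof (induction m)
    case 0
    show ?case by (simp add: n3_zero axis_zero)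
  next
    case (Suc m)
    define d where "d x = p (x + axis i \<tau>) - p x" for x
    have cd: "continuous_on UNIV d" unfolding d_def by (intro continuous_intros cp cp0)
    have pd: "periodic d"
      using periodic_shift[OF periodic_trig[of N c], of "axis i \<tau>"] periodic_trig[of N c]
      unfolding d_def p_def periodic_def by simp
    have "(\<lambda>x. p (x + axis i (real (Suc m) * \<tau>)) - p x)
        = (\<lambda>x. d (x + axis i (real m * \<tau>)) + (p (x + axis i (real m * \<tau>)) - p x))"
      using ax[of "real m * \<tau>" \<tau>] by (simp add: d_def algebra_simps)
    then have "n3 (\<lambda>x. p (x + axis i (real (Suc m) * \<tau>)) - p x)
        \<le> n3 (\<lambda>x. d (x + axis i (real m * \<tau>))) + n3 (\<lambda>x. p (x + axis i (real m * \<tau>)) - p x)"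
      using n3_add[OF continuous_on_shift[OF cd, of "axis i (real m * \<tau>)"] continuous_on_diff[OF cp cp0, of "axis i (real m * \<tau>)"]] by simp
    also have "n3 (\<lambda>x. d (x + axis i (real m * \<tau>))) = n3 d" by (rule n3_shift[OF cd pd])
    finally show ?case using Suc by (simp add: d_def[abs_def] algebra_simps)
  qed
  have bound: "n3 (\<lambda>x. p (x + axis i t) - p x) \<le> 2 * pi * \<bar>t\<bar> * n3 q + M * t\<^sup>2 * inverse (real (Suc m))" for m
  proof -
    have "n3 (\<lambda>x. p (x + axis i (real (Suc m) * (t / real (Suc m)))) - p x)
        \<le> real (Suc m) * n3 (\<lambda>x. p (x + axis i (t / real (Suc m))) - p x)" by (rule tele)
    also have "\<dots> \<le> real (Suc m) * (2 * pi * \<bar>t / real (Suc m)\<bar> * n3 q + M * (t / real (Suc m))\<^sup>2)"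
      by (intro mult_left_mono small) auto
    also have "\<dots> = 2 * pi * \<bar>t\<bar> * n3 q + M * t\<^sup>2 * inverse (real (Suc m))"
      by (simp add: field_simps power2_eq_square del: of_nat_Suc)
    finally show ?thesis by (simp del: of_nat_Suc)
  qed
  have "(\<lambda>m. 2 * pi * \<bar>t\<bar> * n3 q + M * t\<^sup>2 * inverse (real (Suc m))) \<longlonglongrightarrow> 2 * pi * \<bar>t\<bar> * n3 q + M * t\<^sup>2 * 0"
    by (intro tendsto_intros LIMSEQ_inverse_real_of_nat)
  then have "n3 (\<lambda>x. p (x + axis i t) - p x) \<le> 2 * pi * \<bar>t\<bar> * n3 q + M * t\<^sup>2 * 0"
    by (rule tendsto_lowerbound) (use bound in auto)
  also have "\<dots> \<le> 2 * pi * \<bar>t\<bar> * (2 * real n * n3 p) + 0"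
    using bernstein[OF n c, where N = N and i = i] unfolding q_def p_def
    by (intro add_mono mult_left_mono) auto
  finally show ?thesis by (simp add: p_def mult_ac)
qed

text \<open>A weak Jordan inequality: \<open>y cos y \<le> sin y\<close> at \<open>y = x / 2\<close>
  gives \<open>x (cos (x / 2))^2 \<le> sin x\<close>, and the squared cosine is at least 1/2 on this
  range.\<close>

lemma sin_ge_half: "0 \<le> x \<Longrightarrow> x \<le> pi / 2 \<Longrightarrow> x / 2 \<le> sin x"
proof -
  assume x: "0 \<le> x" "x \<le> pi / 2"
  have g: "y * cos y \<le> sin y" if "0 \<le> y" "y \<le> pi" for y
  proof -
    have "(\<lambda>y. sin y - y * cos y) 0 \<le> (\<lambda>y. sin y - y * cos y) y"
    proof (rule DERIV_nonneg_imp_nondecreasing[OF that(1)])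
      fix z assume "0 \<le> z" "z \<le> y"
      then show "\<exists>d. ((\<lambda>y. sin y - y * cos y) has_real_derivative d) (at z) \<and> d \<ge> 0"
        using that sin_ge_zero[of z] by (intro exI[of _ "z * sin z"]) (auto intro!: derivative_eq_intros)
    qed
    then show ?thesis by simp
  qed
  have c: "0 \<le> cos (x / 2)" using x by (intro cos_ge_zero) auto
  have cx: "0 \<le> cos x" using x by (intro cos_ge_zero) auto
  have "x / 2 \<le> x * (cos (x / 2))\<^sup>2"
    using cx x cos_double_cos[of "x / 2"] mult_left_mono[of "1/2" "(cos (x / 2))\<^sup>2" x] by simp
  also have "\<dots> = 2 * (x / 2 * cos (x / 2)) * cos (x / 2)" by (simp add: power2_eq_square)
  also have "\<dots> \<le> 2 * sin (x / 2) * cos (x / 2)"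
    using g[of "x / 2"] x c by (intro mult_right_mono) auto
  also have "\<dots> = sin x" using sin_double[of "x / 2"] by simp
  finally show ?thesis .
qed

text \<open>By periodicity only the distance of \<open>t\<close> to the nearest integer matters, and
  \<open>|sin (pi t)|\<close> is comparable to it. The sine is preferred because its square is a
  trigonometric polynomial, whose averages under a kernel can be read off the symbol.\<close>

lemma trig_diff_axis_sin:
  assumes n: "n > 0" and c: "\<And>k. k \<notin> freq_box n \<Longrightarrow> c k = 0"
  shows "n3 (\<lambda>x. trig N c (x + axis i t) - trig N c x) \<le> 8 * real n * \<bar>sin (pi * t)\<bar> * n3 (trig N c)"
proof -
  define s where "s = t - of_int (round t)"
  have s: "\<bar>s\<bar> \<le> 1/2" unfolding s_def using of_int_round_abs_le[of t] by (simp add: abs_minus_commute)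
  have "axis i t = axis i s + (axis i (of_int (round t)) :: real^3)"
    by (simp add: axis_def vec_eq_iff s_def)
  then have "trig N c (x + axis i t) = trig N c (x + axis i s)" for x
    using periodic_int[OF periodic_trig[of N c], of "x + axis i s" i "round t"] by (simp add: add.assoc)
  then have "n3 (\<lambda>x. trig N c (x + axis i t) - trig N c x) = n3 (\<lambda>x. trig N c (x + axis i s) - trig N c x)" by simp
  also have "\<dots> \<le> 4 * pi * real n * \<bar>s\<bar> * n3 (trig N c)" by (rule trig_diff_axis[OF n c])
  also have "\<dots> \<le> 8 * real n * \<bar>sin (pi * s)\<bar> * n3 (trig N c)"
  proof -
    have "pi * \<bar>s\<bar> / 2 \<le> sin (pi * \<bar>s\<bar>)" using s by (intro sin_ge_half) auto
    also have "\<dots> \<le> \<bar>sin (pi * s)\<bar>" by (cases "s \<ge> 0") auto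
    finally have "(4 * pi * \<bar>s\<bar>) * (real n * n3 (trig N c)) \<le> (8 * \<bar>sin (pi * s)\<bar>) * (real n * n3 (trig N c))"
      by (intro mult_right_mono mult_nonneg_nonneg n3_nonneg continuous_on_trig) auto
    then show ?thesis by (simp add: mult_ac)
  qed
  also have "\<bar>sin (pi * s)\<bar> = \<bar>sin (pi * t)\<bar>"
  proof -
    have "pi * t = pi * s + pi * of_int (round t)" by (simp add: s_def algebra_simps)
    then have "sin (pi * t) = sin (pi * s) * cos (pi * of_int (round t)) + cos (pi * s) * sin (pi * of_int (round t))"
      by (metis sin_add)
    moreover have "sin (pi * of_int (round t)) = 0" using sin_zero_iff_int2 by (auto simp: mult.commute)
    moreover have "\<bar>cos (pi * of_int (round t))\<bar> = 1"
      using calculation(2) sin_cos_squared_add[of "pi * of_int (round t)"] by (simp add: power2_eq_1_iff abs_if)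
    ultimately show ?thesis by (simp add: abs_mult)
  qed
  finally show ?thesis .
qed

text \<open>The three coordinates are shifted one after the other, and each increment is moved back
  by translation invariance.\<close>

lemma trig_diff_shift:
  assumes n: "n > 0" and c: "\<And>k. k \<notin> freq_box n \<Longrightarrow> c k = 0"
  shows "n3 (\<lambda>x. trig N c (x + y) - trig N c (x + y'))
    \<le> 8 * real n * (\<Sum>i\<in>UNIV. \<bar>sin (pi * (y $ i - y' $ i))\<bar>) * n3 (trig N c)"
proof -
  define z where "z = y - y'"
  define p where "p = trig N c"
  define d where "d i x = p (x + axis i (z $ i)) - p x" for i x
  have cp: "continuous_on UNIV p" unfolding p_def by (rule continuous_on_trig)
  have cd: "continuous_on UNIV (d i)" for i
    unfolding d_def by (intro continuous_intros continuous_on_shift cp)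
  have pd: "periodic (d i)" for i
    using periodic_shift[OF periodic_trig[of N c], of "axis i (z $ i)"] periodic_trig[of N c]
    unfolding d_def p_def periodic_def by simp
  define e where "e x = p (x + z) - p x" for x
  have e: "e x = d 1 (x + (axis 2 (z $ 2) + axis 3 (z $ 3))) + (d 2 (x + axis 3 (z $ 3)) + d 3 x)" for x
    using vec3_axis_sum[of z] by (simp add: e_def d_def add_ac)
  have "n3 (\<lambda>x. p (x + y) - p (x + y')) = n3 (\<lambda>x. e (x + y'))"
    by (simp add: e_def z_def add_ac)
  also have "\<dots> = n3 e"
  proof (rule n3_shift)
    show "continuous_on UNIV e" unfolding e_def by (intro continuous_intros continuous_on_shift cp)
    show "periodic e" using periodic_shift[OF periodic_trig[of N c], of z] periodic_trig[of N c]
      unfolding e_def p_def periodic_def by simp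
  qed
  also have "\<dots> \<le> n3 (\<lambda>x. d 1 (x + (axis 2 (z $ 2) + axis 3 (z $ 3)))) + (n3 (\<lambda>x. d 2 (x + axis 3 (z $ 3))) + n3 (d 3))"
    unfolding e[abs_def]
    by (rule order_trans[OF n3_add], rule continuous_on_shift[OF cd],
        rule continuous_on_add[OF continuous_on_shift[OF cd] cd],
        rule add_left_mono, rule n3_add[OF continuous_on_shift[OF cd] cd])
  also have "\<dots> = n3 (d 1) + (n3 (d 2) + n3 (d 3))" by (simp add: n3_shift[OF cd pd])
  also have "\<dots> \<le> 8 * real n * \<bar>sin (pi * z $ 1)\<bar> * n3 p + (8 * real n * \<bar>sin (pi * z $ 2)\<bar> * n3 p + 8 * real n * \<bar>sin (pi * z $ 3)\<bar> * n3 p)"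
    unfolding d_def p_def by (intro add_mono trig_diff_axis_sin[OF n c])
  also have "\<dots> = 8 * real n * (\<Sum>i\<in>UNIV. \<bar>sin (pi * (y $ i - y' $ i))\<bar>) * n3 p"
    by (simp add: sum_3 z_def algebra_simps)
  finally show ?thesis unfolding p_def .
qed

section \<open>A positive mollifier with compactly supported symbol\<close>

text \<open>An autocorrelation as symbol makes the kernel a square, hence nonnegative. For the Lipschitz hat
  function the symbol differs from 1 by \<open>O(d\<^sup>2 / N\<^sup>2)\<close> at frequency \<open>d\<close>, which controls the second moment of
  the kernel.\<close>

definition hat :: "nat \<Rightarrow> int \<Rightarrow> real" where
  "hat N j = max 0 (real N - \<bar>real_of_int j\<bar>) / sqrt (\<Sum>i\<in>{- int N..int N}. (max 0 (real N - \<bar>real_of_int i\<bar>))\<^sup>2)"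

definition lam1 :: "nat \<Rightarrow> int \<Rightarrow> real" where
  "lam1 N d = autocorr N (hat N) d"

text \<open>One side of the triangle alone contributes the squares of \<open>0, ..., N\<close>. The
  bound gives the normalised hat a Lipschitz constant of order \<open>N^(-3/2)\<close>.\<close>

lemma hat_sum_ge:
  "real N ^ 3 / 3 \<le> (\<Sum>i\<in>{- int N..int N}. (max 0 (real N - \<bar>real_of_int i\<bar>))\<^sup>2)"
proof -
  have "real N ^ 3 / 3 \<le> (\<Sum>i\<le>N. (real i)\<^sup>2)"
  proof (induction N)
    case (Suc N)
    then show ?case by (simp add: algebra_simps power2_eq_square power3_eq_cube)
  qed simp
  also have "\<dots> = (\<Sum>j\<in>(\<lambda>i. int i - int N) ` {..N}. (real N - \<bar>real_of_int j\<bar>)\<^sup>2)"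
    by (subst sum.reindex) (auto simp: inj_on_def intro!: sum.cong)
  also have "\<dots> = (\<Sum>j\<in>(\<lambda>i. int i - int N) ` {..N}. (max 0 (real N - \<bar>real_of_int j\<bar>))\<^sup>2)"
    by (intro sum.cong refl) auto
  also have "\<dots> \<le> (\<Sum>i\<in>{- int N..int N}. (max 0 (real N - \<bar>real_of_int i\<bar>))\<^sup>2)"
    by (intro sum_mono2) auto
  finally show ?thesis .
qed

lemma hat_eq_0: "\<bar>j\<bar> > int N \<Longrightarrow> hat N j = 0"
  by (auto simp: hat_def max_def)

lemma hat_nonneg: "0 \<le> hat N j"
  by (auto simp: hat_def intro!: divide_nonneg_nonneg sum_nonneg)

lemma hat_uminus: "hat N (- j) = hat N j" by (simp add: hat_def)

lemma lam1_0:
  assumes "N > 0"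
  shows "lam1 N 0 = 1"
proof -
  let ?Z = "\<Sum>i\<in>{- int N..int N}. (max 0 (real N - \<bar>real_of_int i\<bar>))\<^sup>2"
  have "0 < real N ^ 3 / 3" using assms by simp
  then have Z: "0 < ?Z" using hat_sum_ge[of N] by linarith
  have "lam1 N 0 = (\<Sum>i\<in>{- int N..int N}. (max 0 (real N - \<bar>real_of_int i\<bar>))\<^sup>2 / ?Z)"
    unfolding lam1_def autocorr_def hat_def using Z
    by (intro sum.cong refl) (simp add: power2_eq_square)
  then show ?thesis using Z by (simp flip: sum_divide_distrib)
qed

lemma hat_lipschitz:
  assumes "N > 0"
  shows "(hat N j - hat N (j + d))\<^sup>2 \<le> (real_of_int d)\<^sup>2 * 3 / real N ^ 3"
proof -
  let ?Z = "\<Sum>i\<in>{- int N..int N}. (max 0 (real N - \<bar>real_of_int i\<bar>))\<^sup>2"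
  let ?m = "\<lambda>j. max 0 (real N - \<bar>real_of_int j\<bar>)"
  have N: "0 < real N ^ 3 / 3" using assms by simp
  then have Z: "0 < ?Z" using hat_sum_ge[of N] by linarith
  have "\<bar>?m j - ?m (j + d)\<bar> \<le> \<bar>real_of_int d\<bar>" by (auto simp: max_def)
  then have m: "(?m j - ?m (j + d))\<^sup>2 \<le> (real_of_int d)\<^sup>2" by (metis abs_le_square_iff)
  have "(hat N j - hat N (j + d))\<^sup>2 = (?m j - ?m (j + d))\<^sup>2 / ?Z"
    unfolding hat_def diff_divide_distrib[symmetric] power_divide using Z by simp
  also have "\<dots> \<le> (real_of_int d)\<^sup>2 / (real N ^ 3 / 3)"
    using m hat_sum_ge[of N] N by (intro frac_le) auto
  finally show ?thesis by simp
qed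

text \<open>The hat and its translate both have \<open>l^2\<close> norm 1, so expanding their
  squared distance leaves twice the deficit of the autocorrelation. The range is widened by
  \<open>|d|\<close> to contain both supports.\<close>

lemma one_minus_lam1:
  assumes "N > 0"
  shows "1 - lam1 N d = (\<Sum>j\<in>{- (int N + \<bar>d\<bar>)..int N + \<bar>d\<bar>}. (hat N j - hat N (j + d))\<^sup>2) / 2"
proof -
  let ?J = "{- (int N + \<bar>d\<bar>)..int N + \<bar>d\<bar>}" and ?I = "{- int N..int N}"
  have 1: "(\<Sum>j\<in>?J. (hat N j)\<^sup>2) = 1"
  proof -
    have "(\<Sum>j\<in>?J. (hat N j)\<^sup>2) = (\<Sum>j\<in>?I. (hat N j)\<^sup>2)"
      by (rule sum.mono_neutral_right) (auto intro!: hat_eq_0)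
    then show ?thesis using lam1_0[OF assms] by (simp add: lam1_def autocorr_def power2_eq_square)
  qed
  have 2: "(\<Sum>j\<in>?J. (hat N (j + d))\<^sup>2) = 1"
  proof -
    have "(\<Sum>j\<in>?J. (hat N (j + d))\<^sup>2) = (\<Sum>j\<in>(\<lambda>j. j + d) ` ?J. (hat N j)\<^sup>2)"
      by (subst sum.reindex) auto
    also have "\<dots> = (\<Sum>j\<in>?I. (hat N j)\<^sup>2)"
    proof (rule sum.mono_neutral_right)
      show "?I \<subseteq> (\<lambda>j. j + d) ` ?J"
      proof
        fix i assume "i \<in> ?I"
        then show "i \<in> (\<lambda>j. j + d) ` ?J" by (intro image_eqI[of _ _ "i - d"]) auto
      qed
    qed (auto intro!: hat_eq_0)
    finally show ?thesis using lam1_0[OF assms] by (simp add: lam1_def autocorr_def power2_eq_square)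
  qed
  have 3: "(\<Sum>j\<in>?J. hat N j * hat N (j + d)) = lam1 N d"
    unfolding lam1_def autocorr_def
    by (rule sum.mono_neutral_right) (auto simp: hat_eq_0)
  have "(\<Sum>j\<in>?J. (hat N j - hat N (j + d))\<^sup>2)
      = (\<Sum>j\<in>?J. (hat N j)\<^sup>2) + (\<Sum>j\<in>?J. (hat N (j + d))\<^sup>2) - 2 * (\<Sum>j\<in>?J. hat N j * hat N (j + d))"
    by (simp add: power2_diff sum.distrib sum_subtractf sum_distrib_left mult.assoc)
  then show ?thesis unfolding 1 2 3 by simp
qed

lemma lam1_lower:
  assumes "N > 0"
  shows "1 - lam1 N d \<le> 3/2 * (real_of_int d)\<^sup>2 * (2 * real N + 2 * \<bar>real_of_int d\<bar> + 1) / real N ^ 3"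
proof -
  have "(\<Sum>j\<in>{- (int N + \<bar>d\<bar>)..int N + \<bar>d\<bar>}. (hat N j - hat N (j + d))\<^sup>2)
      \<le> (\<Sum>j\<in>{- (int N + \<bar>d\<bar>)..int N + \<bar>d\<bar>}. (real_of_int d)\<^sup>2 * 3 / real N ^ 3)"
    by (intro sum_mono hat_lipschitz assms)
  also have "\<dots> = (2 * real N + 2 * \<bar>real_of_int d\<bar> + 1) * ((real_of_int d)\<^sup>2 * 3 / real N ^ 3)"
    by simp
  finally show ?thesis unfolding one_minus_lam1[OF assms]
    by (simp only: divide_le_eq_numeral1 times_divide_eq_right times_divide_eq_left divide_divide_eq_left mult_ac)
qed

lemma lam1_le_1: "N > 0 \<Longrightarrow> lam1 N d \<le> 1"
  using one_minus_lam1[of N d] sum_nonneg[of "{- (int N + \<bar>d\<bar>)..int N + \<bar>d\<bar>}" "\<lambda>j. (hat N j - hat N (j + d))\<^sup>2"]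
  by simp

lemma lam1_nonneg: "0 \<le> lam1 N d"
  unfolding lam1_def autocorr_def by (intro sum_nonneg mult_nonneg_nonneg hat_nonneg)

lemma lam1_uminus: "lam1 N (- d) = lam1 N d"
proof -
  have "(\<Sum>j\<in>{- int N..int N}. hat N j * hat N (j + - d)) = (\<Sum>j\<in>{- int N..int N}. hat N (- j) * hat N (- j + - d))"
    by (rule sum.reindex_bij_witness[of _ uminus uminus]) auto
  also have "\<dots> = (\<Sum>j\<in>{- int N..int N}. hat N j * hat N (j + d))"
    using hat_uminus[of N] by (intro sum.cong refl) (metis minus_add_distrib)
  finally show ?thesis by (simp add: lam1_def autocorr_def)
qed

lemma lam1_eq_0: "\<bar>d\<bar> > 2 * int N \<Longrightarrow> lam1 N d = 0"
  unfolding lam1_def autocorr_def by (intro sum.neutral ballI) (auto intro!: hat_eq_0)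

definition lam :: "nat \<Rightarrow> int^3 \<Rightarrow> real" where
  "lam N k = lam1 N (k $ 1) * lam1 N (k $ 2) * lam1 N (k $ 3)"

lemma lam_nonneg: "0 \<le> lam N k" by (simp add: lam_def lam1_nonneg)

lemma lam_le_1: "N > 0 \<Longrightarrow> lam N k \<le> 1"
  unfolding lam_def by (intro mult_le_one lam1_le_1 lam1_nonneg mult_nonneg_nonneg) auto

lemma lam_uminus: "lam N (- k) = lam N k" by (simp add: lam_def lam1_uminus)

lemma lam_eq_0: "k \<notin> freq_box (2 * N) \<Longrightarrow> lam N k = 0"
proof -
  assume "k \<notin> freq_box (2 * N)"
  then obtain i where "\<bar>k $ i\<bar> > 2 * int N" by (auto simp: freq_box_def not_le)
  then have "lam1 N (k $ i) = 0" by (rule lam1_eq_0)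
  then show ?thesis using exhaust_3[of i] by (auto simp: lam_def)
qed

lemma lam_0: "N > 0 \<Longrightarrow> lam N 0 = 1" by (simp add: lam_def lam1_0)

lemma lam_tendsto_1: "(\<lambda>q. lam (2 ^ q) k) \<longlonglongrightarrow> 1"
proof -
  have "(\<lambda>q. lam1 (2 ^ q) d) \<longlonglongrightarrow> 1" for d
  proof -
    define K where "K = 3/2 * (real_of_int d)\<^sup>2 * (3 + 2 * \<bar>real_of_int d\<bar>)"
    have "1 - lam1 (2 ^ q) d \<le> K * (1/2) ^ q" for q
    proof -
      let ?N = "2 ^ q :: real"
      have N: "1 \<le> ?N" by simp
      have "1 - lam1 (2 ^ q) d \<le> 3/2 * (real_of_int d)\<^sup>2 * (2 * ?N + 2 * \<bar>real_of_int d\<bar> + 1) / ?N ^ 3"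
        using lam1_lower[of "2 ^ q" d] by simp
      also have "\<dots> \<le> 3/2 * (real_of_int d)\<^sup>2 * ((3 + 2 * \<bar>real_of_int d\<bar>) * ?N) / ?N ^ 3"
      proof (intro divide_right_mono mult_left_mono)
        show "2 * ?N + 2 * \<bar>real_of_int d\<bar> + 1 \<le> (3 + 2 * \<bar>real_of_int d\<bar>) * ?N"
          using N mult_left_mono[OF N, of "2 * \<bar>real_of_int d\<bar>"] unfolding distrib_right by linarith
      qed auto
      also have "\<dots> = K / ?N ^ 2" by (simp add: K_def power2_eq_square power3_eq_cube)
      also have "\<dots> \<le> K / ?N"
      proof (rule divide_left_mono)
        show "?N \<le> ?N ^ 2" using N by (rule self_le_power) simp
        show "0 \<le> K" unfolding K_def by (intro mult_nonneg_nonneg add_nonneg_nonneg) auto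
      qed simp
      finally show ?thesis by (simp add: power_one_over)
    qed
    then have lo: "1 - K * (1/2) ^ q \<le> lam1 (2 ^ q) d" for q by (simp add: algebra_simps)
    have "(\<lambda>q. 1 - K * (1/2) ^ q) \<longlonglongrightarrow> 1 - K * 0"
      by (intro tendsto_diff tendsto_mult tendsto_const LIMSEQ_realpow_zero) simp_all
    then have l: "(\<lambda>q. 1 - K * (1/2) ^ q) \<longlonglongrightarrow> 1" by simp
    show ?thesis
      by (rule tendsto_sandwich[OF always_eventually always_eventually l tendsto_const])
        (simp_all add: lo lam1_le_1)
  qed
  then have "(\<lambda>q. lam1 (2 ^ q) (k $ 1) * lam1 (2 ^ q) (k $ 2) * lam1 (2 ^ q) (k $ 3)) \<longlonglongrightarrow> 1 * 1 * 1"
    by (intro tendsto_mult)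
  then show ?thesis by (simp add: lam_def)
qed

text \<open>On trigonometric polynomials of bounded degree, the multiplier with symbol \<open>lam N\<close> is a convex
  combination of finitely many translations; the mean square distance of the shifts is \<open>O(N\<^sup>-\<^sup>2)\<close>.\<close>

lemma lam_averaging:
  assumes N: "N > 0" and D: "D > 0"
  obtains G :: "(nat \<times> nat \<times> nat) set" and W :: "nat \<times> nat \<times> nat \<Rightarrow> real" and y :: "nat \<times> nat \<times> nat \<Rightarrow> real^3"
  where "finite G" "\<And>g. 0 \<le> W g" "(\<Sum>g\<in>G. W g) = 1"
    "\<And>k. k \<in> freq_box D \<Longrightarrow> (\<Sum>g\<in>G. complex_of_real (W g) * fexp k (y g)) = complex_of_real (lam N k)"
    "\<And>i. (\<Sum>g\<in>G. \<Sum>h\<in>G. W g * W h * (sin (pi * (y g $ i - y h $ i)))\<^sup>2) \<le> 15/2 / real N ^ 2"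
proof -
  \<comment> \<open>Exceeds \<open>|k $ i| + 2 N\<close> for all \<open>k\<close> in
    \<open>freq_box D\<close>, the condition for sampling without aliasing.\<close>
  define R where "R = D + 2 * N + 1"
  define w where "w r = sampled_kernel N (hat N) R r" for r
  define G where "G = {..<R} \<times> {..<R} \<times> {..<R}"
  define W where "W = (\<lambda>(a, b, c). w a * (w b * w c))"
  define y where "y = (\<lambda>(a, b, c). vector [real a / real R, real b / real R, real c / real R] :: real^3)"
  have w0: "0 \<le> w r" for r by (simp add: w_def sampled_kernel_nonneg)
  have W0: "0 \<le> W g" for g by (auto simp: W_def w0 split: prod.split)
  have coeff: "(\<Sum>g\<in>G. complex_of_real (W g) * fexp k (y g)) = complex_of_real (lam N k)"
    if k: "k \<in> freq_box D" for k
  proof -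
    define z where "z d r = complex_of_real (w r) * cis (2 * pi * (real_of_int d * (real r / real R)))" for d r
    have 1: "(\<Sum>r<R. z (k $ i) r) = complex_of_real (lam1 N (k $ i))" for i
    proof -
      have "\<bar>k $ i\<bar> \<le> int D" using k by (simp add: freq_box_def)
      then show ?thesis
        unfolding z_def w_def lam1_def by (intro sampled_kernel_coeff) (auto simp: R_def hat_eq_0)
    qed
    have "fexp k (y (a, b, c)) = cis (2 * pi * (real_of_int (k $ 1) * (real a / real R)))
        * (cis (2 * pi * (real_of_int (k $ 2) * (real b / real R))) * cis (2 * pi * (real_of_int (k $ 3) * (real c / real R))))" for a b c
    proof -
      have "y (a, b, c) = axis 1 (real a / real R) + axis 2 (real b / real R) + axis 3 (real c / real R)"
        by (simp add: y_def vec_eq_iff forall_3 axis_def)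
      then show ?thesis by (simp only: fexp_add fexp_axis mult.assoc)
    qed
    then have "complex_of_real (W (a, b, c)) * fexp k (y (a, b, c)) = z (k $ 1) a * (z (k $ 2) b * z (k $ 3) c)" for a b c
      by (simp add: W_def z_def mult_ac)
    then have "(\<Sum>g\<in>G. complex_of_real (W g) * fexp k (y g))
        = (\<Sum>(a, b, c)\<in>G. z (k $ 1) a * (z (k $ 2) b * z (k $ 3) c))"
      by (intro sum.cong refl) (auto split: prod.split)
    also have "\<dots> = (\<Sum>a<R. \<Sum>b<R. \<Sum>c<R. z (k $ 1) a * (z (k $ 2) b * z (k $ 3) c))"
      unfolding G_def by (simp add: sum.cartesian_product split_beta')
    also have "\<dots> = (\<Sum>a<R. z (k $ 1) a) * ((\<Sum>b<R. z (k $ 2) b) * (\<Sum>c<R. z (k $ 3) c))"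
      unfolding sum_product[of "z (k $ 2)"] unfolding sum_distrib_right unfolding sum_distrib_left by (rule refl)
    finally show ?thesis by (simp add: 1 lam_def)
  qed
  have W1: "(\<Sum>g\<in>G. W g) = 1"
    using coeff[of 0] lam_0[OF N] by (simp add: freq_box_def flip: of_real_sum)
  have moment: "(\<Sum>g\<in>G. \<Sum>h\<in>G. W g * W h * (sin (pi * (y g $ i - y h $ i)))\<^sup>2) \<le> 15/2 / real N ^ 2" for i
  proof -
    define e where "e = (axis i 1 :: int^3)"
    have fe: "freq e = axis i 1" by (simp add: e_def freq_def axis_def vec_eq_iff)
    have eD: "e \<in> freq_box D" using D by (simp add: e_def freq_box_def axis_def)
    \<comment> \<open>The squared sine is half of one minus a cosine, and the cosine of a difference
      factors into characters of the unit frequency \<open>e\<close>. The double average is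
      therefore \<open>(1 - lam1 N 1 ^ 2) / 2\<close>.\<close>
    have s: "(sin (pi * (y g $ i - y h $ i)))\<^sup>2 = (1 - Re (fexp e (y g) * cnj (fexp e (y h)))) / 2" for g h
    proof -
      have "fexp e (y g) * cnj (fexp e (y h)) = cis (2 * (pi * (y g $ i - y h $ i)))"
        by (simp add: fexp_def fe inner_axis' cis_cnj cis_mult algebra_simps)
      then show ?thesis using cos_double_sin[of "pi * (y g $ i - y h $ i)"] by simp
    qed
    have l: "lam N e = lam1 N 1"
      unfolding lam_def e_def using exhaust_3[of i] by (auto simp: axis_def lam1_0[OF N])
    have "(\<Sum>g\<in>G. \<Sum>h\<in>G. complex_of_real (W g) * complex_of_real (W h) * (fexp e (y g) * cnj (fexp e (y h))))
        = (\<Sum>g\<in>G. complex_of_real (W g) * fexp e (y g)) * cnj (\<Sum>g\<in>G. complex_of_real (W g) * fexp e (y g))"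
      unfolding cnj_sum sum_product by (intro sum.cong refl) (simp add: mult_ac)
    also have "\<dots> = complex_of_real ((lam1 N 1)\<^sup>2)"
      unfolding coeff[OF eD] l by (simp add: power2_eq_square)
    finally have "Re (\<Sum>g\<in>G. \<Sum>h\<in>G. complex_of_real (W g) * complex_of_real (W h) * (fexp e (y g) * cnj (fexp e (y h)))) = (lam1 N 1)\<^sup>2"
      by simp
    moreover have p: "Re (complex_of_real r * complex_of_real r' * w) = r * r' * Re w" for r r' w by simp
    ultimately have c: "(\<Sum>g\<in>G. \<Sum>h\<in>G. W g * W h * Re (fexp e (y g) * cnj (fexp e (y h)))) = (lam1 N 1)\<^sup>2"
      unfolding Re_sum p by blast
    have "(\<Sum>g\<in>G. \<Sum>h\<in>G. W g * W h * (sin (pi * (y g $ i - y h $ i)))\<^sup>2)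
        = ((\<Sum>g\<in>G. \<Sum>h\<in>G. W g * W h) - (\<Sum>g\<in>G. \<Sum>h\<in>G. W g * W h * Re (fexp e (y g) * cnj (fexp e (y h))))) / 2"
      unfolding s sum_subtractf[symmetric] sum_divide_distrib by (intro sum.cong refl) (simp add: algebra_simps)
    also have "(\<Sum>g\<in>G. \<Sum>h\<in>G. W g * W h) = 1"
      using W1 by (simp add: sum_product[symmetric])
    also have "(1 - (\<Sum>g\<in>G. \<Sum>h\<in>G. W g * W h * Re (fexp e (y g) * cnj (fexp e (y h))))) / 2 \<le> 1 - lam1 N 1"
    proof -
      have "0 \<le> 1 - 2 * lam1 N 1 + (lam1 N 1)\<^sup>2" using zero_le_power2[of "1 - lam1 N 1"] by (simp add: power2_diff)
      then have "1 - (lam1 N 1)\<^sup>2 \<le> 2 * (1 - lam1 N 1)" unfolding right_diff_distrib by simp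
      then show ?thesis unfolding c by simp
    qed
    \<comment> \<open>The Lipschitz estimate of the symbol at \<open>d = 1\<close>; then
      \<open>2 N + 3 \<le> 5 N\<close> accounts for the constant \<open>15/2\<close>.\<close>
    also have "\<dots> \<le> 3/2 * (2 * real N + 3) / real N ^ 3"
      using lam1_lower[OF N, of 1] by (simp add: add.commute)
    also have "\<dots> \<le> 3/2 * (5 * real N) / real N ^ 3"
      using N by (intro divide_right_mono mult_left_mono) auto
    also have "\<dots> = 15/2 / real N ^ 2" using N by (simp add: power2_eq_square power3_eq_cube)
    finally show ?thesis .
  qed
  show ?thesis by (rule that[OF _ W0 W1 coeff moment]) (auto simp: G_def)
qed

section \<open>The helicity flux\<close>

text \<open>Bilinear, without conjugation: for real fields the conjugate of a coefficient is the
  coefficient at the opposite frequency, so conjugates appear as arguments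
  \<open>- k\<close>.\<close>

definition dotc :: "complex^3 \<Rightarrow> complex^3 \<Rightarrow> complex" where
  "dotc x y = (\<Sum>i\<in>UNIV. x $ i * y $ i)"

definition crossc :: "complex^3 \<Rightarrow> complex^3 \<Rightarrow> complex^3" where
  "crossc x y = vector [x $ 2 * y $ 3 - x $ 3 * y $ 2, x $ 3 * y $ 1 - x $ 1 * y $ 3, x $ 1 * y $ 2 - x $ 2 * y $ 1]"

definition cfreq :: "int^3 \<Rightarrow> complex^3" where
  "cfreq k = (\<chi> i. of_int (k $ i))"

definition curlc :: "(int^3 \<Rightarrow> complex^3) \<Rightarrow> int^3 \<Rightarrow> complex^3" where
  "curlc a k = (2 * pi * \<i>) *s crossc (cfreq k) (a k)"

lemma crossc_nth [simp]:
  "crossc x y $ 1 = x $ 2 * y $ 3 - x $ 3 * y $ 2"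
  "crossc x y $ 2 = x $ 3 * y $ 1 - x $ 1 * y $ 3"
  "crossc x y $ 3 = x $ 1 * y $ 2 - x $ 2 * y $ 1"
  by (simp_all add: crossc_def)

lemma cfreq_add: "cfreq (k + l) = cfreq k + cfreq l" by (simp add: cfreq_def vec_eq_iff)
lemma cfreq_uminus: "cfreq (- k) = - cfreq k" by (simp add: cfreq_def vec_eq_iff)
lemma dotc_add_left: "dotc (x + y) z = dotc x z + dotc y z" by (simp add: dotc_def algebra_simps sum.distrib)
lemma dotc_uminus_left: "dotc (- x) z = - dotc x z" by (simp add: dotc_def sum_negf)
lemma dotc_smult_left: "dotc (c *s x) z = c * dotc x z" by (simp add: dotc_def sum_distrib_left mult.assoc)
lemma dotc_smult_right: "dotc x (c *s z) = c * dotc x z" by (simp add: dotc_def sum_distrib_left mult_ac)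
lemma dotc_commute: "dotc x y = dotc y x" by (simp add: dotc_def mult.commute)
lemma dotc_zero [simp]: "dotc 0 x = 0" "dotc x 0 = 0" by (simp_all add: dotc_def)

lemma dotc_cfreq_curlc [simp]: "dotc (cfreq k) (curlc a k) = 0"
  by (simp add: dotc_def curlc_def sum_3 algebra_simps)

lemma curlc_eq_0: "a k = 0 \<Longrightarrow> curlc a k = 0"
  by (simp add: curlc_def vec_eq_iff forall_3)

lemma curlc_smult: "curlc (\<lambda>k. c k *s a k) k = c k *s curlc a k"
  by (simp add: curlc_def vec_eq_iff forall_3 algebra_simps)

text \<open>The expansion of a double cross product, paired with \<open>v\<close>.\<close>

lemma dotc_crossc_curlc:
  "dotc (crossc x (curlc a l)) v
    = 2 * pi * \<i> * (dotc x (a l) * dotc (cfreq l) v - dotc x (cfreq l) * dotc (a l) v)"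
  by (simp add: dotc_def curlc_def sum_3 algebra_simps)

lemma dotc_crossc_swap: "dotc (crossc x y) z = - dotc (crossc x z) y"
  by (simp add: dotc_def sum_3 algebra_simps)

text \<open>Parseval form of the integral of \<open>K (u x \<omega>) . \<omega>\<close>, where
  \<open>K\<close> has symbol \<open>\<kappa>\<close>. If \<open>\<kappa>\<close> is the square of
  an even real symbol of \<open>S\<close>, this is the integral of
  \<open>S (u x \<omega>) . S \<omega>\<close>.\<close>

definition flux :: "nat \<Rightarrow> (int^3 \<Rightarrow> complex) \<Rightarrow> (int^3 \<Rightarrow> complex^3) \<Rightarrow> complex" where
  "flux N \<kappa> a = (\<Sum>k\<in>freq_box N. \<Sum>l\<in>freq_box N.
     \<kappa> (k + l) * dotc (crossc (a k) (curlc a l)) (curlc a (- (k + l))))"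

text \<open>In \<open>u x \<omega> = grad |u|^2 / 2 - (u . grad) u\<close> the gradient integrates
  to 0 against a divergence-free field. On coefficients, symmetrising \<open>T\<close> in
  \<open>k\<close> and \<open>l\<close> produces \<open>k + l\<close> dotted with a curl at the
  opposite frequency, which is 0. In the other term \<open>div\<close> allows \<open>l\<close> to be
  replaced by \<open>k + l\<close>.\<close>

lemma flux_alt:
  assumes div: "\<And>k. dotc (cfreq k) (a k) = 0"
  shows "flux N \<kappa> a = 2 * pi * \<i> * (\<Sum>k\<in>freq_box N. \<Sum>l\<in>freq_box N.
     \<kappa> (k + l) * (dotc (a k) (cfreq (- (k + l))) * dotc (a l) (curlc a (- (k + l)))))"
proof -
  let ?F = "freq_box N"
  define T where "T k l = \<kappa> (k + l) * (dotc (a k) (a l) * dotc (cfreq l) (curlc a (- (k + l))))" for k l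
  have sym: "T k l + T l k = 0" for k l
  proof -
    have "dotc (cfreq k) v + dotc (cfreq l) v = - dotc (cfreq (- (k + l))) v" for v
      by (simp only: cfreq_uminus dotc_uminus_left cfreq_add dotc_add_left minus_minus)
    from this[of "curlc a (- (k + l))"]
    have z: "dotc (cfreq l) (curlc a (- (k + l))) + dotc (cfreq k) (curlc a (- (k + l))) = 0"
      by (simp only: dotc_cfreq_curlc add.commute minus_zero)
    have "T k l + T l k = \<kappa> (k + l) * (dotc (a k) (a l) * (dotc (cfreq l) (curlc a (- (k + l))) + dotc (cfreq k) (curlc a (- (k + l)))))"
      unfolding T_def by (simp only: add.commute[of l k] dotc_commute[of "a l" "a k"] distrib_left)
    then show ?thesis by (simp only: z mult_zero_right)
  qed
  have "(\<Sum>k\<in>?F. \<Sum>l\<in>?F. T k l) + (\<Sum>k\<in>?F. \<Sum>l\<in>?F. T k l)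
      = (\<Sum>k\<in>?F. \<Sum>l\<in>?F. T k l) + (\<Sum>k\<in>?F. \<Sum>l\<in>?F. T l k)"
    by (subst sum.swap[of _ ?F ?F]) (rule refl)
  also have "\<dots> = 0" unfolding sum.distrib[symmetric] sym by simp
  finally have T0: "(\<Sum>k\<in>?F. \<Sum>l\<in>?F. T k l) = 0" by (simp add: complex_eq_iff)
  have "\<kappa> (k + l) * dotc (crossc (a k) (curlc a l)) (curlc a (- (k + l)))
      = 2 * pi * \<i> * T k l + 2 * pi * \<i> * (\<kappa> (k + l) * (dotc (a k) (cfreq (- (k + l))) * dotc (a l) (curlc a (- (k + l)))))" for k l
  proof -
    have "dotc (a k) (cfreq (- (k + l))) = - dotc (a k) (cfreq l)"
      using div[of k] by (simp only: dotc_commute[of "a k"] cfreq_uminus dotc_uminus_left cfreq_add dotc_add_left) simp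
    then show ?thesis unfolding dotc_crossc_curlc T_def by (simp add: algebra_simps)
  qed
  then have "flux N \<kappa> a = 2 * pi * \<i> * (\<Sum>k\<in>?F. \<Sum>l\<in>?F. T k l)
      + 2 * pi * \<i> * (\<Sum>k\<in>?F. \<Sum>l\<in>?F. \<kappa> (k + l) * (dotc (a k) (cfreq (- (k + l))) * dotc (a l) (curlc a (- (k + l)))))"
    unfolding flux_def by (simp add: sum.distrib sum_distrib_left)
  then show ?thesis by (simp only: T0) simp
qed

text \<open>Pointwise, \<open>u x \<omega>\<close> is orthogonal to \<open>\<omega>\<close>. On
  coefficients, exchanging \<open>l\<close> and \<open>- (k + l)\<close> exchanges the two curls and
  flips the sign of the triple product.\<close>

lemma flux_1_eq_0:
  assumes supp: "\<And>k. k \<notin> freq_box N \<Longrightarrow> a k = 0"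
  shows "flux N (\<lambda>_. 1) a = 0"
proof -
  let ?F = "freq_box N"
  have "(\<Sum>l\<in>?F. dotc (crossc (a k) (curlc a l)) (curlc a (- (k + l)))) = 0" for k
  proof -
    define S where "S = {l \<in> ?F. - (k + l) \<in> ?F}"
    define g where "g l m = dotc (crossc (a k) (curlc a l)) (curlc a m)" for l m
    have "(\<Sum>l\<in>?F. g l (- (k + l))) = (\<Sum>l\<in>S. g l (- (k + l)))"
      unfolding S_def by (rule sum.mono_neutral_right)
        (auto simp: finite_freq_box g_def curlc_eq_0 supp simp del: freq_box_uminus)
    moreover have "(\<Sum>l\<in>S. g l (- (k + l))) = (\<Sum>l\<in>S. g (- (k + l)) l)"
      by (rule sum.reindex_bij_witness[of _ "\<lambda>l. - (k + l)" "\<lambda>l. - (k + l)"])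
        (auto simp: S_def simp del: freq_box_uminus)
    moreover have "(\<Sum>l\<in>S. g (- (k + l)) l) = - (\<Sum>l\<in>S. g l (- (k + l)))"
      unfolding sum_negf[symmetric] g_def by (intro sum.cong refl) (rule dotc_crossc_swap)
    ultimately have "(\<Sum>l\<in>?F. g l (- (k + l))) = - (\<Sum>l\<in>?F. g l (- (k + l)))" by metis
    then have "(\<Sum>l\<in>?F. g l (- (k + l))) = 0" by (simp add: complex_eq_iff)
    then show ?thesis unfolding g_def .
  qed
  then show ?thesis by (simp add: flux_def)
qed

text \<open>Up to index \<open>q\<close> the growing bound is summed, giving a multiple of its last
  term; beyond \<open>q\<close> the decaying one, giving a multiple of its first. The result is
  independent of \<open>M\<close>; in use, \<open>q\<close> is the mollification scale.\<close>

lemma geometric_split_bound: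
  fixes x :: "nat \<Rightarrow> real"
  assumes g: "1 < g" and r: "0 < r" "r < 1" and \<alpha>: "0 \<le> \<alpha>" "0 \<le> \<beta>"
    and x1: "\<And>n. x n \<le> \<alpha> * g ^ n" and x2: "\<And>n. x n \<le> \<beta> * r ^ n"
  shows "(\<Sum>n\<le>M. x n) \<le> \<alpha> * g ^ q * (g / (g - 1)) + \<beta> * r ^ q / (1 - r)"
proof -
  have "(\<Sum>n\<le>M. x n) = (\<Sum>n\<in>{..M} \<inter> {..q}. x n) + (\<Sum>n\<in>{..M} - {..q}. x n)"
    by (rule sum.Int_Diff) simp
  also have "(\<Sum>n\<in>{..M} \<inter> {..q}. x n) \<le> (\<Sum>n\<in>{..M} \<inter> {..q}. \<alpha> * g ^ n)"
    by (intro sum_mono x1)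
  also have "\<dots> \<le> (\<Sum>n\<in>{..<Suc q}. \<alpha> * g ^ n)"
    using \<alpha> g by (intro sum_mono2) auto
  also have "\<dots> = \<alpha> * ((g ^ Suc q - 1) / (g - 1))"
    using g geometric_sum[of g "Suc q"] by (simp only: sum_distrib_left[symmetric])
  also have "\<dots> \<le> \<alpha> * (g ^ Suc q / (g - 1))"
    using g \<alpha> by (intro mult_left_mono divide_right_mono) auto
  also have "\<dots> = \<alpha> * g ^ q * (g / (g - 1))" by simp
  also have "(\<Sum>n\<in>{..M} - {..q}. x n) \<le> (\<Sum>n\<in>{..M} - {..q}. \<beta> * r ^ n)"
    by (intro sum_mono x2)
  also have "\<dots> \<le> (\<Sum>n\<in>(\<lambda>i. q + i) ` {..<Suc M}. \<beta> * r ^ n)"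
  proof (rule sum_mono2)
    show "{..M} - {..q} \<subseteq> (\<lambda>i. q + i) ` {..<Suc M}"
    proof
      fix n assume "n \<in> {..M} - {..q}"
      then show "n \<in> (\<lambda>i. q + i) ` {..<Suc M}" by (intro image_eqI[of _ _ "n - q"]) auto
    qed
  qed (use \<alpha> r in auto)
  also have "\<dots> = (\<Sum>i<Suc M. \<beta> * r ^ q * r ^ i)"
    by (subst sum.reindex) (auto simp: power_add mult.assoc)
  also have "\<dots> = \<beta> * r ^ q * ((1 - r ^ Suc M) / (1 - r))"
    using r by (simp only: sum_distrib_left[symmetric] sum_gp_strict) simp
  also have "\<dots> \<le> \<beta> * r ^ q * (1 / (1 - r))"
    using \<alpha> r by (intro mult_left_mono divide_right_mono) auto
  finally show ?thesis by simp
qed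

section \<open>The flux as a variance, and its dyadic estimate\<close>

lemma n3_lam_multiplier_le:
  assumes "n > 0" "N > 0"
  shows "n3 (trig N (\<lambda>k. complex_of_real (lam n k) * c k)) \<le> n3 (trig N c)"
proof -
  obtain G :: "(nat \<times> nat \<times> nat) set" and W y where G: "finite G" "\<And>g. 0 \<le> W g" "(\<Sum>g\<in>G. W g) = 1"
    "\<And>k. k \<in> freq_box N \<Longrightarrow> (\<Sum>g\<in>G. complex_of_real (W g) * fexp k (y g)) = complex_of_real (lam n k)"
    by (rule lam_averaging[OF assms]) (rule that; assumption)
  have "trig N (\<lambda>k. complex_of_real (lam n k) * c k) x = (\<Sum>g\<in>G. complex_of_real (W g) * trig N c (x + y g))" for x
  proof -
    have "trig N (\<lambda>k. complex_of_real (lam n k) * c k) x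
        = trig N (\<lambda>k. \<Sum>g\<in>G. complex_of_real (W g) * (fexp k (y g) * c k)) x"
      unfolding trig_def by (intro sum.cong refl) (simp add: G(4)[symmetric] sum_distrib_right mult.assoc)
    then show ?thesis by (simp add: trig_sum trig_cmult trig_shift)
  qed
  then have "n3 (trig N (\<lambda>k. complex_of_real (lam n k) * c k)) = n3 (\<lambda>x. \<Sum>g\<in>G. complex_of_real (W g) * trig N c (x + y g))"
    by presburger
  also have "\<dots> \<le> (\<Sum>g\<in>G. n3 (\<lambda>x. complex_of_real (W g) * trig N c (x + y g)))"
    by (intro n3_sum G continuous_on_mult continuous_on_const continuous_on_shift continuous_on_trig)
  also have "\<dots> = (\<Sum>g\<in>G. W g * n3 (trig N c))"
    using G(2) by (simp add: n3_cmult n3_shift[OF continuous_on_trig periodic_trig])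
  also have "\<dots> = n3 (trig N c)" using G(3) by (simp flip: sum_distrib_right)
  finally show ?thesis .
qed

lemma sum_swap_3:
  fixes F :: "'a \<Rightarrow> 'b \<Rightarrow> 'c \<Rightarrow> 'e::comm_monoid_add"
  shows "(\<Sum>a\<in>A. \<Sum>b\<in>B. \<Sum>c\<in>E. F a b c) = (\<Sum>c\<in>E. \<Sum>a\<in>A. \<Sum>b\<in>B. F a b c)"
  proof -
    have "(\<Sum>a\<in>A. \<Sum>b\<in>B. \<Sum>c\<in>E. F a b c) = (\<Sum>a\<in>A. \<Sum>c\<in>E. \<Sum>b\<in>B. F a b c)"
      by (intro sum.cong refl) (rule sum.swap)
    also have "\<dots> = (\<Sum>c\<in>E. \<Sum>a\<in>A. \<Sum>b\<in>B. F a b c)" by (rule sum.swap)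
    finally show ?thesis .
  qed

lemma sum_swap_pairs:
  fixes f :: "'a \<Rightarrow> 'b \<Rightarrow> 'c \<Rightarrow> 'd \<Rightarrow> 'e::comm_monoid_add"
  shows "(\<Sum>a\<in>A. \<Sum>b\<in>B. \<Sum>c\<in>C. \<Sum>d\<in>D. f a b c d) = (\<Sum>c\<in>C. \<Sum>d\<in>D. \<Sum>a\<in>A. \<Sum>b\<in>B. f a b c d)"
proof -
  have "(\<Sum>a\<in>A. \<Sum>b\<in>B. \<Sum>c\<in>C. \<Sum>d\<in>D. f a b c d) = (\<Sum>c\<in>C. \<Sum>a\<in>A. \<Sum>b\<in>B. \<Sum>d\<in>D. f a b c d)"
    by (rule sum_swap_3)
  also have "\<dots> = (\<Sum>c\<in>C. \<Sum>d\<in>D. \<Sum>a\<in>A. \<Sum>b\<in>B. f a b c d)"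
    by (intro sum.cong refl sum_swap_3)
  finally show ?thesis .
qed

text \<open>Coefficients of the \<open>i\<close>-th partial derivative of the \<open>j\<close>-th
  component of \<open>S \<omega>\<close>, for the mollifier \<open>S\<close> with symbol
  \<open>lam n\<close>.\<close>

definition stretching :: "nat \<Rightarrow> (int^3 \<Rightarrow> complex^3) \<Rightarrow> 3 \<Rightarrow> 3 \<Rightarrow> int^3 \<Rightarrow> complex" where
  "stretching n a i j k = 2 * pi * \<i> * (complex_of_real (lam n k) * (cfreq k $ i * curlc a k $ j))"

text \<open>The flux is the integral of the Reynolds stress \<open>S(u \<otimes> u) - S u \<otimes> S u\<close> of the mollifier \<open>S\<close> against
  \<open>\<nabla>S \<omega>\<close>, and the stress is a variance of the translates that \<open>S\<close> averages.\<close>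

lemma flux_eq_variance:
  assumes div: "\<And>k. dotc (cfreq k) (a k) = 0" and supp: "\<And>k. k \<notin> freq_box N \<Longrightarrow> a k = 0"
    and G: "(\<Sum>g\<in>G. W g) = 1"
      "\<And>k. k \<in> freq_box (2 * N) \<Longrightarrow> (\<Sum>g\<in>G. complex_of_real (W g) * fexp k (y g)) = complex_of_real (lam n k)"
  shows "flux N (\<lambda>k. (complex_of_real (lam n k))\<^sup>2) a = (1/2) * (\<Sum>g\<in>G. \<Sum>h\<in>G. complex_of_real (W g * W h) *
     (\<Sum>i\<in>UNIV. \<Sum>j\<in>UNIV. integral cell (\<lambda>x.
        trig N (\<lambda>k. (fexp k (y g) - fexp k (y h)) * a k $ i) x *
        trig N (\<lambda>k. (fexp k (y g) - fexp k (y h)) * a k $ j) x *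
        trig N (stretching n a i j) x)))"
proof -
  let ?F = "freq_box N" and ?l = "\<lambda>k. complex_of_real (lam n k)"
  define X where "X k l = dotc (a k) (cfreq (- (k + l))) * dotc (a l) (curlc a (- (k + l)))" for k l
  define b where "b k = ?l k *s a k" for k
  have cb: "curlc b k = ?l k *s curlc a k" for k unfolding b_def by (rule curlc_smult)
  have divb: "dotc (cfreq k) (b k) = 0" for k by (simp add: b_def dotc_smult_right div)
  \<comment> \<open>The mollified field \<open>b\<close> has zero flux. Subtracting this zero turns
    the weight \<open>lam (k + l) ^ 2\<close> into \<open>lam (k + l)\<close> times
    \<open>lam (k + l) - lam k * lam l\<close>, and the second factor is the symbol of the
    commutator.\<close>
  have "0 = flux N (\<lambda>_. 1) b" by (rule flux_1_eq_0[symmetric]) (simp add: b_def supp)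
  also have "\<dots> = 2 * pi * \<i> * (\<Sum>k\<in>?F. \<Sum>l\<in>?F. ?l k * ?l l * ?l (k + l) * X k l)"
    unfolding flux_alt[OF divb] cb
    by (rule arg_cong2[where f = "(*)", OF refl], intro sum.cong refl)
      (simp only: b_def X_def dotc_smult_left dotc_smult_right lam_uminus mult_1_left mult_ac)
  finally have z: "2 * pi * \<i> * (\<Sum>k\<in>?F. \<Sum>l\<in>?F. ?l k * ?l l * ?l (k + l) * X k l) = 0" by simp
  have "flux N (\<lambda>k. (?l k)\<^sup>2) a = 2 * pi * \<i> * (\<Sum>k\<in>?F. \<Sum>l\<in>?F. (?l (k + l))\<^sup>2 * X k l)"
    unfolding flux_alt[OF div] X_def ..
  also have "\<dots> = 2 * pi * \<i> * (\<Sum>k\<in>?F. \<Sum>l\<in>?F. (?l (k + l))\<^sup>2 * X k l) - 2 * pi * \<i> * (\<Sum>k\<in>?F. \<Sum>l\<in>?F. ?l k * ?l l * ?l (k + l) * X k l)"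
    unfolding z by simp
  also have "\<dots> = (\<Sum>k\<in>?F. \<Sum>l\<in>?F. (?l (k + l) - ?l k * ?l l) * (2 * pi * \<i> * ?l (k + l) * X k l))"
    unfolding right_diff_distrib[symmetric] sum_subtractf[symmetric] sum_distrib_left
    by (intro sum.cong refl) (simp add: algebra_simps power2_eq_square)
  also have "\<dots> = (\<Sum>k\<in>?F. \<Sum>l\<in>?F. \<Sum>g\<in>G. \<Sum>h\<in>G. (1/2) * complex_of_real (W g * W h) *
      ((fexp k (y g) - fexp k (y h)) * (fexp l (y g) - fexp l (y h)) * (2 * pi * \<i> * ?l (k + l) * X k l)))"
  proof (intro sum.cong refl)
    fix k l assume kl: "k \<in> ?F" "l \<in> ?F"
    have box: "k \<in> freq_box (2 * N)" "l \<in> freq_box (2 * N)" "k + l \<in> freq_box (2 * N)"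
    proof -
      show "k \<in> freq_box (2 * N)" "l \<in> freq_box (2 * N)" using kl freq_box_mono[of N "2 * N"] by auto
      have "\<bar>k $ i + l $ i\<bar> \<le> 2 * int N" for i
        using kl abs_triangle_ineq[of "k $ i" "l $ i"] unfolding freq_box_def by (smt (verit) mem_Collect_eq)
      then show "k + l \<in> freq_box (2 * N)" by (simp add: freq_box_def)
    qed
    let ?W = "\<lambda>g. complex_of_real (W g)"
    have W1: "(\<Sum>g\<in>G. ?W g) = 1" using G(1) by (simp flip: of_real_sum)
    have s1: "(\<Sum>g\<in>G. \<Sum>h\<in>G. ?W g * ?W h * fexp (k + l) (y g)) = ?l (k + l)"
    proof -
      have "(\<Sum>g\<in>G. \<Sum>h\<in>G. ?W g * ?W h * fexp (k + l) (y g)) = (\<Sum>g\<in>G. ?W g * fexp (k + l) (y g)) * (\<Sum>h\<in>G. ?W h)"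
        unfolding sum_product by (intro sum.cong refl) (simp add: mult_ac)
      then show ?thesis by (simp add: W1 G(2)[OF box(3)])
    qed
    have s2: "(\<Sum>g\<in>G. \<Sum>h\<in>G. ?W g * ?W h * fexp (k + l) (y h)) = ?l (k + l)"
    proof -
      have "(\<Sum>g\<in>G. \<Sum>h\<in>G. ?W g * ?W h * fexp (k + l) (y h)) = (\<Sum>h\<in>G. ?W h) * (\<Sum>g\<in>G. ?W g * fexp (k + l) (y g))"
        unfolding sum_product by (intro sum.cong refl) (simp add: mult_ac)
      then show ?thesis by (simp add: W1 G(2)[OF box(3)])
    qed
    have s3: "(\<Sum>g\<in>G. \<Sum>h\<in>G. ?W g * ?W h * (fexp k (y g) * fexp l (y h))) = ?l k * ?l l"
      unfolding G(2)[OF box(1), symmetric] G(2)[OF box(2), symmetric] sum_product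
      by (intro sum.cong refl) (simp add: mult_ac)
    have s4: "(\<Sum>g\<in>G. \<Sum>h\<in>G. ?W g * ?W h * (fexp k (y h) * fexp l (y g))) = ?l k * ?l l"
      unfolding mult.commute[of "?l k" "?l l"]
      unfolding G(2)[OF box(1), symmetric] G(2)[OF box(2), symmetric] sum_product
      by (intro sum.cong refl) (simp add: mult_ac)
    \<comment> \<open>A covariance is half the mean product of differences over independent pairs
      \<open>(g, h)\<close>: the unmixed terms give \<open>lam (k + l)\<close> twice, the mixed ones
      \<open>lam k * lam l\<close> twice.\<close>
    have "(\<Sum>g\<in>G. \<Sum>h\<in>G. ?W g * ?W h * ((fexp k (y g) - fexp k (y h)) * (fexp l (y g) - fexp l (y h))))
        = (\<Sum>g\<in>G. \<Sum>h\<in>G. ?W g * ?W h * fexp (k + l) (y g)) + (\<Sum>g\<in>G. \<Sum>h\<in>G. ?W g * ?W h * fexp (k + l) (y h))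
        - (\<Sum>g\<in>G. \<Sum>h\<in>G. ?W g * ?W h * (fexp k (y g) * fexp l (y h)))
        - (\<Sum>g\<in>G. \<Sum>h\<in>G. ?W g * ?W h * (fexp k (y h) * fexp l (y g)))"
      unfolding sum.distrib[symmetric] sum_subtractf[symmetric] fexp_add_freq
      by (intro sum.cong refl) (simp add: algebra_simps)
    also have "\<dots> = 2 * (?l (k + l) - ?l k * ?l l)" unfolding s1 s2 s3 s4 by simp
    finally have v: "?l (k + l) - ?l k * ?l l = (1/2) * (\<Sum>g\<in>G. \<Sum>h\<in>G. ?W g * ?W h * ((fexp k (y g) - fexp k (y h)) * (fexp l (y g) - fexp l (y h))))"
      by simp
    show "(?l (k + l) - ?l k * ?l l) * (2 * pi * \<i> * ?l (k + l) * X k l) = (\<Sum>g\<in>G. \<Sum>h\<in>G. (1/2) * complex_of_real (W g * W h) *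
      ((fexp k (y g) - fexp k (y h)) * (fexp l (y g) - fexp l (y h)) * (2 * pi * \<i> * ?l (k + l) * X k l)))"
      unfolding v sum_distrib_left sum_distrib_right
      by (intro sum.cong refl) (simp add: mult_ac)
  qed
  also have "\<dots> = (\<Sum>g\<in>G. \<Sum>h\<in>G. \<Sum>k\<in>?F. \<Sum>l\<in>?F. (1/2) * complex_of_real (W g * W h) *
      ((fexp k (y g) - fexp k (y h)) * (fexp l (y g) - fexp l (y h)) * (2 * pi * \<i> * ?l (k + l) * X k l)))"
    by (rule sum_swap_pairs)
  also have "\<dots> = (\<Sum>g\<in>G. \<Sum>h\<in>G. (1/2) * (complex_of_real (W g * W h) *
     (\<Sum>i\<in>UNIV. \<Sum>j\<in>UNIV. integral cell (\<lambda>x.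
        trig N (\<lambda>k. (fexp k (y g) - fexp k (y h)) * a k $ i) x *
        trig N (\<lambda>k. (fexp k (y g) - fexp k (y h)) * a k $ j) x *
        trig N (stretching n a i j) x))))"
  proof (intro sum.cong refl)
    fix g h
    define \<delta> where "\<delta> k = fexp k (y g) - fexp k (y h)" for k
    have st: "stretching n a i j k = 0" if "k \<notin> ?F" for i j k
      using that by (simp add: stretching_def curlc_eq_0 supp)
    have X: "2 * pi * \<i> * ?l (k + l) * X k l
        = (\<Sum>i\<in>UNIV. \<Sum>j\<in>UNIV. a k $ i * a l $ j * stretching n a i j (- (k + l)))" for k l
    proof -
      have "X k l = (\<Sum>i\<in>UNIV. \<Sum>j\<in>UNIV. (a k $ i * cfreq (- (k + l)) $ i) * (a l $ j * curlc a (- (k + l)) $ j))"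
        unfolding X_def dotc_def by (rule sum_product)
      moreover have "?l (- (k + l)) = ?l (k + l)" by (simp only: lam_uminus)
      ultimately show ?thesis
        unfolding stretching_def by (simp only: sum_distrib_left) (intro sum.cong refl, simp only: mult_ac)
    qed
    have "(\<Sum>k\<in>?F. \<Sum>l\<in>?F. \<delta> k * \<delta> l * (2 * pi * \<i> * ?l (k + l) * X k l))
        = (\<Sum>k\<in>?F. \<Sum>l\<in>?F. \<Sum>i\<in>UNIV. \<Sum>j\<in>UNIV. (\<delta> k * a k $ i) * (\<delta> l * a l $ j) * stretching n a i j (- (k + l)))"
      unfolding X sum_distrib_left by (intro sum.cong refl) (simp only: mult_ac)
    also have "\<dots> = (\<Sum>i\<in>UNIV. \<Sum>j\<in>UNIV. \<Sum>k\<in>?F. \<Sum>l\<in>?F. (\<delta> k * a k $ i) * (\<delta> l * a l $ j) * stretching n a i j (- (k + l)))"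
      by (rule sum_swap_pairs)
    also have "\<dots> = (\<Sum>i\<in>UNIV. \<Sum>j\<in>UNIV. integral cell (\<lambda>x. trig N (\<lambda>k. \<delta> k * a k $ i) x *
        trig N (\<lambda>k. \<delta> k * a k $ j) x * trig N (stretching n a i j) x))"
      by (intro sum.cong refl integral_trig3[symmetric] st)
    finally show "(\<Sum>k\<in>?F. \<Sum>l\<in>?F. (1/2) * complex_of_real (W g * W h) *
      ((fexp k (y g) - fexp k (y h)) * (fexp l (y g) - fexp l (y h)) * (2 * pi * \<i> * ?l (k + l) * X k l)))
      = (1/2) * (complex_of_real (W g * W h) *
     (\<Sum>i\<in>UNIV. \<Sum>j\<in>UNIV. integral cell (\<lambda>x.
        trig N (\<lambda>k. (fexp k (y g) - fexp k (y h)) * a k $ i) x *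
        trig N (\<lambda>k. (fexp k (y g) - fexp k (y h)) * a k $ j) x *
        trig N (stretching n a i j) x)))"
      unfolding \<delta>_def by (simp only: sum_distrib_left[symmetric] mult.assoc)
  qed
  finally show ?thesis by (simp only: sum_distrib_left)
qed

text \<open>\<open>c n\<close> plays the \<open>n\<close>-th Littlewood-Paley block and
  \<open>r\<close> the decay rate of the blocks. The range of \<open>r\<close> makes
  \<open>(2 r)^n\<close> and \<open>(4 r)^n\<close> grow geometrically while \<open>r^n\<close>
  decays.\<close>

locale dyadic_decomposition =
  fixes r B :: real and N M :: nat and c :: "nat \<Rightarrow> int^3 \<Rightarrow> complex^3"
  assumes r: "1/2 < r" "r < 1" and B: "0 \<le> B" and N: "N > 0"
    and supp: "\<And>n k. k \<notin> freq_box (2 ^ (n + 1)) \<Longrightarrow> c n k = 0"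
    and norm_c: "\<And>n i. n3 (trig N (\<lambda>k. c n k $ i)) \<le> B * r ^ n"
begin

definition a :: "int^3 \<Rightarrow> complex^3" where "a k = (\<Sum>n\<le>M. c n k)"

text \<open>Blocks up to \<open>q\<close> are estimated by the mean value inequality, at the price
  \<open>2^n \<sigma>\<close>, the higher ones by the triangle inequality. Both parts are of order
  \<open>r^q\<close> when \<open>\<sigma>\<close> is of order \<open>2^(-q)\<close>.\<close>

lemma increment_bound:
  assumes \<sigma>: "\<sigma> = (\<Sum>i\<in>UNIV. \<bar>sin (pi * (y $ i - y' $ i))\<bar>)"
  shows "n3 (trig N (\<lambda>k. (fexp k y - fexp k y') * a k $ i))
    \<le> (32 * r / (2 * r - 1) + 2 / (1 - r)) * B * r ^ q * (1 + 2 ^ q * \<sigma>)"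
proof -
  have \<sigma>0: "0 \<le> \<sigma>" unfolding \<sigma> by (intro sum_nonneg) auto
  define x where "x n = n3 (\<lambda>x. trig N (\<lambda>k. c n k $ i) (x + y) - trig N (\<lambda>k. c n k $ i) (x + y'))" for n
  have cs: "continuous_on UNIV (\<lambda>x. trig N (\<lambda>k. c n k $ i) (x + z))" for n z
    by (intro continuous_on_shift continuous_on_trig)
  have eq: "trig N (\<lambda>k. (fexp k y - fexp k y') * a k $ i) x
      = (\<Sum>n\<le>M. trig N (\<lambda>k. c n k $ i) (x + y) - trig N (\<lambda>k. c n k $ i) (x + y'))" for x
  proof -
    have "trig N (\<lambda>k. (fexp k y - fexp k y') * a k $ i) x
        = trig N (\<lambda>k. \<Sum>n\<le>M. fexp k y * c n k $ i + (- 1) * (fexp k y' * c n k $ i)) x"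
      by (simp add: a_def sum_distrib_left algebra_simps)
    also have "\<dots> = (\<Sum>n\<le>M. trig N (\<lambda>k. c n k $ i) (x + y) - trig N (\<lambda>k. c n k $ i) (x + y'))"
      by (simp only: trig_sum trig_add trig_cmult trig_shift) simp
    finally show ?thesis .
  qed
  have "n3 (trig N (\<lambda>k. (fexp k y - fexp k y') * a k $ i)) \<le> (\<Sum>n\<le>M. x n)"
    unfolding eq[abs_def] x_def by (intro n3_sum continuous_on_diff cs) simp
  also have "\<dots> \<le> (16 * \<sigma> * B) * (2 * r) ^ q * (2 * r / (2 * r - 1)) + (2 * B) * r ^ q / (1 - r)"
  proof (rule geometric_split_bound)
    show "x n \<le> 16 * \<sigma> * B * (2 * r) ^ n" for n
    proof -
      have "x n \<le> 8 * real (2 ^ (n + 1)) * \<sigma> * n3 (trig N (\<lambda>k. c n k $ i))"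
        unfolding x_def \<sigma> by (rule trig_diff_shift) (simp_all add: supp)
      also have "\<dots> \<le> 8 * real (2 ^ (n + 1)) * \<sigma> * (B * r ^ n)"
        by (intro mult_left_mono norm_c) (simp add: \<sigma>0)
      finally show ?thesis by (simp add: power_mult_distrib mult_ac)
    qed
    show "x n \<le> 2 * B * r ^ n" for n
    proof -
      have "x n \<le> n3 (\<lambda>x. trig N (\<lambda>k. c n k $ i) (x + y)) + n3 (\<lambda>x. (- 1) * trig N (\<lambda>k. c n k $ i) (x + y'))"
        unfolding x_def using n3_add[OF cs continuous_on_mult[OF continuous_on_const cs], of n y "- 1" n y'] by simp
      also have "\<dots> = 2 * n3 (trig N (\<lambda>k. c n k $ i))"
        by (simp only: n3_cmult n3_shift[OF continuous_on_trig periodic_trig]) simp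
      finally show ?thesis using norm_c[of n i] by simp
    qed
  qed (use r B \<sigma>0 in auto)
  also have "\<dots> = B * r ^ q * (32 * r / (2 * r - 1) * (2 ^ q * \<sigma>) + 2 / (1 - r))"
    by (simp add: power_mult_distrib algebra_simps)
  also have "\<dots> \<le> B * r ^ q * ((32 * r / (2 * r - 1) + 2 / (1 - r)) * (1 + 2 ^ q * \<sigma>))"
  proof (rule mult_left_mono)
    define P where "P = 32 * r / (2 * r - 1)" define Q where "Q = 2 / (1 - r)"
    have "0 \<le> P" "0 \<le> Q" "0 \<le> 2 ^ q * \<sigma>" using r \<sigma>0 by (auto simp: P_def Q_def)
    then show "32 * r / (2 * r - 1) * (2 ^ q * \<sigma>) + 2 / (1 - r) \<le> (32 * r / (2 * r - 1) + 2 / (1 - r)) * (1 + 2 ^ q * \<sigma>)"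
      unfolding P_def[symmetric] Q_def[symmetric] by (simp add: algebra_simps)
  qed (use r B in auto)
  finally show ?thesis by (simp add: mult_ac)
qed

text \<open>Each derivative may be charged to either of two bands, that of the block,
  \<open>2^(n+1)\<close>, or that of the mollifier, \<open>2^(q+1)\<close>. The resulting bounds
  grow like \<open>(4 r)^n\<close> and decay like \<open>4^q r^n\<close>, and they balance at
  \<open>n = q\<close>.\<close>

lemma second_derivative_bound:
  "n3 (trig N (\<lambda>k. of_int (k $ i) * (of_int (k $ j) * (complex_of_real (lam (2 ^ q) k) * a k $ l))))
    \<le> (64 * r / (4 * r - 1) + 16 / (1 - r)) * B * (4 * r) ^ q"
proof -
  let ?p = "\<lambda>n. trig N (\<lambda>k. of_int (k $ i) * (of_int (k $ j) * (complex_of_real (lam (2 ^ q) k) * c n k $ l)))"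
  define x where "x n = n3 (?p n)" for n
  have eq: "trig N (\<lambda>k. of_int (k $ i) * (of_int (k $ j) * (complex_of_real (lam (2 ^ q) k) * a k $ l))) x
      = (\<Sum>n\<le>M. ?p n x)" for x
    unfolding trig_sum[symmetric] by (simp add: a_def sum_distrib_left)
  have "n3 (trig N (\<lambda>k. of_int (k $ i) * (of_int (k $ j) * (complex_of_real (lam (2 ^ q) k) * a k $ l)))) \<le> (\<Sum>n\<le>M. x n)"
    unfolding eq[abs_def] x_def by (intro n3_sum continuous_on_trig) simp
  also have "\<dots> \<le> (16 * B) * (4 * r) ^ q * (4 * r / (4 * r - 1)) + (16 * 4 ^ q * B) * r ^ q / (1 - r)"
  proof (rule geometric_split_bound)
    \<comment> \<open>Used with \<open>m = n\<close> for the support of the block and with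
      \<open>m = q\<close> for that of the mollifier.\<close>
    have D: "x n \<le> (2 * real (2 ^ (m + 1))) * ((2 * real (2 ^ (m + 1))) * (B * r ^ n))"
      if z: "\<And>k. k \<notin> freq_box (2 ^ (m + 1)) \<Longrightarrow> complex_of_real (lam (2 ^ q) k) * c n k $ l = 0" for n m
    proof -
      have "x n \<le> (2 * real (2 ^ (m + 1))) * n3 (trig N (\<lambda>k. of_int (k $ j) * (complex_of_real (lam (2 ^ q) k) * c n k $ l)))"
        unfolding x_def by (rule bernstein) (simp_all add: z)
      also have "\<dots> \<le> (2 * real (2 ^ (m + 1))) * ((2 * real (2 ^ (m + 1))) * n3 (trig N (\<lambda>k. complex_of_real (lam (2 ^ q) k) * c n k $ l)))"
        by (intro mult_left_mono bernstein) (simp_all add: z)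
      also have "\<dots> \<le> (2 * real (2 ^ (m + 1))) * ((2 * real (2 ^ (m + 1))) * (B * r ^ n))"
        by (intro mult_left_mono order_trans[OF n3_lam_multiplier_le norm_c]) (simp_all add: N)
      finally show ?thesis .
    qed
    have four: "(2::real) ^ m * 2 ^ m = 4 ^ m" for m by (simp flip: power_mult_distrib)
    show "x n \<le> 16 * B * (4 * r) ^ n" for n
      using D[of n n] by (simp add: supp power_mult_distrib four[symmetric] mult_ac)
    show "x n \<le> 16 * 4 ^ q * B * r ^ n" for n
      using D[of q n] by (simp add: lam_eq_0 four[symmetric] mult_ac)
  qed (use r B in auto)
  also have "\<dots> = (64 * r / (4 * r - 1) + 16 / (1 - r)) * B * (4 * r) ^ q"
    by (simp add: power_mult_distrib algebra_simps)
  finally show ?thesis .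
qed

text \<open>A component of the curl is a difference of two first derivatives, so each entry is a
  difference of two second derivatives of the mollified field, with the factor
  \<open>(2 pi i)^2 = - 4 pi^2\<close>.\<close>

lemma stretching_bound:
  "n3 (trig N (stretching (2 ^ q) a i j))
    \<le> 8 * pi\<^sup>2 * (64 * r / (4 * r - 1) + 16 / (1 - r)) * B * (4 * r) ^ q"
proof -
  define K where "K = (64 * r / (4 * r - 1) + 16 / (1 - r)) * B * (4 * r) ^ q"
  define s where "s \<alpha> \<beta> k = of_int (k $ i) * (of_int (k $ \<alpha>) * (complex_of_real (lam (2 ^ q) k) * a k $ \<beta>))" for \<alpha> \<beta> :: 3 and k
  have b: "n3 (trig N (s \<alpha> \<beta>)) \<le> K" for \<alpha> \<beta>
    unfolding s_def[abs_def] K_def by (rule second_derivative_bound)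
  have two: "n3 (trig N (stretching (2 ^ q) a i j)) \<le> 4 * pi\<^sup>2 * (K + K)"
    if st: "\<And>k. stretching (2 ^ q) a i j k = - (4 * pi\<^sup>2) * (s \<alpha> \<beta> k + (- 1) * s \<beta> \<alpha> k)" for \<alpha> \<beta>
  proof -
    have "trig N (stretching (2 ^ q) a i j) = (\<lambda>x. - (4 * pi\<^sup>2) * (trig N (s \<alpha> \<beta>) x + (- 1) * trig N (s \<beta> \<alpha>) x))"
      unfolding st[abs_def] trig_cmult[abs_def] trig_add by (simp only: trig_cmult)
    then have "n3 (trig N (stretching (2 ^ q) a i j)) = 4 * pi\<^sup>2 * n3 (\<lambda>x. trig N (s \<alpha> \<beta>) x + (- 1) * trig N (s \<beta> \<alpha>) x)"
      by (simp only: n3_cmult) (simp add: norm_mult norm_power)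
    also have "\<dots> \<le> 4 * pi\<^sup>2 * (n3 (trig N (s \<alpha> \<beta>)) + n3 (\<lambda>x. (- 1) * trig N (s \<beta> \<alpha>) x))"
      by (intro mult_left_mono n3_add continuous_on_trig continuous_on_mult continuous_on_const) auto
    also have "\<dots> \<le> 4 * pi\<^sup>2 * (K + K)"
      unfolding n3_cmult using b[of \<alpha> \<beta>] b[of \<beta> \<alpha>] by (intro mult_left_mono) auto
    finally show ?thesis .
  qed
  have ii: "\<i> * (\<i> * z) = - z" for z :: complex by (simp add: mult.assoc[symmetric])
  consider "j = 1" | "j = 2" | "j = 3" using exhaust_3[of j] by blast
  then have "n3 (trig N (stretching (2 ^ q) a i j)) \<le> 4 * pi\<^sup>2 * (K + K)"
  proof cases
    case 1 show ?thesis
      by (rule two[of 2 3]) (simp add: 1 stretching_def s_def curlc_def cfreq_def power2_eq_square algebra_simps ii)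
  next
    case 2 show ?thesis
      by (rule two[of 3 1]) (simp add: 2 stretching_def s_def curlc_def cfreq_def power2_eq_square algebra_simps ii)
  next
    case 3 show ?thesis
      by (rule two[of 1 2]) (simp add: 3 stretching_def s_def curlc_def cfreq_def power2_eq_square algebra_simps ii)
  qed
  then show ?thesis by (simp add: K_def mult_ac)
qed

end

text \<open>The bracketed factors belong to the two increments and to the derivative of the
  mollified vorticity. The number 617 rounds up \<open>9 * 137 / 2\<close>: nine index pairs, the
  weighted second moment 137, and the 1/2 of the variance formula.\<close>

definition flux_const :: "real \<Rightarrow> real" where
  "flux_const r = 617 * (32 * r / (2 * r - 1) + 2 / (1 - r))\<^sup>2 * (8 * pi\<^sup>2 * (64 * r / (4 * r - 1) + 16 / (1 - r)))"

text \<open>Hoelder's inequality with three \<open>L^3\<close> factors gives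
  \<open>(r^q)^2 (4 r)^q = (4 r^3)^q\<close>. For each pair of shifts it carries
  \<open>(1 + 2^q \<sigma>)^2\<close>, so only second moments of the shifts enter. The bound does
  not involve \<open>M\<close> and \<open>N\<close>, which permits a limit later.\<close>

theorem flux_bound:
  assumes dd: "dyadic_decomposition r B N c"
    and div: "\<And>n k. dotc (cfreq k) (c n k) = 0" and M: "2 ^ (M + 1) \<le> N"
  shows "norm (flux N (\<lambda>k. (complex_of_real (lam (2 ^ q) k))\<^sup>2) (\<lambda>k. \<Sum>n\<le>M. c n k)) \<le> flux_const r * B ^ 3 * (4 * r ^ 3) ^ q"
proof -
  interpret dyadic_decomposition r B N M c by (rule dd)
  have aeq: "(\<lambda>k. \<Sum>n\<le>M. c n k) = a" by (simp add: a_def[abs_def])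
  have N2: "2 * N > 0" using N by simp
  have q0: "(2::nat) ^ q > 0" by simp
  obtain G :: "(nat \<times> nat \<times> nat) set" and W y where G: "finite G" "\<And>g. 0 \<le> W g" "(\<Sum>g\<in>G. W g) = 1"
    "\<And>k. k \<in> freq_box (2 * N) \<Longrightarrow> (\<Sum>g\<in>G. complex_of_real (W g) * fexp k (y g)) = complex_of_real (lam (2 ^ q) k)"
    "\<And>i. (\<Sum>g\<in>G. \<Sum>h\<in>G. W g * W h * (sin (pi * (y g $ i - y h $ i)))\<^sup>2) \<le> 15/2 / real (2 ^ q) ^ 2"
    by (rule lam_averaging[OF q0 N2]) (rule that; assumption)
  have diva: "dotc (cfreq k) (a k) = 0" for k
  proof -
    have "dotc (cfreq k) (a k) = (\<Sum>n\<le>M. dotc (cfreq k) (c n k))"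
      unfolding dotc_def a_def sum_component sum_distrib_left by (rule sum.swap)
    then show ?thesis by (simp add: div)
  qed
  have suppa: "a k = 0" if k: "k \<notin> freq_box N" for k
  proof -
    have "c n k = 0" if "n \<le> M" for n
    proof (rule supp)
      have "(2::nat) ^ (n + 1) \<le> 2 ^ (M + 1)" using that by (intro power_increasing) auto
      then have "freq_box (2 ^ (n + 1)) \<subseteq> freq_box N" using M by (intro freq_box_mono) linarith
      then show "k \<notin> freq_box (2 ^ (n + 1))" using k by blast
    qed
    then show ?thesis by (simp add: a_def)
  qed
  define C1 where "C1 = 32 * r / (2 * r - 1) + 2 / (1 - r)"
  define C2 where "C2 = 8 * pi\<^sup>2 * (64 * r / (4 * r - 1) + 16 / (1 - r))"
  have C: "0 \<le> C1" "0 \<le> C2" using r by (auto simp: C1_def C2_def)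
  define \<sigma> where "\<sigma> g h = (\<Sum>i\<in>UNIV. \<bar>sin (pi * (y g $ i - y h $ i))\<bar>)" for g h
  have \<sigma>0: "0 \<le> \<sigma> g h" for g h unfolding \<sigma>_def by (intro sum_nonneg) auto
  define I where "I g h i j = integral cell (\<lambda>x.
        trig N (\<lambda>k. (fexp k (y g) - fexp k (y h)) * a k $ i) x *
        trig N (\<lambda>k. (fexp k (y g) - fexp k (y h)) * a k $ j) x *
        trig N (stretching (2 ^ q) a i j) x)" for g h i j
  define K where "K = C1\<^sup>2 * C2 * B ^ 3 * (4 * r ^ 3) ^ q"
  have K0: "0 \<le> K" unfolding K_def using C B r by auto
  have Ib: "norm (I g h i j) \<le> K * (1 + 2 ^ q * \<sigma> g h)\<^sup>2" for g h i j
  proof -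
    have "norm (I g h i j) \<le> n3 (trig N (\<lambda>k. (fexp k (y g) - fexp k (y h)) * a k $ i)) *
        n3 (trig N (\<lambda>k. (fexp k (y g) - fexp k (y h)) * a k $ j)) * n3 (trig N (stretching (2 ^ q) a i j))"
      unfolding I_def by (intro holder3 continuous_on_trig)
    also have "\<dots> \<le> (C1 * B * r ^ q * (1 + 2 ^ q * \<sigma> g h)) * (C1 * B * r ^ q * (1 + 2 ^ q * \<sigma> g h)) * (C2 * B * (4 * r) ^ q)"
      unfolding C1_def C2_def
      by (intro mult_mono increment_bound stretching_bound mult_nonneg_nonneg n3_nonneg continuous_on_trig)
        (use C B r \<sigma>0[of g h] in \<open>simp_all add: \<sigma>_def C1_def[symmetric] C2_def[symmetric]\<close>)
    also have "\<dots> = K * (1 + 2 ^ q * \<sigma> g h)\<^sup>2"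
      by (simp add: K_def power_mult_distrib power2_eq_square power3_eq_cube mult_ac)
    finally show ?thesis .
  qed
  \<comment> \<open>The second moment is \<open>O(4^(-q))\<close> and absorbs the factor
    \<open>4^q\<close>, leaving \<open>2 + 6 * 3 * 15/2 = 137\<close> uniformly in
    \<open>q\<close>.\<close>
  have mom: "(\<Sum>g\<in>G. \<Sum>h\<in>G. W g * W h * (1 + 2 ^ q * \<sigma> g h)\<^sup>2) \<le> 137"
  proof -
    define S where "S g h = (\<Sum>i\<in>UNIV. (sin (pi * (y g $ i - y h $ i)))\<^sup>2)" for g h
    have \<sigma>S: "(\<sigma> g h)\<^sup>2 \<le> 3 * S g h" for g h
      using sum_squares_bound[of "\<bar>sin (pi * (y g $ 1 - y h $ 1))\<bar>" "\<bar>sin (pi * (y g $ 2 - y h $ 2))\<bar>"]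
        sum_squares_bound[of "\<bar>sin (pi * (y g $ 1 - y h $ 1))\<bar>" "\<bar>sin (pi * (y g $ 3 - y h $ 3))\<bar>"]
        sum_squares_bound[of "\<bar>sin (pi * (y g $ 2 - y h $ 2))\<bar>" "\<bar>sin (pi * (y g $ 3 - y h $ 3))\<bar>"]
      unfolding \<sigma>_def S_def sum_3 power2_eq_square by (simp add: algebra_simps)
    have "(1 + 2 ^ q * \<sigma> g h)\<^sup>2 \<le> 2 + 6 * 4 ^ q * S g h" for g h
    proof -
      have "(1 + 2 ^ q * \<sigma> g h)\<^sup>2 \<le> 2 + 2 * (2 ^ q * \<sigma> g h)\<^sup>2"
        using zero_le_power2[of "1 - 2 ^ q * \<sigma> g h"] by (simp add: power2_sum power2_diff)
      also have "(2 ^ q * \<sigma> g h)\<^sup>2 = 4 ^ q * (\<sigma> g h)\<^sup>2"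
        by (simp add: power_mult_distrib power2_eq_square flip: power_mult_distrib[of 2 2 q])
      also have "2 + 2 * (4 ^ q * (\<sigma> g h)\<^sup>2) \<le> 2 + 2 * (4 ^ q * (3 * S g h))"
        using \<sigma>S by (intro add_left_mono mult_left_mono) auto
      finally show ?thesis by simp
    qed
    then have "(\<Sum>g\<in>G. \<Sum>h\<in>G. W g * W h * (1 + 2 ^ q * \<sigma> g h)\<^sup>2) \<le> (\<Sum>g\<in>G. \<Sum>h\<in>G. W g * W h * (2 + 6 * 4 ^ q * S g h))"
      by (intro sum_mono mult_left_mono) (auto simp: G)
    also have "\<dots> = 2 * (\<Sum>g\<in>G. \<Sum>h\<in>G. W g * W h) + 6 * 4 ^ q * (\<Sum>g\<in>G. \<Sum>h\<in>G. W g * W h * S g h)"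
      unfolding sum_distrib_left sum.distrib[symmetric] by (intro sum.cong refl) (simp add: algebra_simps)
    also have "(\<Sum>g\<in>G. \<Sum>h\<in>G. W g * W h) = 1" using G(3) by (simp add: sum_product[symmetric])
    also have "(\<Sum>g\<in>G. \<Sum>h\<in>G. W g * W h * S g h) = (\<Sum>i\<in>UNIV. \<Sum>g\<in>G. \<Sum>h\<in>G. W g * W h * (sin (pi * (y g $ i - y h $ i)))\<^sup>2)"
      unfolding S_def sum_3 distrib_left sum.distrib ..
    also have "2 * 1 + 6 * 4 ^ q * \<dots> \<le> 2 * 1 + 6 * 4 ^ q * (\<Sum>i\<in>(UNIV :: 3 set). 15/2 / real (2 ^ q) ^ 2)"
      by (intro add_left_mono mult_left_mono sum_mono G(5)) auto
    also have "real (2 ^ q) ^ 2 = 4 ^ q" by (simp add: power2_eq_square flip: power_mult_distrib[of 2 2 q])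
    finally show ?thesis by simp
  qed
  have "flux N (\<lambda>k. (complex_of_real (lam (2 ^ q) k))\<^sup>2) a
      = (1/2) * (\<Sum>g\<in>G. \<Sum>h\<in>G. complex_of_real (W g * W h) * (\<Sum>i\<in>UNIV. \<Sum>j\<in>UNIV. I g h i j))"
    unfolding I_def by (rule flux_eq_variance[OF diva suppa G(3,4)])
  also have "norm \<dots> \<le> (1/2) * (\<Sum>g\<in>G. \<Sum>h\<in>G. (W g * W h) * (9 * (K * (1 + 2 ^ q * \<sigma> g h)\<^sup>2)))"
  proof -
    have "norm (complex_of_real (W g * W h) * (\<Sum>i\<in>UNIV. \<Sum>j\<in>UNIV. I g h i j)) \<le> (W g * W h) * (9 * (K * (1 + 2 ^ q * \<sigma> g h)\<^sup>2))" for g h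
    proof -
      have "norm (\<Sum>i\<in>UNIV. \<Sum>j\<in>UNIV. I g h i j) \<le> (\<Sum>i\<in>(UNIV::3 set). \<Sum>j\<in>(UNIV::3 set). K * (1 + 2 ^ q * \<sigma> g h)\<^sup>2)"
        by (intro sum_norm_le Ib)
      then have "norm (\<Sum>i\<in>UNIV. \<Sum>j\<in>UNIV. I g h i j) \<le> 9 * (K * (1 + 2 ^ q * \<sigma> g h)\<^sup>2)" by simp
      then show ?thesis
        unfolding norm_mult using G(2) by (intro mult_mono) (auto simp: norm_mult abs_mult)
    qed
    then have "norm (\<Sum>g\<in>G. \<Sum>h\<in>G. complex_of_real (W g * W h) * (\<Sum>i\<in>UNIV. \<Sum>j\<in>UNIV. I g h i j))
      \<le> (\<Sum>g\<in>G. \<Sum>h\<in>G. (W g * W h) * (9 * (K * (1 + 2 ^ q * \<sigma> g h)\<^sup>2)))"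
      by (intro sum_norm_le)
    then show ?thesis unfolding norm_mult by simp
  qed
  also have "\<dots> = 9 / 2 * K * (\<Sum>g\<in>G. \<Sum>h\<in>G. W g * W h * (1 + 2 ^ q * \<sigma> g h)\<^sup>2)"
    unfolding sum_distrib_left by (intro sum.cong refl) simp
  also have "\<dots> \<le> 9 / 2 * K * 137" using mom K0 by (intro mult_left_mono) auto
  also have "\<dots> \<le> 617 * K" using K0 by simp
  finally show ?thesis unfolding aeq by (simp add: flux_const_def K_def C1_def C2_def mult_ac)
qed

section \<open>Fourier coefficients of distributions\<close>

text \<open>A complex amplitude covers the cosine (\<open>z = 1\<close>) and the sine
  (\<open>z = \<i>\<close>) in one family, on which a distribution takes the value
  \<open>Re (z * c)\<close> with \<open>c\<close> its Fourier coefficient.\<close>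

definition wave :: "int^3 \<Rightarrow> complex \<Rightarrow> real^3 \<Rightarrow> real" where
  "wave m z x = Re (z * cnj (fexp m x))"

lemma wave_eq: "wave m z x = Re z * cos (2 * pi * (freq m \<bullet> x)) + Im z * sin (2 * pi * (freq m \<bullet> x))"
  by (simp add: wave_def fexp_def)

lemma smooth_wave: "smooth (wave m z)"
proof -
  have L: "bounded_linear (\<lambda>x. 2 * pi * (freq m \<bullet> x))"
    by (intro bounded_linear_const_mult bounded_linear_inner_right)
  show ?thesis
    using smooth_compose_linear[OF L smooth_sin_cos[of "Re z" "Im z"]] by (simp add: wave_eq[abs_def])
qed

lemma torus_test_wave: "torus_test (wave m z)"
  unfolding torus_test_def using smooth_wave periodic_fexp by (auto simp: wave_def periodic_def)

lemma wave_has_derivative: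
  "(wave m z has_derivative (\<lambda>v. wave m (- (2 * pi * (freq m \<bullet> v)) * \<i> * z) x)) (at x)"
  unfolding wave_eq[abs_def]
  by (auto intro!: derivative_eq_intros simp: fun_eq_iff algebra_simps)

lemma frechet_derivative_wave:
  "frechet_derivative (wave m z) (at x) v = wave m (- (2 * pi * (freq m \<bullet> v)) * \<i> * z) x"
  by (simp flip: frechet_derivative_at[OF wave_has_derivative])

lemma torus_distribution_linear:
  assumes "torus_distribution f" "torus_test \<phi>" "torus_test \<psi>"
  shows "f (\<lambda>x. a * \<phi> x + b * \<psi> x) = a * f \<phi> + b * f \<psi>"
  using assms unfolding torus_distribution_def by blast

lemma cos_wave: "(\<lambda>x. cos (2 * pi * (freq k \<bullet> x))) = wave k 1" by (simp add: wave_eq[abs_def])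
lemma sin_wave: "(\<lambda>x. sin (2 * pi * (freq k \<bullet> x))) = wave k \<i>" by (simp add: wave_eq[abs_def])

lemma fourier_coeff_wave: "fourier_coeff f k = Complex (f (wave k 1)) (- f (wave k \<i>))"
  by (simp add: fourier_coeff_def cos_wave sin_wave)

lemma fourier_coeff_eqI:
  assumes "\<And>z. f (wave k z) = Re (z * c)"
  shows "fourier_coeff f k = c"
  by (simp add: fourier_coeff_wave assms complex_eq_iff)

lemma torus_distribution_wave:
  assumes "torus_distribution f"
  shows "f (wave m z) = Re (z * fourier_coeff f m)"
proof -
  have "wave m z = (\<lambda>x. Re z * wave m 1 x + Im z * wave m \<i> x)" by (simp add: wave_eq fun_eq_iff)
  then have "f (wave m z) = Re z * f (wave m 1) + Im z * f (wave m \<i>)"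
    using torus_distribution_linear[OF assms torus_test_wave torus_test_wave] by metis
  then show ?thesis by (simp add: fourier_coeff_wave)
qed

lemma dist_partial_wave:
  assumes "torus_distribution f"
  shows "dist_partial j f (wave m z) = Re (z * (2 * pi * \<i> * of_int (m $ j) * fourier_coeff f m))"
proof -
  have "freq m \<bullet> axis j 1 = real_of_int (m $ j)" by (simp add: inner_axis freq_def)
  then show ?thesis
    unfolding dist_partial_def frechet_derivative_wave
    by (simp add: torus_distribution_wave[OF assms] algebra_simps)
qed

definition uhat :: "functional^3 \<Rightarrow> int^3 \<Rightarrow> complex^3" where
  "uhat f k = (\<chi> i. fourier_coeff (f $ i) k)"

lemma dist_curl_wave:
  assumes "\<forall>i. torus_distribution (f $ i)"
  shows "(dist_curl f $ i) (wave m z) = Re (z * curlc (uhat f) m $ i)"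
  using exhaust_3[of i] assms
  by (elim disjE)
    (simp_all add: dist_curl_def dist_partial_wave curlc_def uhat_def cfreq_def algebra_simps)

lemma dist_div_wave:
  assumes "\<forall>i. torus_distribution (f $ i)"
  shows "dist_div f (wave m z) = Re (z * (2 * pi * \<i> * dotc (cfreq m) (uhat f m)))"
  using assms
  by (simp add: dist_div_def dist_partial_wave dotc_def uhat_def cfreq_def sum_3 algebra_simps)

lemma uhat_div_free:
  assumes "\<forall>i. torus_distribution (f $ i)" "dist_eq (dist_div f) (\<lambda>\<phi>. 0)"
  shows "dotc (cfreq m) (uhat f m) = 0"
proof -
  have "Re (z * (2 * pi * \<i> * dotc (cfreq m) (uhat f m))) = 0" for z
    using assms(2) dist_div_wave[OF assms(1)] torus_test_wave unfolding dist_eq_def by metis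
  from this[of 1] this[of "\<i>"] show ?thesis by (simp add: complex_eq_iff)
qed

lemma fourier_coeff_uminus:
  assumes "torus_distribution f"
  shows "fourier_coeff f (- k) = cnj (fourier_coeff f k)"
proof -
  have "wave (- k) z = wave k (cnj z)" for z by (simp add: wave_eq freq_uminus fun_eq_iff)
  then show ?thesis
    by (intro fourier_coeff_eqI) (simp add: torus_distribution_wave[OF assms])
qed

section \<open>Littlewood-Paley blocks as trigonometric polynomials\<close>

definition cutoff_symbol :: "(real^3 \<Rightarrow> real) \<Rightarrow> nat \<Rightarrow> int^3 \<Rightarrow> real" where
  "cutoff_symbol \<theta> n k = \<theta> (freq k /\<^sub>R 2 ^ n)"

fun block_symbol :: "(real^3 \<Rightarrow> real) \<Rightarrow> nat \<Rightarrow> int^3 \<Rightarrow> real" where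
  "block_symbol \<theta> 0 k = cutoff_symbol \<theta> 0 k"
| "block_symbol \<theta> (Suc n) k = cutoff_symbol \<theta> (Suc n) k - cutoff_symbol \<theta> n k"

lemma sum_block_symbol: "(\<Sum>n\<le>M. block_symbol \<theta> n k) = cutoff_symbol \<theta> M k"
  by (induction M) auto

lemma abs_component_le_norm_freq: "\<bar>real_of_int (k $ i)\<bar> \<le> norm (freq k)"
  using component_le_norm_cart[of "freq k" i] by (simp add: freq_def)

context
  fixes \<theta> :: "real^3 \<Rightarrow> real"
  assumes \<theta>: "dyadic_cutoff \<theta>"
begin

lemma cutoff_symbol_bounds: "0 \<le> cutoff_symbol \<theta> n k" "cutoff_symbol \<theta> n k \<le> 1"
  using \<theta> by (auto simp: cutoff_symbol_def dyadic_cutoff_def)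

lemma cutoff_symbol_uminus: "cutoff_symbol \<theta> n (- k) = cutoff_symbol \<theta> n k"
proof -
  have "norm (freq (- k) /\<^sub>R 2 ^ n) = norm (freq k /\<^sub>R 2 ^ n)" by (simp add: freq_uminus)
  then show ?thesis using \<theta> unfolding cutoff_symbol_def dyadic_cutoff_def by blast
qed

lemma cutoff_symbol_eq_1: "norm (freq k) \<le> 2 ^ n \<Longrightarrow> cutoff_symbol \<theta> n k = 1"
  using \<theta> unfolding cutoff_symbol_def dyadic_cutoff_def by (auto simp: field_simps)

lemma cutoff_symbol_eq_0: "norm (freq k) \<ge> 3/2 * 2 ^ n \<Longrightarrow> cutoff_symbol \<theta> n k = 0"
  using \<theta> unfolding cutoff_symbol_def dyadic_cutoff_def by (auto simp: field_simps)

lemma cutoff_symbol_support: "k \<notin> freq_box (2 ^ (n + 1)) \<Longrightarrow> cutoff_symbol \<theta> n k = 0"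
proof (rule cutoff_symbol_eq_0)
  assume "k \<notin> freq_box (2 ^ (n + 1))"
  then obtain i where "\<not> \<bar>k $ i\<bar> \<le> int (2 ^ (n + 1))" by (auto simp: freq_box_def)
  then have "real_of_int (int (2 ^ (n + 1))) < real_of_int \<bar>k $ i\<bar>" by linarith
  then have "2 * 2 ^ n < \<bar>real_of_int (k $ i)\<bar>" by simp
  moreover have "3/2 * 2 ^ n \<le> (2::real) * 2 ^ n" by simp
  ultimately show "norm (freq k) \<ge> 3/2 * 2 ^ n" using abs_component_le_norm_freq[of k i] by linarith
qed

lemma block_symbol_support: "k \<notin> freq_box (2 ^ (n + 1)) \<Longrightarrow> block_symbol \<theta> n k = 0"
proof (cases n)
  case (Suc m)
  assume k: "k \<notin> freq_box (2 ^ (n + 1))"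
  have "freq_box (2 ^ (m + 1)) \<subseteq> freq_box (2 ^ (n + 1))" unfolding Suc by (intro freq_box_mono) simp
  then show ?thesis using k cutoff_symbol_support[of k n] cutoff_symbol_support[of k m] Suc by auto
qed (simp add: cutoff_symbol_support)

lemma abs_block_symbol_le: "\<bar>block_symbol \<theta> n k\<bar> \<le> 1"
proof (cases n)
  case (Suc m) then show ?thesis using cutoff_symbol_bounds[of n k] cutoff_symbol_bounds[of m k] by auto
qed (use cutoff_symbol_bounds[of 0 k] in auto)

lemma block_symbol_eq_0_large: "norm (freq k) \<le> 2 ^ n \<Longrightarrow> block_symbol \<theta> (Suc n) k = 0"
proof -
  assume k: "norm (freq k) \<le> 2 ^ n"
  then have "norm (freq k) \<le> 2 ^ Suc n" by (rule order_trans) simp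
  with k show ?thesis by (simp add: cutoff_symbol_eq_1)
qed

text \<open>Block \<open>n\<close> lives below \<open>3/2 * 2^n\<close> and block \<open>m\<close>
  above \<open>2^(m-1)\<close>; since \<open>3/2 \<le> 2\<close>, these ranges are disjoint once
  \<open>m \<ge> n + 2\<close>.\<close>

lemma block_symbol_adjacent:
  assumes "block_symbol \<theta> n k \<noteq> 0" "block_symbol \<theta> m k \<noteq> 0" "n < m"
  shows "m = n + 1"
proof (rule ccontr)
  assume "m \<noteq> n + 1"
  then obtain p where p: "m = Suc p" "n + 1 \<le> p" using assms(3) by (cases m) auto
  have "\<not> norm (freq k) \<le> 2 ^ p" using assms(2) block_symbol_eq_0_large[of k p] p by auto
  moreover have "(2::real) ^ (n + 1) \<le> 2 ^ p" using p by (intro power_increasing) auto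
  moreover have "(0::real) < 2 ^ n" by simp
  ultimately have large: "norm (freq k) \<ge> 3/2 * 2 ^ n" unfolding power_add power_one_right by linarith
  have "cutoff_symbol \<theta> n k = 0" by (rule cutoff_symbol_eq_0[OF large])
  moreover have "cutoff_symbol \<theta> n' k = 0" if "n = Suc n'" for n'
  proof (rule cutoff_symbol_eq_0)
    have "3/2 * (2::real) ^ n' \<le> 3/2 * 2 ^ n" using that by simp
    then show "3/2 * 2 ^ n' \<le> norm (freq k)" using large by linarith
  qed
  ultimately have "block_symbol \<theta> n k = 0" by (cases n) auto
  then show False using assms by simp
qed

text \<open>At most two blocks see a given frequency. This bounds the partial sums of Bony's series
  uniformly in their length.\<close>

lemma sum_abs_block_symbol_le: "(\<Sum>n<M. \<bar>block_symbol \<theta> n k\<bar>) \<le> 2"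
proof -
  define S where "S = {n. n < M \<and> block_symbol \<theta> n k \<noteq> 0}"
  have fS: "finite S" by (simp add: S_def)
  have "(\<Sum>n<M. \<bar>block_symbol \<theta> n k\<bar>) = (\<Sum>n\<in>S. \<bar>block_symbol \<theta> n k\<bar>)"
    unfolding S_def by (rule sum.mono_neutral_right) auto
  also have "\<dots> \<le> (\<Sum>n\<in>S. 1)" by (intro sum_mono abs_block_symbol_le)
  also have "\<dots> = real (card S)" by simp
  also have "\<dots> \<le> 2"
  proof (cases "S = {}")
    case False
    define j where "j = Min S"
    have j: "j \<in> S" using False fS unfolding j_def by (rule Min_in[rotated])
    have "S \<subseteq> {j, j + 1}"
    proof
      fix n assume n: "n \<in> S"
      then have "j \<le> n" using fS unfolding j_def by simp
      then show "n \<in> {j, j + 1}" using block_symbol_adjacent[of j k n] n j by (cases "j = n") (auto simp: S_def)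
    qed
    then have "card S \<le> card {j, j + 1}" by (intro card_mono) auto
    then show ?thesis by simp
  qed simp
  finally show ?thesis .
qed

text \<open>Taking real parts term by term loses nothing, because the whole sum is real: the
  coefficients are conjugate symmetric and the cutoff is even.\<close>

lemma low_freq_eq_trig:
  assumes f: "\<And>k. fourier_coeff f (- k) = cnj (fourier_coeff f k)" and N: "2 ^ (n + 1) \<le> N"
  shows "complex_of_real (low_freq \<theta> n f x) = trig N (\<lambda>k. complex_of_real (cutoff_symbol \<theta> n k) * fourier_coeff f k) x"
proof -
  let ?c = "\<lambda>k. complex_of_real (cutoff_symbol \<theta> n k) * fourier_coeff f k"
  have "cnj (trig N ?c x) = (\<Sum>k\<in>freq_box N. ?c (- k) * fexp (- k) x)"
    unfolding trig_def cnj_sum by (intro sum.cong refl) (simp add: f fexp_uminus cutoff_symbol_uminus)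
  also have "\<dots> = trig N ?c x"
    unfolding trig_def by (rule sum.reindex_bij_witness[of _ uminus uminus]) auto
  finally have real: "complex_of_real (Re (trig N ?c x)) = trig N ?c x"
    by (simp add: complex_eq_iff)
  have sub: "{k. \<theta> (freq k /\<^sub>R 2 ^ n) \<noteq> 0} \<subseteq> freq_box N"
    using cutoff_symbol_support[of _ n] freq_box_mono[OF N] unfolding cutoff_symbol_def by blast
  have "low_freq \<theta> n f x = (\<Sum>k\<in>freq_box N. cutoff_symbol \<theta> n k * Re (fourier_coeff f k * fexp k x))"
    unfolding low_freq_def cutoff_symbol_def fexp_def by (rule sum.mono_neutral_left[OF finite_freq_box sub]) auto
  also have "\<dots> = Re (trig N ?c x)"
    unfolding trig_def Re_sum by (intro sum.cong refl) (simp add: algebra_simps)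
  finally show ?thesis using real by simp
qed

lemma lp_block_eq_trig:
  assumes f: "\<And>k. fourier_coeff f (- k) = cnj (fourier_coeff f k)" and N: "2 ^ (n + 1) \<le> N"
  shows "complex_of_real (lp_block \<theta> n f x) = trig N (\<lambda>k. complex_of_real (block_symbol \<theta> n k) * fourier_coeff f k) x"
proof (cases n)
  case 0 then show ?thesis using low_freq_eq_trig[OF f N] by simp
next
  case (Suc m)
  have Nm: "2 ^ (m + 1) \<le> N" using N Suc by (simp add: mult_2[symmetric]) 
  show ?thesis
    using low_freq_eq_trig[OF f N, of x] low_freq_eq_trig[OF f Nm, of x] unfolding Suc
    by (simp add: trig_def sum_subtractf algebra_simps)
qed

end

section \<open>Bony's product tested against waves\<close>

text \<open>Under the real part the wave is a multiple of the exponential of frequency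
  \<open>- m\<close>, so orthogonality leaves the convolution of \<open>a\<close> and
  \<open>b\<close> at \<open>m\<close>.\<close>

lemma integral_product_wave:
  fixes F H :: "real^3 \<Rightarrow> real"
  assumes F: "\<And>x. complex_of_real (F x) = trig N a x" and H: "\<And>x. complex_of_real (H x) = trig N b x"
    and b: "\<And>k. k \<notin> freq_box N \<Longrightarrow> b k = 0" and m: "m \<in> freq_box N"
  shows "(LINT x:cell|lborel. F x * H x * wave m z x) = Re (z * (\<Sum>k\<in>freq_box N. a k * b (m - k)))"
proof -
  define c where "c k = (if k = - m then z else 0)" for k
  have c0: "c k = 0" if "k \<notin> freq_box N" for k using that m by (auto simp: c_def)
  have tc: "trig N c x = z * cnj (fexp m x)" for x
  proof -
    have "trig N c x = (\<Sum>k\<in>freq_box N. if k = - m then z * fexp k x else 0)"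
      unfolding trig_def by (intro sum.cong refl) (simp add: c_def)
    then show ?thesis using m by (simp add: sum.delta finite_freq_box fexp_uminus)
  qed
  have eq: "F x * H x * wave m z x = Re (trig N a x * trig N b x * trig N c x)" for x
    unfolding F[symmetric] H[symmetric] tc wave_def by simp
  have cont: "continuous_on UNIV (\<lambda>x. trig N a x * trig N b x * trig N c x)"
    by (intro continuous_intros)
  have "(LINT x:cell|lborel. F x * H x * wave m z x) = integral cell (\<lambda>x. Re (trig N a x * trig N b x * trig N c x))"
    unfolding eq
  proof (rule set_borel_integral_eq_integral(2))
    show "set_integrable lborel cell (\<lambda>x. Re (trig N a x * trig N b x * trig N c x))"
      unfolding set_integrable_def
      by (rule borel_integrable_compact) (intro continuous_intros compact_cbox | rule continuous_on_subset[OF cont], simp)+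
  qed
  also have "\<dots> = Re (integral cell (\<lambda>x. trig N a x * trig N b x * trig N c x))"
    using integral_linear[OF continuous_integrable_cbox[OF cont] bounded_linear_Re] by (simp add: o_def)
  also have "integral cell (\<lambda>x. trig N a x * trig N b x * trig N c x) = (\<Sum>k\<in>freq_box N. \<Sum>l\<in>freq_box N. a k * b l * c (- (k + l)))"
    by (rule integral_trig3[OF c0])
  also have "\<dots> = (\<Sum>k\<in>freq_box N. z * (a k * b (m - k)))"
  proof (intro sum.cong refl)
    fix k
    have "(\<Sum>l\<in>freq_box N. a k * b l * c (- (k + l))) = (\<Sum>l\<in>freq_box N. if l = m - k then z * (a k * b l) else 0)"
      by (intro sum.cong refl) (auto simp: c_def algebra_simps)
    also have "\<dots> = z * (a k * b (m - k))"
      using b[of "m - k"] by (auto simp: sum.delta finite_freq_box)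
    finally show "(\<Sum>l\<in>freq_box N. a k * b l * c (- (k + l))) = z * (a k * b (m - k))" .
  qed
  finally show ?thesis by (simp add: sum_distrib_left)
qed

section \<open>Series over the frequency lattice\<close>

lemma infsum_dominated:
  fixes V :: "nat \<Rightarrow> 'a \<Rightarrow> complex"
  assumes g: "g summable_on UNIV" and V: "\<And>n k. norm (V n k) \<le> g k" and lim: "\<And>k. (\<lambda>n. V n k) \<longlonglongrightarrow> L k"
  shows "(\<lambda>n. infsum (V n) UNIV) \<longlonglongrightarrow> infsum L UNIV"
proof -
  have L: "norm (L k) \<le> g k" for k
    by (rule LIMSEQ_le_const2[OF tendsto_norm[OF lim]]) (use V in blast)
  have g0: "0 \<le> g k" for k using V[of 0 k] norm_ge_zero order_trans by blast
  have ab: "Infinite_Set_Sum.abs_summable_on h UNIV" "infsetsum h UNIV = infsum h UNIV" if "\<And>k. norm (h k) \<le> g k" for h :: "'a \<Rightarrow> complex"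
  proof -
    have "(\<lambda>k. norm (h k)) summable_on UNIV"
      by (rule summable_on_comparison_test[OF g]) (use that in auto)
    then show "Infinite_Set_Sum.abs_summable_on h UNIV" by (simp add: abs_summable_equivalent)
    then show "infsetsum h UNIV = infsum h UNIV" by (rule infsetsum_infsum)
  qed
  have gi: "integrable (count_space UNIV) g"
  proof -
    have "(\<lambda>k. norm (g k)) summable_on UNIV" using g g0 by simp
    then have "Infinite_Set_Sum.abs_summable_on g UNIV" by (rule iffD1[OF abs_summable_equivalent])
    then show ?thesis by (simp add: abs_summable_on_def)
  qed
  have "(\<lambda>n. integral\<^sup>L (count_space UNIV) (V n)) \<longlonglongrightarrow> integral\<^sup>L (count_space UNIV) L"
    by (rule integral_dominated_convergence[where w = g]) (use gi V lim in auto)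
  then show ?thesis using ab(2)[OF V] ab(2)[OF L] by (simp add: infsetsum_def)
qed

lemma freq_box_exhausts: "eventually (\<lambda>N. k \<in> freq_box N) sequentially"
proof -
  define N0 where "N0 = nat (Max (range (\<lambda>i. \<bar>k $ i\<bar>)))"
  have "\<bar>k $ i\<bar> \<le> int N0" for i
  proof -
    have "\<bar>k $ i\<bar> \<le> Max (range (\<lambda>i. \<bar>k $ i\<bar>))" by (intro Max_ge) auto
    then show ?thesis unfolding N0_def by linarith
  qed
  then have "k \<in> freq_box N" if "N0 \<le> N" for N
    using that unfolding freq_box_def by (force intro: order_trans)
  then show ?thesis unfolding eventually_sequentially by blast
qed

lemma infsum_eq_lim_freq_box:
  fixes c :: "int^3 \<Rightarrow> complex"
  assumes g: "g summable_on UNIV" and c: "\<And>k. norm (c k) \<le> g k"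
  shows "(\<lambda>N. \<Sum>k\<in>freq_box N. c k) \<longlonglongrightarrow> infsum c UNIV"
proof -
  define V where "V N k = (if k \<in> freq_box N then c k else 0)" for N k
  have "infsum (V N) UNIV = (\<Sum>k\<in>freq_box N. c k)" for N
  proof -
    have "infsum (V N) UNIV = infsum c (freq_box N)"
      by (rule infsum_cong_neutral) (auto simp: V_def)
    then show ?thesis by (simp add: finite_freq_box)
  qed
  moreover have "(\<lambda>N. infsum (V N) UNIV) \<longlonglongrightarrow> infsum c UNIV"
  proof (rule infsum_dominated[OF g])
    have g0: "0 \<le> g k" for k using c[of k] norm_ge_zero order_trans by blast
    show "norm (V n k) \<le> g k" for n k using c g0 by (simp add: V_def)
    show "(\<lambda>n. V n k) \<longlonglongrightarrow> c k" for k
      by (rule tendsto_eventually, rule eventually_mono[OF freq_box_exhausts[of k]]) (simp add: V_def)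
  qed
  ultimately show ?thesis by simp
qed

lemma infsum_finite_sum:
  fixes f :: "nat \<Rightarrow> 'a \<Rightarrow> complex"
  assumes f: "\<And>n. f n summable_on A"
  shows "(\<lambda>k. \<Sum>n<M. f n k) summable_on A \<and> infsum (\<lambda>k. \<Sum>n<M. f n k) A = (\<Sum>n<M. infsum (f n) A)"
  by (induction M) (simp_all add: summable_on_add infsum_add f)

text \<open>A partial sum over \<open>n\<close> is a series over \<open>k\<close> whose weights are
  the partial sums of \<open>w n k\<close>. These are bounded and convergent, so dominated
  convergence in \<open>k\<close> exchanges the two summations.\<close>

lemma sums_weighted_waves:
  fixes cv :: "int^3 \<Rightarrow> complex" and w :: "nat \<Rightarrow> int^3 \<Rightarrow> real"
  assumes g: "g summable_on UNIV" and cv: "\<And>k. norm (cv k) \<le> g k"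
    and t: "\<And>n. t n = Re (z * (\<Sum>k\<in>freq_box (N n). complex_of_real (w n k) * cv k))"
    and supp: "\<And>n k. k \<notin> freq_box (N n) \<Longrightarrow> w n k = 0"
    and bd: "\<And>M k. \<bar>\<Sum>n<M. w n k\<bar> \<le> C" and lim: "\<And>k. (\<lambda>M. \<Sum>n<M. w n k) \<longlonglongrightarrow> L k"
  shows "t sums Re (z * (\<Sum>\<^sub>\<infinity>k. complex_of_real (L k) * cv k))"
proof -
  have fin: "infsum (\<lambda>k. complex_of_real (w n k) * cv k) UNIV = (\<Sum>k\<in>freq_box (N n). complex_of_real (w n k) * cv k)"
    "(\<lambda>k. complex_of_real (w n k) * cv k) summable_on UNIV" for n
  proof -
    have "infsum (\<lambda>k. complex_of_real (w n k) * cv k) UNIV = infsum (\<lambda>k. complex_of_real (w n k) * cv k) (freq_box (N n))"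
      by (rule infsum_cong_neutral) (use supp in auto)
    then show "infsum (\<lambda>k. complex_of_real (w n k) * cv k) UNIV = (\<Sum>k\<in>freq_box (N n). complex_of_real (w n k) * cv k)"
      by (simp add: finite_freq_box)
    show "(\<lambda>k. complex_of_real (w n k) * cv k) summable_on UNIV"
      by (rule finite_nonzero_values_imp_summable_on, rule finite_subset[OF _ finite_freq_box[of "N n"]])
        (use supp in auto)
  qed
  have part: "(\<Sum>n<M. t n) = Re (z * infsum (\<lambda>k. complex_of_real (\<Sum>n<M. w n k) * cv k) UNIV)" for M
  proof -
    have "infsum (\<lambda>k. complex_of_real (\<Sum>n<M. w n k) * cv k) UNIV = infsum (\<lambda>k. \<Sum>n<M. complex_of_real (w n k) * cv k) UNIV"
      by (simp add: sum_distrib_right)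
    also have "\<dots> = (\<Sum>n<M. infsum (\<lambda>k. complex_of_real (w n k) * cv k) UNIV)"
      by (rule conjunct2[OF infsum_finite_sum]) (rule fin(2))
    finally show ?thesis by (simp add: t fin(1) sum_distrib_left Re_sum)
  qed
  have C: "0 \<le> C" by (rule order_trans[OF abs_ge_zero bd])
  have "(\<lambda>M. infsum (\<lambda>k. complex_of_real (\<Sum>n<M. w n k) * cv k) UNIV) \<longlonglongrightarrow> (\<Sum>\<^sub>\<infinity>k. complex_of_real (L k) * cv k)"
  proof (rule infsum_dominated)
    show "(\<lambda>k. C * g k) summable_on UNIV" by (intro summable_on_cmult_right g)
    show "norm (complex_of_real (\<Sum>n<M. w n k) * cv k) \<le> C * g k" for M k
      unfolding norm_mult norm_of_real by (intro mult_mono bd cv) (use C in auto)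
  qed (intro tendsto_mult tendsto_of_real lim tendsto_const)
  then have "(\<lambda>M. Re (z * infsum (\<lambda>k. complex_of_real (\<Sum>n<M. w n k) * cv k) UNIV)) \<longlonglongrightarrow> Re (z * (\<Sum>\<^sub>\<infinity>k. complex_of_real (L k) * cv k))"
    by (intro tendsto_intros)
  then show ?thesis unfolding sums_def part .
qed

text \<open>The two paraproducts and the remainder tile the index pairs on either side of and around
  the diagonal. Two more remainder terms complete the square of indices up to \<open>N + 1\<close>,
  and only the pair \<open>(N + 2, N + 1)\<close> sticks out.\<close>

lemma bony_symbol_identity:
  fixes S S' b b' :: "nat \<Rightarrow> real"
  assumes S: "\<And>n. S (Suc n) = S n + b (Suc n)" "\<And>n. S' (Suc n) = S' n + b' (Suc n)"
    and S0: "S 0 = b 0" "S' 0 = b' 0"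
  shows "(\<Sum>n<N. S n * b' (n + 2)) + (\<Sum>n<N. b (n + 2) * S' n)
      + (\<Sum>n<N + 2. (\<Sum>m = n - 1..n + 1. b m) * b' n)
    = S (N + 1) * S' (N + 1) + b (N + 2) * b' (N + 1)"
proof (induction N)
  case 0
  have "{0 - 1..0 + 1} = {0, 1::nat}" "{1 - 1..1 + 1} = {0, 1, 2::nat}" by auto
  then have "(\<Sum>n<0 + 2. (\<Sum>m = n - 1..n + 1. b m) * b' n) = (b 0 + b 1) * b' 0 + (b 0 + (b 1 + b 2)) * b' 1"
    by (simp add: numeral_2_eq_2)
  then show ?case using S(1)[of 0] S(2)[of 0] S0 by (simp add: algebra_simps numeral_2_eq_2)
next
  case (Suc N)
  have "{(N + 2) - 1..(N + 2) + 1} = {N + 1, N + 2, N + 3}" by auto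
  then have 1: "(\<Sum>m = (N + 2) - 1..(N + 2) + 1. b m) = b (N + 1) + (b (N + 2) + b (N + 3))" by simp
  have 2: "(\<Sum>n<Suc N + 2. (\<Sum>m = n - 1..n + 1. b m) * b' n)
      = (\<Sum>n<N + 2. (\<Sum>m = n - 1..n + 1. b m) * b' n) + (b (N + 1) + (b (N + 2) + b (N + 3))) * b' (N + 2)"
    using 1 by simp
  have 3: "S (N + 2) = S N + b (N + 1) + b (N + 2)" "S (N + 1) = S N + b (N + 1)"
    "S' (N + 2) = S' N + b' (N + 1) + b' (N + 2)" "S' (N + 1) = S' N + b' (N + 1)"
    using S(1)[of N] S(1)[of "N + 1"] S(2)[of N] S(2)[of "N + 1"] by simp_all
  have "(\<Sum>n<Suc N. S n * b' (n + 2)) + (\<Sum>n<Suc N. b (n + 2) * S' n)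
      + (\<Sum>n<Suc N + 2. (\<Sum>m = n - 1..n + 1. b m) * b' n)
    = ((\<Sum>n<N. S n * b' (n + 2)) + (\<Sum>n<N. b (n + 2) * S' n)
      + (\<Sum>n<N + 2. (\<Sum>m = n - 1..n + 1. b m) * b' n))
      + (S N * b' (N + 2) + b (N + 2) * S' N + (b (N + 1) + (b (N + 2) + b (N + 3))) * b' (N + 2))"
    unfolding 2 by simp
  also have "\<dots> = S (N + 2) * S' (N + 2) + b (N + 3) * b' (N + 2)"
    unfolding Suc.IH 3 by (simp add: algebra_simps)
  finally show ?case by (simp add: numeral_3_eq_3 numeral_2_eq_2)
qed

lemma sum_eventually_zero:
  fixes w :: "nat \<Rightarrow> real"
  assumes "\<And>n. p \<le> n \<Longrightarrow> w n = 0" "p \<le> M"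
  shows "(\<Sum>n<M. w n) = (\<Sum>n<p. w n)"
  by (rule sum.mono_neutral_right) (use assms in auto)

text \<open>At each frequency \<open>k\<close> the three families of weights add up to 1. Tested
  with a single wave, Bony's product is therefore the plain convolution of the coefficients at
  \<open>m\<close>, whatever the cutoff.\<close>

theorem bony_product_wave:
  assumes \<theta>: "dyadic_cutoff \<theta>"
    and f: "\<And>k. fourier_coeff f (- k) = cnj (fourier_coeff f k)"
    and g: "\<And>k. fourier_coeff g (- k) = cnj (fourier_coeff g k)"
    and G: "G summable_on UNIV" "\<And>k. norm (fourier_coeff f k * fourier_coeff g (m - k)) \<le> G k"
  shows "bony_product \<theta> f g (wave m z) = Re (z * (\<Sum>\<^sub>\<infinity>k. fourier_coeff f k * fourier_coeff g (m - k)))"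
proof -
  define cv where "cv k = fourier_coeff f k * fourier_coeff g (m - k)" for k
  define w1 where "w1 n k = cutoff_symbol \<theta> n k * block_symbol \<theta> (n + 2) (m - k)" for n k
  define w2 where "w2 n k = block_symbol \<theta> (n + 2) k * cutoff_symbol \<theta> n (m - k)" for n k
  define w3 where "w3 n k = (\<Sum>j = n - 1..n + 1. block_symbol \<theta> j k) * block_symbol \<theta> n (m - k)" for n k
  obtain mm where mm: "m \<in> freq_box mm"
    using freq_box_exhausts[of m] eventually_happens by (metis sequentially_bot)
  \<comment> \<open>Large enough for the blocks up to \<open>n + 2\<close>, whose band is
    \<open>2 ^ (n + 3)\<close>, and for the frequency \<open>m\<close> of the wave.\<close>
  define N where "N n = 2 ^ (n + 3) + mm" for n :: nat
  have mN: "m \<in> freq_box (N n)" for n using mm freq_box_mono[of mm "N n"] by (auto simp: N_def)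
  have pw: "2 ^ (j + 1) \<le> N n" if "j \<le> n + 2" for j n
  proof -
    have "(2::nat) ^ (j + 1) \<le> 2 ^ (n + 3)" using that by (intro power_increasing) auto
    then show ?thesis by (simp add: N_def)
  qed
  have bwN: "block_symbol \<theta> j k = 0" if "j \<le> n + 2" "k \<notin> freq_box (N n)" for j n k
    using block_symbol_support[OF \<theta>, of k j] freq_box_mono[OF pw[OF that(1)]] that(2) by blast
  have twN: "cutoff_symbol \<theta> j k = 0" if "j \<le> n + 2" "k \<notin> freq_box (N n)" for j n k
    using cutoff_symbol_support[OF \<theta>, of k j] freq_box_mono[OF pw[OF that(1)]] that(2) by blast
  \<comment> \<open>From index \<open>p k\<close> on no block sees \<open>k\<close> or
    \<open>m - k\<close>, so all three series of weights at \<open>k\<close> are finite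
    sums.\<close>
  define p where "p k = nat \<lceil>norm (freq k)\<rceil> + nat \<lceil>norm (freq (m - k))\<rceil> + 1" for k
  have big: "norm (freq k) \<le> 2 ^ n \<and> norm (freq (m - k)) \<le> 2 ^ n" if "p k \<le> Suc n" for k n
  proof -
    have "norm (freq k) \<le> real n" "norm (freq (m - k)) \<le> real n"
      using that real_nat_ceiling_ge[of "norm (freq k)"] real_nat_ceiling_ge[of "norm (freq (m - k))"]
      unfolding p_def by linarith+
    moreover have "real n \<le> 2 ^ n" using less_exp[of n] by (metis less_imp_le of_nat_le_iff of_nat_numeral of_nat_power)
    ultimately show ?thesis by linarith
  qed
  have bwp: "block_symbol \<theta> n k = 0" "block_symbol \<theta> n (m - k) = 0" if "p k \<le> n" for n k
  proof -
    obtain n' where n': "n = Suc n'" using \<open>p k \<le> n\<close> by (cases n) (auto simp: p_def)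
    show "block_symbol \<theta> n k = 0" "block_symbol \<theta> n (m - k) = 0"
      unfolding n' using big[of k n'] that block_symbol_eq_0_large[OF \<theta>] n' by blast+
  qed
  have z1: "w1 n k = 0" and z2: "w2 n k = 0" and z3: "w3 n k = 0" if "p k \<le> n" for n k
    using that bwp[of k "n + 2"] bwp[of k n] by (simp_all add: w1_def w2_def w3_def)
  define L1 where "L1 k = (\<Sum>n<p k. w1 n k)" for k
  define L2 where "L2 k = (\<Sum>n<p k. w2 n k)" for k
  define L3 where "L3 k = (\<Sum>n<p k. w3 n k)" for k
  have lims: "(\<lambda>M. \<Sum>n<M. w1 n k) \<longlonglongrightarrow> L1 k" "(\<lambda>M. \<Sum>n<M. w2 n k) \<longlonglongrightarrow> L2 k" "(\<lambda>M. \<Sum>n<M. w3 n k) \<longlonglongrightarrow> L3 k" for k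
    unfolding L1_def L2_def L3_def
    by (rule tendsto_eventually, rule eventually_sequentiallyI[of "p k"], rule sum_eventually_zero, (rule z1 z2 z3)?, assumption, assumption)+
  have total: "L1 k + L2 k + L3 k = 1" for k
  proof -
    have "(\<Sum>n<p k. cutoff_symbol \<theta> n k * block_symbol \<theta> (n + 2) (m - k)) + (\<Sum>n<p k. block_symbol \<theta> (n + 2) k * cutoff_symbol \<theta> n (m - k))
      + (\<Sum>n<p k + 2. (\<Sum>j = n - 1..n + 1. block_symbol \<theta> j k) * block_symbol \<theta> n (m - k))
      = cutoff_symbol \<theta> (p k + 1) k * cutoff_symbol \<theta> (p k + 1) (m - k) + block_symbol \<theta> (p k + 2) k * block_symbol \<theta> (p k + 1) (m - k)"
      by (rule bony_symbol_identity) simp_all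
    moreover have "(\<Sum>n<p k + 2. w3 n k) = L3 k"
      unfolding L3_def by (rule sum_eventually_zero) (simp_all add: z3)
    moreover have "cutoff_symbol \<theta> (p k + 1) k = 1" "cutoff_symbol \<theta> (p k + 1) (m - k) = 1"
      using big[of k "p k + 1"] by (auto intro!: cutoff_symbol_eq_1[OF \<theta>])
    moreover have "block_symbol \<theta> (p k + 2) k = 0" using bwp[of k "p k + 2"] by simp
    ultimately show ?thesis by (simp add: L1_def L2_def w1_def w2_def w3_def)
  qed
  have sb: "(\<Sum>n<M. \<bar>block_symbol \<theta> (n + 2) k\<bar>) \<le> 2" for M k
  proof -
    have "(\<Sum>n<M. \<bar>block_symbol \<theta> (n + 2) k\<bar>) = (\<Sum>n\<in>(\<lambda>n. n + 2) ` {..<M}. \<bar>block_symbol \<theta> n k\<bar>)"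
      by (subst sum.reindex) (auto simp: inj_on_def)
    also have "\<dots> \<le> (\<Sum>n<M + 2. \<bar>block_symbol \<theta> n k\<bar>)" by (intro sum_mono2) auto
    also have "\<dots> \<le> 2" by (rule sum_abs_block_symbol_le[OF \<theta>])
    finally show ?thesis .
  qed
  \<comment> \<open>The common bound 6 comes from the remainder: three neighbouring blocks of
    modulus at most 1, times the bound 2 for the block sum.\<close>
  have bd1: "\<bar>\<Sum>n<M. w1 n k\<bar> \<le> 6" for M k
  proof -
    have "\<bar>\<Sum>n<M. w1 n k\<bar> \<le> (\<Sum>n<M. \<bar>block_symbol \<theta> (n + 2) (m - k)\<bar>)"
      unfolding w1_def using cutoff_symbol_bounds[OF \<theta>]
      by (intro order_trans[OF sum_abs] sum_mono) (simp add: abs_mult mult_left_le_one_le)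
    then show ?thesis using sb[of "m - k" M] by linarith
  qed
  have bd2: "\<bar>\<Sum>n<M. w2 n k\<bar> \<le> 6" for M k
  proof -
    have "\<bar>\<Sum>n<M. w2 n k\<bar> \<le> (\<Sum>n<M. \<bar>block_symbol \<theta> (n + 2) k\<bar>)"
      unfolding w2_def using cutoff_symbol_bounds[OF \<theta>]
      by (intro order_trans[OF sum_abs] sum_mono) (simp add: abs_mult mult_left_le)
    then show ?thesis using sb[of k M] by linarith
  qed
  have bd3: "\<bar>\<Sum>n<M. w3 n k\<bar> \<le> 6" for M k
  proof -
    have "\<bar>\<Sum>j = n - 1..n + 1. block_symbol \<theta> j k\<bar> \<le> 3" for n
    proof -
      have "\<bar>\<Sum>j = n - 1..n + 1. block_symbol \<theta> j k\<bar> \<le> (\<Sum>j = n - 1..n + 1. 1)"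
        by (intro order_trans[OF sum_abs] sum_mono abs_block_symbol_le[OF \<theta>])
      also have "\<dots> \<le> 3" by simp
      finally show ?thesis .
    qed
    then have "\<bar>\<Sum>n<M. w3 n k\<bar> \<le> (\<Sum>n<M. 3 * \<bar>block_symbol \<theta> n (m - k)\<bar>)"
      unfolding w3_def by (intro order_trans[OF sum_abs] sum_mono) (simp add: abs_mult mult_right_mono)
    then show ?thesis using sum_abs_block_symbol_le[OF \<theta>, of "m - k" M] by (simp flip: sum_distrib_left)
  qed
  have p0: "2 ^ (n + 1) \<le> N n" and p2: "2 ^ ((n + 2) + 1) \<le> N n" for n
    by (rule pw, simp)+
  have zb: "complex_of_real (block_symbol \<theta> j k) * c = 0" if "j \<le> n + 2" "k \<notin> freq_box (N n)" for j n k c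
    by (simp only: bwN[OF that] of_real_0 mult_zero_left)
  have zt: "complex_of_real (cutoff_symbol \<theta> j k) * c = 0" if "j \<le> n + 2" "k \<notin> freq_box (N n)" for j n k c
    by (simp only: twN[OF that] of_real_0 mult_zero_left)
  note lf = low_freq_eq_trig[OF \<theta> f] low_freq_eq_trig[OF \<theta> g]
  note lb = lp_block_eq_trig[OF \<theta> f] lp_block_eq_trig[OF \<theta> g]
  have s1: "(\<lambda>n. LINT x:cell|lborel. low_freq \<theta> n f x * lp_block \<theta> (n + 2) g x * wave m z x)
      sums Re (z * (\<Sum>\<^sub>\<infinity>k. complex_of_real (L1 k) * cv k))"
  proof (rule sums_weighted_waves[OF G(1) G(2)[folded cv_def] _ _ bd1 lims(1), where N = N])
    show "(LINT x:cell|lborel. low_freq \<theta> n f x * lp_block \<theta> (n + 2) g x * wave m z x)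
        = Re (z * (\<Sum>k\<in>freq_box (N n). complex_of_real (w1 n k) * cv k))" for n
    proof -
      have "(LINT x:cell|lborel. low_freq \<theta> n f x * lp_block \<theta> (n + 2) g x * wave m z x)
          = Re (z * (\<Sum>k\<in>freq_box (N n). (complex_of_real (cutoff_symbol \<theta> n k) * fourier_coeff f k) * (complex_of_real (block_symbol \<theta> (n + 2) (m - k)) * fourier_coeff g (m - k))))"
        by (rule integral_product_wave[OF lf(1)[OF p0] lb(2)[OF p2] zb mN]) simp_all
      also have "(\<Sum>k\<in>freq_box (N n). (complex_of_real (cutoff_symbol \<theta> n k) * fourier_coeff f k) * (complex_of_real (block_symbol \<theta> (n + 2) (m - k)) * fourier_coeff g (m - k))) = (\<Sum>k\<in>freq_box (N n). complex_of_real (w1 n k) * cv k)"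
        by (intro sum.cong refl) (simp add: w1_def cv_def mult_ac)
      finally show ?thesis .
    qed
    show "w1 n k = 0" if "k \<notin> freq_box (N n)" for n k
      using twN[of n n k] that by (simp only: w1_def) simp
  qed
  have s2: "(\<lambda>n. LINT x:cell|lborel. low_freq \<theta> n g x * lp_block \<theta> (n + 2) f x * wave m z x)
      sums Re (z * (\<Sum>\<^sub>\<infinity>k. complex_of_real (L2 k) * cv k))"
  proof (rule sums_weighted_waves[OF G(1) G(2)[folded cv_def] _ _ bd2 lims(2), where N = N])
    show "(LINT x:cell|lborel. low_freq \<theta> n g x * lp_block \<theta> (n + 2) f x * wave m z x)
        = Re (z * (\<Sum>k\<in>freq_box (N n). complex_of_real (w2 n k) * cv k))" for n
    proof -
      have "(LINT x:cell|lborel. lp_block \<theta> (n + 2) f x * low_freq \<theta> n g x * wave m z x)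
          = Re (z * (\<Sum>k\<in>freq_box (N n). (complex_of_real (block_symbol \<theta> (n + 2) k) * fourier_coeff f k) * (complex_of_real (cutoff_symbol \<theta> n (m - k)) * fourier_coeff g (m - k))))"
        by (rule integral_product_wave[OF lb(1)[OF p2] lf(2)[OF p0] zt mN]) simp_all
      also have "(\<Sum>k\<in>freq_box (N n). (complex_of_real (block_symbol \<theta> (n + 2) k) * fourier_coeff f k) * (complex_of_real (cutoff_symbol \<theta> n (m - k)) * fourier_coeff g (m - k))) = (\<Sum>k\<in>freq_box (N n). complex_of_real (w2 n k) * cv k)"
        by (intro sum.cong refl) (simp add: w2_def cv_def mult_ac)
      finally show ?thesis by (simp only: mult.commute[of "low_freq \<theta> n g _"])
    qed
    show "w2 n k = 0" if "k \<notin> freq_box (N n)" for n k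
      using bwN[of "n + 2" n k] that unfolding w2_def by (simp del: block_symbol.simps)
  qed
  have s3: "(\<lambda>n. LINT x:cell|lborel. (\<Sum>j = n - 1..n + 1. lp_block \<theta> j f x) * lp_block \<theta> n g x * wave m z x)
      sums Re (z * (\<Sum>\<^sub>\<infinity>k. complex_of_real (L3 k) * cv k))"
  proof (rule sums_weighted_waves[OF G(1) G(2)[folded cv_def] _ _ bd3 lims(3), where N = N])
    show "(LINT x:cell|lborel. (\<Sum>j = n - 1..n + 1. lp_block \<theta> j f x) * lp_block \<theta> n g x * wave m z x)
        = Re (z * (\<Sum>k\<in>freq_box (N n). complex_of_real (w3 n k) * cv k))" for n
    proof -
      have F: "complex_of_real (\<Sum>j = n - 1..n + 1. lp_block \<theta> j f x)
          = trig (N n) (\<lambda>k. \<Sum>j = n - 1..n + 1. complex_of_real (block_symbol \<theta> j k) * fourier_coeff f k) x" for x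
        unfolding trig_sum of_real_sum by (intro sum.cong refl lb(1) pw) auto
      show ?thesis
    proof -
      have "(LINT x:cell|lborel. (\<Sum>j = n - 1..n + 1. lp_block \<theta> j f x) * lp_block \<theta> n g x * wave m z x)
          = Re (z * (\<Sum>k\<in>freq_box (N n). (\<Sum>j = n - 1..n + 1. complex_of_real (block_symbol \<theta> j k) * fourier_coeff f k) * (complex_of_real (block_symbol \<theta> n (m - k)) * fourier_coeff g (m - k))))"
        by (rule integral_product_wave[OF F lb(2)[OF p0] zb mN]) simp_all
      also have "(\<Sum>k\<in>freq_box (N n). (\<Sum>j = n - 1..n + 1. complex_of_real (block_symbol \<theta> j k) * fourier_coeff f k) * (complex_of_real (block_symbol \<theta> n (m - k)) * fourier_coeff g (m - k))) = (\<Sum>k\<in>freq_box (N n). complex_of_real (w3 n k) * cv k)"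
        by (intro sum.cong refl) (simp only: w3_def cv_def of_real_mult of_real_sum sum_distrib_right[symmetric] mult.assoc mult.left_commute[of "fourier_coeff f _"])
      finally show ?thesis .
    qed
    qed
    show "w3 n k = 0" if "k \<notin> freq_box (N n)" for n k
    proof -
      have "(\<Sum>j = n - 1..n + 1. block_symbol \<theta> j k) = 0" using that by (intro sum.neutral ballI bwN[of _ n]) auto
      then show ?thesis by (simp add: w3_def)
    qed
  qed
  have sm: "(\<lambda>k. complex_of_real (L k) * cv k) summable_on UNIV" if "\<And>k. \<bar>L k\<bar> \<le> 6" for L
  proof -
    have "(\<lambda>k. norm (complex_of_real (L k) * cv k)) summable_on UNIV"
    proof (rule summable_on_comparison_test)
      show "(\<lambda>k. 6 * G k) summable_on UNIV" by (intro summable_on_cmult_right G)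
      show "norm (complex_of_real (L k) * cv k) \<le> 6 * G k" for k
        unfolding norm_mult norm_of_real using that G(2)[of k] by (intro mult_mono) (auto simp: cv_def norm_mult)
    qed auto
    then show ?thesis by (rule abs_summable_summable)
  qed
  have sm1: "(\<lambda>k. complex_of_real (L1 k) * cv k) summable_on UNIV" unfolding L1_def by (rule sm) (rule bd1)
  have sm2: "(\<lambda>k. complex_of_real (L2 k) * cv k) summable_on UNIV" unfolding L2_def by (rule sm) (rule bd2)
  have sm3: "(\<lambda>k. complex_of_real (L3 k) * cv k) summable_on UNIV" unfolding L3_def by (rule sm) (rule bd3)
  have "(\<Sum>\<^sub>\<infinity>k. complex_of_real (L1 k) * cv k) + (\<Sum>\<^sub>\<infinity>k. complex_of_real (L2 k) * cv k) + (\<Sum>\<^sub>\<infinity>k. complex_of_real (L3 k) * cv k)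
      = (\<Sum>\<^sub>\<infinity>k. complex_of_real (L1 k) * cv k + complex_of_real (L2 k) * cv k + complex_of_real (L3 k) * cv k)"
    by (simp add: infsum_add summable_on_add sm1 sm2 sm3)
  also have "\<dots> = (\<Sum>\<^sub>\<infinity>k. cv k)"
  proof (rule infsum_cong)
    fix k
    have "complex_of_real (L1 k) * cv k + complex_of_real (L2 k) * cv k + complex_of_real (L3 k) * cv k = complex_of_real (L1 k + L2 k + L3 k) * cv k"
      by (simp add: algebra_simps)
    then show "complex_of_real (L1 k) * cv k + complex_of_real (L2 k) * cv k + complex_of_real (L3 k) * cv k = cv k"
      unfolding total by simp
  qed
  finally have tot: "(\<Sum>\<^sub>\<infinity>k. complex_of_real (L1 k) * cv k) + (\<Sum>\<^sub>\<infinity>k. complex_of_real (L2 k) * cv k) + (\<Sum>\<^sub>\<infinity>k. complex_of_real (L3 k) * cv k) = (\<Sum>\<^sub>\<infinity>k. cv k)" .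
  have "bony_product \<theta> f g (wave m z) = Re (z * ((\<Sum>\<^sub>\<infinity>k. complex_of_real (L1 k) * cv k) + (\<Sum>\<^sub>\<infinity>k. complex_of_real (L2 k) * cv k) + (\<Sum>\<^sub>\<infinity>k. complex_of_real (L3 k) * cv k)))"
    unfolding bony_product_def paraproduct_def bony_remainder_def
      sums_unique[OF s1, symmetric] sums_unique[OF s2, symmetric] sums_unique[OF s3, symmetric]
    by (simp add: algebra_simps)
  then show ?thesis unfolding tot unfolding cv_def .
qed

section \<open>Divergence-free fields of finite energy\<close>

text \<open>Comparable to the density of the squared \<open>H^(1/2)\<close> norm. The sum of the
  moduli of the components, squared, is a convenient majorant for products of components.\<close>

definition energy_density :: "(int^3 \<Rightarrow> complex^3) \<Rightarrow> int^3 \<Rightarrow> real" where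
  "energy_density v k = sqrt (1 + (norm (freq k))\<^sup>2) * (\<Sum>i\<in>UNIV. norm (v k $ i))\<^sup>2"

definition lamb_vector :: "(int^3 \<Rightarrow> complex^3) \<Rightarrow> int^3 \<Rightarrow> complex^3" where
  "lamb_vector v m = (\<chi> j. \<Sum>\<^sub>\<infinity>k. crossc (v k) (curlc v (m - k)) $ j)"

definition vorticity_rhs :: "(int^3 \<Rightarrow> complex^3) \<Rightarrow> int^3 \<Rightarrow> complex^3" where
  "vorticity_rhs v m = (2 * pi * \<i>) *s crossc (cfreq m) (lamb_vector v m)"

text \<open>The constant of Peetre's inequality for the weight \<open>(1 + |k|^2)^(1/4)\<close>,
  multiplied by \<open>pi\<close>, which is half of the \<open>2 pi\<close> in the curl.\<close>

definition peetre :: "int^3 \<Rightarrow> real" where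
  "peetre m = pi * sqrt (sqrt (2 * (1 + (norm (freq m))\<^sup>2)))"

lemma energy_density_nonneg: "0 \<le> energy_density v k" by (simp add: energy_density_def)

lemma peetre_nonneg: "0 \<le> peetre m" by (simp add: peetre_def)

lemma norm_curlc_le: "norm (curlc v l $ j) \<le> 2 * pi * norm (freq l) * (\<Sum>i\<in>UNIV. norm (v l $ i))"
proof -
  have c: "norm (cfreq l $ \<alpha>) \<le> norm (freq l)" for \<alpha>
    using abs_component_le_norm_freq[of l \<alpha>] by (simp add: cfreq_def)
  have *: "norm (cfreq l $ \<alpha> * v l $ \<beta> - cfreq l $ \<beta> * v l $ \<alpha>) \<le> norm (freq l) * norm (v l $ \<beta>) + norm (freq l) * norm (v l $ \<alpha>)" for \<alpha> \<beta>
    by (rule order_trans[OF norm_triangle_ineq4]) (simp add: norm_mult add_mono mult_right_mono c)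
  have "norm (crossc (cfreq l) (v l) $ j) \<le> norm (freq l) * (\<Sum>i\<in>UNIV. norm (v l $ i))"
    using exhaust_3[of j] *[of 2 3] *[of 3 1] *[of 1 2] mult_nonneg_nonneg[OF norm_ge_zero[of "freq l"] norm_ge_zero]
    by (elim disjE) (simp_all add: sum_3 algebra_simps, (smt (verit, ccfv_SIG) mult_nonneg_nonneg norm_ge_zero)+)
  then have "2 * pi * norm (crossc (cfreq l) (v l) $ j) \<le> 2 * pi * (norm (freq l) * (\<Sum>i\<in>UNIV. norm (v l $ i)))"
    by (intro mult_left_mono) auto
  then show ?thesis by (simp add: curlc_def norm_mult mult.assoc)
qed

text \<open>The curl costs \<open>|m - k|\<close>, at most the square of the weight \<open>J\<close>
  at \<open>m - k\<close>. One factor stays there, the other moves to \<open>k\<close> by Peetre's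
  inequality at a price depending only on \<open>m\<close>. Both coefficients then carry their
  \<open>H^(1/2)\<close> weight, and \<open>2 x y \<le> x^2 + y^2\<close> separates them. This is
  what gives \<open>u x \<omega>\<close> a meaning at each frequency.\<close>

lemma norm_product_curlc_le:
  "norm (v k $ i * curlc v (m - k) $ j) \<le> peetre m * (energy_density v k + energy_density v (m - k))"
proof -
  let ?l = "m - k"
  define P where "P k = (\<Sum>i\<in>UNIV. norm (v k $ i))" for k
  define J where "J k = sqrt (sqrt (1 + (norm (freq k))\<^sup>2))" for k
  have P0: "0 \<le> P k" for k unfolding P_def by (intro sum_nonneg) auto
  have J0: "0 \<le> J k" for k by (simp add: J_def)
  have energy_density: "energy_density v k = (J k * P k)\<^sup>2" for k by (simp add: energy_density_def J_def P_def power_mult_distrib)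
  have vi: "norm (v k $ i) \<le> P k" unfolding P_def by (rule member_le_sum) auto
  have fr: "freq ?l = freq m - freq k" by (simp add: freq_def vec_eq_iff)
  have "(norm (freq ?l))\<^sup>2 \<le> 2 * (norm (freq m))\<^sup>2 + 2 * (norm (freq k))\<^sup>2"
  proof -
    have "(norm (freq ?l))\<^sup>2 \<le> (norm (freq m) + norm (freq k))\<^sup>2"
      unfolding fr by (intro power_mono norm_triangle_ineq4) auto
    also have "\<dots> \<le> 2 * (norm (freq m))\<^sup>2 + 2 * (norm (freq k))\<^sup>2"
      using sum_squares_bound[of "norm (freq m)" "norm (freq k)"] by (simp add: power2_sum)
    finally show ?thesis .
  qed
  also have "1 + (2 * (norm (freq m))\<^sup>2 + 2 * (norm (freq k))\<^sup>2) \<le> 2 * (1 + (norm (freq m))\<^sup>2) * (1 + (norm (freq k))\<^sup>2)"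
    by (simp add: algebra_simps)
  finally have "1 + (norm (freq ?l))\<^sup>2 \<le> 2 * (1 + (norm (freq m))\<^sup>2) * (1 + (norm (freq k))\<^sup>2)" by simp
  then have "J ?l \<le> sqrt (sqrt (2 * (1 + (norm (freq m))\<^sup>2) * (1 + (norm (freq k))\<^sup>2)))"
    unfolding J_def by (simp only: real_sqrt_le_iff)
  then have Jl: "pi * J ?l \<le> peetre m * J k"
    by (simp add: J_def peetre_def real_sqrt_mult mult_ac)
  have "norm (freq ?l) \<le> J ?l * J ?l"
    unfolding J_def by (simp add: real_le_rsqrt)
  then have "norm (curlc v ?l $ j) \<le> 2 * pi * (J ?l * J ?l) * P ?l"
    using norm_curlc_le[of v ?l j] P0[of ?l] unfolding P_def[symmetric]
    by (meson mult_left_mono mult_right_mono order_trans pi_ge_zero zero_le_mult_iff zero_le_numeral)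
  then have "norm (v k $ i * curlc v ?l $ j) \<le> P k * (2 * pi * (J ?l * J ?l) * P ?l)"
    unfolding norm_mult using vi P0 by (intro mult_mono) auto
  also have "\<dots> = (2 * P k * J ?l * P ?l) * (pi * J ?l)" by simp
  also have "\<dots> \<le> (2 * P k * J ?l * P ?l) * (peetre m * J k)"
    by (intro mult_left_mono Jl) (simp add: P0 J0)
  also have "\<dots> = peetre m * (2 * (J k * P k) * (J ?l * P ?l))" by simp
  also have "\<dots> \<le> peetre m * ((J k * P k)\<^sup>2 + (J ?l * P ?l)\<^sup>2)"
    by (intro mult_left_mono sum_squares_bound peetre_nonneg)
  finally show ?thesis by (simp add: energy_density)
qed

lemma norm_crossc_curlc_le:
  "norm (crossc (v k) (curlc v (m - k)) $ j) \<le> 2 * peetre m * (energy_density v k + energy_density v (m - k))"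
proof -
  have "norm (v k $ \<alpha> * curlc v (m - k) $ \<beta> - v k $ \<beta> * curlc v (m - k) $ \<alpha>) \<le> 2 * peetre m * (energy_density v k + energy_density v (m - k))" for \<alpha> \<beta>
    using norm_triangle_ineq4[of "v k $ \<alpha> * curlc v (m - k) $ \<beta>" "v k $ \<beta> * curlc v (m - k) $ \<alpha>"]
      norm_product_curlc_le[of v k \<alpha> m \<beta>] norm_product_curlc_le[of v k \<beta> m \<alpha>] by linarith
  then show ?thesis using exhaust_3[of j] by auto
qed

lemma bij_reflect: "bij (\<lambda>k::int^3. m - k)"
  by (rule bij_betw_byWitness[where f' = "\<lambda>k. m - k"]) auto

lemma summable_reflect:
  fixes h :: "int^3 \<Rightarrow> 'a::{topological_comm_monoid_add}"
  shows "h summable_on UNIV \<Longrightarrow> (\<lambda>k. h (m - k)) summable_on UNIV"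
  using summable_on_reindex_bij_betw[OF bij_reflect, of h m] by simp

lemma infsum_reflect:
  fixes h :: "int^3 \<Rightarrow> 'a::{topological_comm_monoid_add, t2_space}"
  shows "(\<Sum>\<^sub>\<infinity>k. h (m - k)) = (\<Sum>\<^sub>\<infinity>k. h k)"
  by (rule infsum_reindex_bij_betw[OF bij_reflect])

lemma energy_density_pair_summable:
  assumes "energy_density v summable_on UNIV"
  shows "(\<lambda>k. c * (energy_density v k + energy_density v (m - k))) summable_on UNIV"
  by (intro summable_on_cmult_right summable_on_add assms summable_reflect)

lemma infsum_energy_density_pair:
  assumes "energy_density v summable_on UNIV"
  shows "(\<Sum>\<^sub>\<infinity>k. c * (energy_density v k + energy_density v (m - k))) = 2 * c * (\<Sum>\<^sub>\<infinity>k. energy_density v k)"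
  using assms summable_reflect[OF assms, of m] by (simp add: infsum_cmult_right' infsum_add infsum_reflect)

lemma summable_complex_bound:
  fixes h :: "'a \<Rightarrow> complex"
  assumes "g summable_on UNIV" "\<And>k. norm (h k) \<le> g k"
  shows "h summable_on UNIV" "norm (infsum h UNIV) \<le> infsum g UNIV"
proof -
  have s: "(\<lambda>k. norm (h k)) summable_on UNIV"
    by (rule summable_on_comparison_test[OF assms(1)]) (use assms in auto)
  then show "h summable_on UNIV" by (rule abs_summable_summable)
  have "norm (infsum h UNIV) \<le> infsum (\<lambda>k. norm (h k)) UNIV" by (rule norm_infsum_bound[OF s])
  also have "\<dots> \<le> infsum g UNIV" by (rule infsum_mono[OF s assms(1)]) (use assms in auto)
  finally show "norm (infsum h UNIV) \<le> infsum g UNIV" .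
qed

lemma norm_lamb_vector_le:
  assumes "energy_density v summable_on UNIV"
  shows "norm (lamb_vector v m $ j) \<le> 4 * peetre m * (\<Sum>\<^sub>\<infinity>k. energy_density v k)"
proof -
  have "norm (\<Sum>\<^sub>\<infinity>k. crossc (v k) (curlc v (m - k)) $ j) \<le> (\<Sum>\<^sub>\<infinity>k. 2 * peetre m * (energy_density v k + energy_density v (m - k)))"
    by (rule summable_complex_bound(2)[OF energy_density_pair_summable[OF assms] norm_crossc_curlc_le])
  then show ?thesis unfolding infsum_energy_density_pair[OF assms] by (simp add: lamb_vector_def)
qed

text \<open>This is \<open>curl (u x \<omega>)\<close> as minus the divergence, in the first index,
  of the antisymmetric tensor in the weak formulation. Reflecting \<open>k\<close> to
  \<open>m - k\<close> shows the two product arrays to be transposes of each other, so a single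
  array \<open>C\<close> expresses both sides.\<close>

lemma vorticity_rhs_component:
  assumes s: "energy_density v summable_on UNIV"
  shows "vorticity_rhs v m $ j = (\<Sum>i\<in>UNIV. - (2 * pi * \<i> * of_int (m $ i)) *
    ((\<Sum>\<^sub>\<infinity>k. v k $ i * curlc v (m - k) $ j) - (\<Sum>\<^sub>\<infinity>k. curlc v k $ i * v (m - k) $ j)))"
proof -
  define C where "C i j = (\<Sum>\<^sub>\<infinity>k. v k $ i * curlc v (m - k) $ j)" for i j
  have sm: "(\<lambda>k. v k $ i * curlc v (m - k) $ j) summable_on UNIV" for i j
    by (rule summable_complex_bound(1)[OF energy_density_pair_summable[OF s] norm_product_curlc_le])
  have C': "(\<Sum>\<^sub>\<infinity>k. curlc v k $ i * v (m - k) $ j) = C j i" for i j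
    using infsum_reflect[of "\<lambda>k. v k $ j * curlc v (m - k) $ i" m] by (simp add: C_def mult.commute)
  have d: "(\<Sum>\<^sub>\<infinity>k. v k $ i * curlc v (m - k) $ j - v k $ i' * curlc v (m - k) $ j') = C i j - C i' j'" for i j i' j'
  proof -
    have "(\<Sum>\<^sub>\<infinity>k. v k $ i * curlc v (m - k) $ j + (- 1) * (v k $ i' * curlc v (m - k) $ j')) = C i j + (- 1) * C i' j'"
      unfolding C_def infsum_cmult_right'[symmetric] by (intro infsum_add sm summable_on_cmult_right)
    then show ?thesis by simp
  qed
  have a: "lamb_vector v m $ 1 = C 2 3 - C 3 2" "lamb_vector v m $ 2 = C 3 1 - C 1 3" "lamb_vector v m $ 3 = C 1 2 - C 2 1"
    by (simp_all add: lamb_vector_def d)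
  show ?thesis
    unfolding C' C_def[symmetric] using exhaust_3[of j]
    by (elim disjE) (simp_all add: vorticity_rhs_def sum_3 a cfreq_def algebra_simps)
qed

section \<open>The flux of a field with infinitely many modes\<close>

definition helicity_flux :: "nat \<Rightarrow> (int^3 \<Rightarrow> complex^3) \<Rightarrow> complex" where
  "helicity_flux n v = (\<Sum>m\<in>freq_box (2 * n). (complex_of_real (lam n m))\<^sup>2 * dotc (lamb_vector v m) (curlc v (- m)))"

lemma flux_regroup:
  assumes a: "\<And>k. k \<notin> freq_box N \<Longrightarrow> a k = 0" and \<kappa>: "\<And>m. m \<notin> freq_box B \<Longrightarrow> \<kappa> m = 0"
  shows "flux N \<kappa> a = (\<Sum>m\<in>freq_box B. \<kappa> m *
    (\<Sum>k\<in>freq_box N. dotc (crossc (a k) (curlc a (m - k))) (curlc a (- m))))"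
proof -
  define g where "g k l = dotc (crossc (a k) (curlc a l)) (curlc a (- (k + l)))" for k l
  have g0: "g k l = 0" if "l \<notin> freq_box N" for k l
    using that by (simp add: g_def a curlc_eq_0 dotc_def sum_3)
  have "(\<Sum>l\<in>freq_box N. \<kappa> (k + l) * g k l) = (\<Sum>m\<in>freq_box B. \<kappa> m * g k (m - k))" for k
  proof -
    have "(\<Sum>l\<in>freq_box N. \<kappa> (k + l) * g k l) = (\<Sum>l\<in>{l \<in> freq_box N. k + l \<in> freq_box B}. \<kappa> (k + l) * g k l)"
      by (rule sum.mono_neutral_right) (auto simp: finite_freq_box \<kappa>)
    also have "\<dots> = (\<Sum>m\<in>{m \<in> freq_box B. m - k \<in> freq_box N}. \<kappa> m * g k (m - k))"
      by (rule sum.reindex_bij_witness[of _ "\<lambda>m. m - k" "\<lambda>l. k + l"]) auto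
    also have "\<dots> = (\<Sum>m\<in>freq_box B. \<kappa> m * g k (m - k))"
      by (rule sum.mono_neutral_left) (auto simp: finite_freq_box g0)
    finally show ?thesis .
  qed
  then have "flux N \<kappa> a = (\<Sum>k\<in>freq_box N. \<Sum>m\<in>freq_box B. \<kappa> m * g k (m - k))"
    unfolding flux_def g_def by simp
  also have "\<dots> = (\<Sum>m\<in>freq_box B. \<Sum>k\<in>freq_box N. \<kappa> m * g k (m - k))" by (rule sum.swap)
  finally show ?thesis by (simp add: g_def sum_distrib_left)
qed

text \<open>Carries the flux estimate from finitely many blocks to the full field. The outer sum is
  finite because \<open>lam\<close> has bounded support, and each inner convolution converges under
  the dominating energy densities.\<close>

theorem flux_tendsto_helicity_flux:
  assumes \<theta>: "dyadic_cutoff \<theta>" and s: "energy_density v summable_on UNIV"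
  shows "(\<lambda>M. flux (2 ^ (M + 1)) (\<lambda>k. (complex_of_real (lam n k))\<^sup>2) (\<lambda>k. complex_of_real (cutoff_symbol \<theta> M k) *s v k))
    \<longlonglongrightarrow> helicity_flux n v"
proof -
  define a where "a M k = complex_of_real (cutoff_symbol \<theta> M k) *s v k" for M k
  have ca: "curlc (a M) k = complex_of_real (cutoff_symbol \<theta> M k) *s curlc v k" for M k
    unfolding a_def by (rule curlc_smult)
  have tw1: "(\<lambda>M. complex_of_real (cutoff_symbol \<theta> M k)) \<longlonglongrightarrow> 1" for k
  proof (rule tendsto_eventually, rule eventually_sequentiallyI)
    fix M assume "nat \<lceil>norm (freq k)\<rceil> \<le> M"
    then have "norm (freq k) \<le> real M" using real_nat_ceiling_ge[of "norm (freq k)"] by linarith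
    also have "real M \<le> 2 ^ M" using less_exp[of M] by (metis less_imp_le of_nat_le_iff of_nat_numeral of_nat_power)
    finally show "complex_of_real (cutoff_symbol \<theta> M k) = 1" by (simp add: cutoff_symbol_eq_1[OF \<theta>])
  qed
  have reg: "flux (2 ^ (M + 1)) (\<lambda>k. (complex_of_real (lam n k))\<^sup>2) (a M) = (\<Sum>m\<in>freq_box (2 * n). (complex_of_real (lam n m))\<^sup>2 *
    (\<Sum>k\<in>freq_box (2 ^ (M + 1)). dotc (crossc (a M k) (curlc (a M) (m - k))) (curlc (a M) (- m))))" for M
    by (rule flux_regroup) (simp_all add: a_def cutoff_symbol_support[OF \<theta>] lam_eq_0)
  have inner: "(\<Sum>k\<in>freq_box (2 ^ (M + 1)). dotc (crossc (a M k) (curlc (a M) (m - k))) (curlc (a M) (- m)))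
      = (\<Sum>j\<in>UNIV. (\<Sum>\<^sub>\<infinity>k. complex_of_real (cutoff_symbol \<theta> M k * cutoff_symbol \<theta> M (m - k)) * crossc (v k) (curlc v (m - k)) $ j) * (complex_of_real (cutoff_symbol \<theta> M (- m)) * curlc v (- m) $ j))" for M m
  proof -
    have cr: "crossc (a M k) (curlc (a M) (m - k)) $ j = complex_of_real (cutoff_symbol \<theta> M k * cutoff_symbol \<theta> M (m - k)) * crossc (v k) (curlc v (m - k)) $ j" for k j
      using exhaust_3[of j] by (elim disjE) (simp_all add: ca a_def algebra_simps)
    have "infsum (\<lambda>k. complex_of_real (cutoff_symbol \<theta> M k * cutoff_symbol \<theta> M (m - k)) * crossc (v k) (curlc v (m - k)) $ j) UNIV
        = infsum (\<lambda>k. complex_of_real (cutoff_symbol \<theta> M k * cutoff_symbol \<theta> M (m - k)) * crossc (v k) (curlc v (m - k)) $ j) (freq_box (2 ^ (M + 1)))" for j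
      by (rule infsum_cong_neutral) (auto simp: cutoff_symbol_support[OF \<theta>])
    then have i: "infsum (\<lambda>k. complex_of_real (cutoff_symbol \<theta> M k * cutoff_symbol \<theta> M (m - k)) * crossc (v k) (curlc v (m - k)) $ j) UNIV
        = (\<Sum>k\<in>freq_box (2 ^ (M + 1)). crossc (a M k) (curlc (a M) (m - k)) $ j)" for j
      by (simp add: cr finite_freq_box)
    show ?thesis
      unfolding i dotc_def sum_distrib_right by (subst sum.swap) (simp add: ca)
  qed
  have lim: "(\<lambda>M. \<Sum>\<^sub>\<infinity>k. complex_of_real (cutoff_symbol \<theta> M k * cutoff_symbol \<theta> M (m - k)) * crossc (v k) (curlc v (m - k)) $ j) \<longlonglongrightarrow> lamb_vector v m $ j" for m j
    unfolding lamb_vector_def vec_lambda_beta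
  proof (rule infsum_dominated[OF energy_density_pair_summable[OF s]])
    show "norm (complex_of_real (cutoff_symbol \<theta> M k * cutoff_symbol \<theta> M (m - k)) * crossc (v k) (curlc v (m - k)) $ j) \<le> 2 * peetre m * (energy_density v k + energy_density v (m - k))" for M k
    proof -
      have "\<bar>cutoff_symbol \<theta> M k * cutoff_symbol \<theta> M (m - k)\<bar> \<le> 1" using cutoff_symbol_bounds[OF \<theta>] by (simp add: abs_mult mult_le_one)
      then have "norm (complex_of_real (cutoff_symbol \<theta> M k * cutoff_symbol \<theta> M (m - k)) * crossc (v k) (curlc v (m - k)) $ j) \<le> 1 * norm (crossc (v k) (curlc v (m - k)) $ j)"
        unfolding norm_mult norm_of_real by (intro mult_right_mono) auto
      then show ?thesis using norm_crossc_curlc_le[of v k m j] by linarith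
    qed
    show "(\<lambda>M. complex_of_real (cutoff_symbol \<theta> M k * cutoff_symbol \<theta> M (m - k)) * crossc (v k) (curlc v (m - k)) $ j) \<longlonglongrightarrow> crossc (v k) (curlc v (m - k)) $ j" for k
      using tendsto_mult[OF tendsto_mult[OF tw1[of k] tw1[of "m - k"]] tendsto_const[of "crossc (v k) (curlc v (m - k)) $ j"]] by simp
  qed
  have l2: "(\<lambda>M. \<Sum>j\<in>UNIV. (\<Sum>\<^sub>\<infinity>k. complex_of_real (cutoff_symbol \<theta> M k * cutoff_symbol \<theta> M (m - k)) * crossc (v k) (curlc v (m - k)) $ j) * (complex_of_real (cutoff_symbol \<theta> M (- m)) * curlc v (- m) $ j))
      \<longlonglongrightarrow> (\<Sum>j\<in>UNIV. lamb_vector v m $ j * (1 * curlc v (- m) $ j))" for m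
    by (intro tendsto_sum tendsto_mult lim tw1 tendsto_const)
  have "(\<lambda>M. \<Sum>m\<in>freq_box (2 * n). (complex_of_real (lam n m))\<^sup>2 * (\<Sum>k\<in>freq_box (2 ^ (M + 1)). dotc (crossc (a M k) (curlc (a M) (m - k))) (curlc (a M) (- m))))
      \<longlonglongrightarrow> (\<Sum>m\<in>freq_box (2 * n). (complex_of_real (lam n m))\<^sup>2 * (\<Sum>j\<in>UNIV. lamb_vector v m $ j * (1 * curlc v (- m) $ j)))"
    unfolding inner by (rule tendsto_sum, rule tendsto_mult[OF tendsto_const l2])
  then show ?thesis unfolding reg[symmetric] unfolding a_def[abs_def] unfolding helicity_flux_def dotc_def by simp
qed

section \<open>Conservation for weak solutions in Fourier variables\<close>

definition fourier_helicity :: "(int^3 \<Rightarrow> complex^3) \<Rightarrow> real" where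
  "fourier_helicity v = (\<Sum>i\<in>UNIV. Re (\<Sum>\<^sub>\<infinity>k. curlc v k $ i * cnj (v k $ i)))"

text \<open>For a real field \<open>v (- m)\<close> is the conjugate of \<open>v m\<close>, so this
  is the helicity of the mollified field. Without conjugation the form is bilinear, which suits the
  product rule in time.\<close>

definition trunc_fourier_helicity :: "nat \<Rightarrow> (int^3 \<Rightarrow> complex^3) \<Rightarrow> complex" where
  "trunc_fourier_helicity n v = (\<Sum>m\<in>freq_box (2 * n). (complex_of_real (lam n m))\<^sup>2 * dotc (curlc v m) (v (- m)))"

text \<open>The weights stay in \<open>[0, 1]\<close> and tend to 1 at each frequency; the summands
  are dominated through the product estimate at \<open>m = 0\<close>.\<close>

lemma trunc_fourier_helicity_tendsto:
  assumes s: "energy_density v summable_on UNIV" and real: "\<And>k i. v (- k) $ i = cnj (v k $ i)"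
  shows "(\<lambda>q. Re (trunc_fourier_helicity (2 ^ q) v)) \<longlonglongrightarrow> fourier_helicity v"
proof -
  let ?h = "\<lambda>i m. curlc v m $ i * v (- m) $ i"
  have sg: "(\<lambda>m. peetre 0 * (energy_density v (- m) + energy_density v m)) summable_on UNIV"
    using energy_density_pair_summable[OF s, of "peetre 0" 0] by (simp add: add.commute)
  have bd: "norm (?h i m) \<le> peetre 0 * (energy_density v (- m) + energy_density v m)" for i m
    using norm_product_curlc_le[of v "- m" i 0 i] by (simp add: mult.commute)
  have inf: "(\<lambda>q. \<Sum>\<^sub>\<infinity>m. (complex_of_real (lam (2 ^ q) m))\<^sup>2 * ?h i m) \<longlonglongrightarrow> (\<Sum>\<^sub>\<infinity>m. ?h i m)" for i
  proof (rule infsum_dominated[OF sg])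
    show "norm ((complex_of_real (lam (2 ^ q) m))\<^sup>2 * ?h i m) \<le> peetre 0 * (energy_density v (- m) + energy_density v m)" for q m
    proof -
      have "norm ((complex_of_real (lam (2 ^ q) m))\<^sup>2) \<le> 1"
        unfolding norm_power norm_of_real using lam_nonneg[of "2 ^ q" m] lam_le_1[of "2 ^ q" m] by (simp add: power_le_one)
      then have "norm ((complex_of_real (lam (2 ^ q) m))\<^sup>2 * ?h i m) \<le> 1 * norm (?h i m)"
        unfolding norm_mult[of "_\<^sup>2"] by (intro mult_right_mono) auto
      then show ?thesis using bd[where i = i and m = m] by linarith
    qed
    show "(\<lambda>q. (complex_of_real (lam (2 ^ q) m))\<^sup>2 * ?h i m) \<longlonglongrightarrow> ?h i m" for m
      using tendsto_mult[OF tendsto_power[OF tendsto_of_real[OF lam_tendsto_1[of m]], of 2] tendsto_const[of "?h i m"]] by simp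
  qed
  have "infsum (\<lambda>m. (complex_of_real (lam n m))\<^sup>2 * ?h i m) UNIV = infsum (\<lambda>m. (complex_of_real (lam n m))\<^sup>2 * ?h i m) (freq_box (2 * n))" for n i
    by (rule infsum_cong_neutral) (auto simp: lam_eq_0)
  then have fin: "infsum (\<lambda>m. (complex_of_real (lam n m))\<^sup>2 * ?h i m) UNIV = (\<Sum>m\<in>freq_box (2 * n). (complex_of_real (lam n m))\<^sup>2 * ?h i m)" for n i
    by (simp add: finite_freq_box)
  have tr: "trunc_fourier_helicity n v = (\<Sum>i\<in>UNIV. infsum (\<lambda>m. (complex_of_real (lam n m))\<^sup>2 * ?h i m) UNIV)" for n
    unfolding fin trunc_fourier_helicity_def dotc_def sum_distrib_left by (rule sum.swap)
  have "(\<lambda>q. Re (\<Sum>i\<in>UNIV. infsum (\<lambda>m. (complex_of_real (lam (2 ^ q) m))\<^sup>2 * ?h i m) UNIV)) \<longlonglongrightarrow> Re (\<Sum>i\<in>UNIV. \<Sum>\<^sub>\<infinity>m. ?h i m)"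
    by (intro tendsto_Re tendsto_sum inf)
  then show ?thesis unfolding tr fourier_helicity_def by (simp add: real)
qed

text \<open>Only the vorticity is known to have a derivative in time, so the curl is inverted to express
  the truncated helicity as a quadratic form in the vorticity.\<close>

definition biot_savart :: "int^3 \<Rightarrow> 3 \<Rightarrow> 3 \<Rightarrow> complex" where
  "biot_savart m j l = \<i> / (2 * pi * (norm (freq m))\<^sup>2) * crossc (cfreq m) (axis l 1) $ j"

lemma biot_savart_sum:
  "(\<Sum>j\<in>UNIV. \<Sum>l\<in>UNIV. biot_savart m j l * (x $ j * w $ l))
    = \<i> / (2 * pi * (norm (freq m))\<^sup>2) * dotc x (crossc (cfreq m) w)"
  unfolding sum_3 dotc_def biot_savart_def crossc_nth axis_def vec_lambda_beta
  by (simp add: algebra_simps)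

lemma norm_freq_square: "complex_of_real ((norm (freq m))\<^sup>2) = dotc (cfreq m) (cfreq m)"
  by (simp add: dotc_def cfreq_def freq_def norm_vec_def L2_set_def sum_3 power2_eq_square)

text \<open>On divergence-free fields the curl applied twice is minus the Laplacian, so dividing by
  \<open>|m|^2\<close> inverts it: the Biot-Savart law at a nonzero frequency.\<close>

lemma biot_savart_curlc:
  assumes div: "dotc (cfreq m) (v m) = 0" and m: "m \<noteq> 0"
  shows "\<i> / (2 * pi * (norm (freq m))\<^sup>2) * dotc x (crossc (cfreq m) (curlc v m)) = dotc x (v m)"
proof -
  have n0: "norm (freq m) \<noteq> 0" using m by (auto simp: freq_def vec_eq_iff)
  have "dotc x (crossc (cfreq m) (curlc v m)) = 2 * pi * \<i> * (dotc (cfreq m) (v m) * dotc (cfreq m) x - dotc (cfreq m) (cfreq m) * dotc (v m) x)"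
    using dotc_crossc_curlc[of "cfreq m" v m x] by (simp add: dotc_commute)
  then have "dotc x (crossc (cfreq m) (curlc v m)) = - (2 * pi * \<i>) * complex_of_real ((norm (freq m))\<^sup>2) * dotc x (v m)"
    unfolding norm_freq_square div by (simp add: dotc_commute)
  then show ?thesis using n0 by (simp add: field_simps)
qed

lemma vorticity_rhs_0: "vorticity_rhs v 0 = 0"
  by (simp add: vorticity_rhs_def vec_eq_iff forall_3 cfreq_def)

lemma curlc_0: "curlc v 0 = 0"
  by (simp add: curlc_def vec_eq_iff forall_3 cfreq_def)

lemma dotc_vorticity_rhs: "dotc (vorticity_rhs v m) (v (- m)) = dotc (lamb_vector v m) (curlc v (- m))"
  by (simp add: dotc_def vorticity_rhs_def curlc_def cfreq_def sum_3 algebra_simps)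

text \<open>Since the curl is symmetric, both terms of the product rule for the truncated helicity agree.\<close>

lemma trunc_fourier_helicity_derivative:
  assumes div: "\<And>k. dotc (cfreq k) (v k) = 0"
  shows "(\<Sum>m\<in>freq_box (2 * n). \<Sum>j\<in>UNIV. \<Sum>l\<in>UNIV. (complex_of_real (lam n m))\<^sup>2 * (biot_savart (- m) j l *
      (curlc v m $ j * vorticity_rhs v (- m) $ l + vorticity_rhs v m $ j * curlc v (- m) $ l))) = 2 * helicity_flux n v"
proof -
  let ?F = "freq_box (2 * n)" and ?l = "\<lambda>m. (complex_of_real (lam n m))\<^sup>2"
  let ?c = "\<lambda>m. \<i> / (2 * pi * (norm (freq m))\<^sup>2)"
  have "(\<Sum>j\<in>UNIV. \<Sum>l\<in>UNIV. ?l m * (biot_savart (- m) j l * (curlc v m $ j * vorticity_rhs v (- m) $ l + vorticity_rhs v m $ j * curlc v (- m) $ l)))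
    = ?l m * (?c (- m) * dotc (curlc v m) (crossc (cfreq (- m)) (vorticity_rhs v (- m))))
      + ?l m * (?c (- m) * dotc (vorticity_rhs v m) (crossc (cfreq (- m)) (curlc v (- m))))" for m
    unfolding biot_savart_sum[symmetric] sum_distrib_left sum.distrib[symmetric]
    by (intro sum.cong refl) (simp only: distrib_left)
  then have "(\<Sum>m\<in>?F. \<Sum>j\<in>UNIV. \<Sum>l\<in>UNIV. ?l m * (biot_savart (- m) j l * (curlc v m $ j * vorticity_rhs v (- m) $ l + vorticity_rhs v m $ j * curlc v (- m) $ l)))
    = (\<Sum>m\<in>?F. ?l m * (?c (- m) * dotc (curlc v m) (crossc (cfreq (- m)) (vorticity_rhs v (- m)))))
      + (\<Sum>m\<in>?F. ?l m * (?c (- m) * dotc (vorticity_rhs v m) (crossc (cfreq (- m)) (curlc v (- m)))))"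
    by (simp only: sum.distrib)
  also have "(\<Sum>m\<in>?F. ?l m * (?c (- m) * dotc (curlc v m) (crossc (cfreq (- m)) (vorticity_rhs v (- m)))))
      = (\<Sum>m\<in>?F. ?l (- m) * (?c (- (- m)) * dotc (curlc v (- m)) (crossc (cfreq (- (- m))) (vorticity_rhs v (- (- m))))))"
    by (rule sum.reindex_bij_witness[of _ uminus uminus]) auto
  also have "\<dots> = (\<Sum>m\<in>?F. ?l m * (?c (- m) * dotc (vorticity_rhs v m) (crossc (cfreq (- m)) (curlc v (- m)))))"
  proof (intro sum.cong refl)
    fix m
    have "dotc (curlc v (- m)) (crossc (cfreq m) (vorticity_rhs v m)) = dotc (vorticity_rhs v m) (crossc (cfreq (- m)) (curlc v (- m)))"
      unfolding cfreq_uminus by (simp add: dotc_def sum_3 algebra_simps)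
    then show "?l (- m) * (?c (- (- m)) * dotc (curlc v (- m)) (crossc (cfreq (- (- m))) (vorticity_rhs v (- (- m)))))
      = ?l m * (?c (- m) * dotc (vorticity_rhs v m) (crossc (cfreq (- m)) (curlc v (- m))))"
      by (simp add: lam_uminus freq_uminus)
  qed
  also have "(\<Sum>m\<in>?F. ?l m * (?c (- m) * dotc (vorticity_rhs v m) (crossc (cfreq (- m)) (curlc v (- m))))) = helicity_flux n v"
    unfolding helicity_flux_def
  proof (intro sum.cong refl)
    fix m
    have "?c (- m) * dotc (vorticity_rhs v m) (crossc (cfreq (- m)) (curlc v (- m))) = dotc (lamb_vector v m) (curlc v (- m))"
    proof (cases "m = 0")
      case False
      then show ?thesis using biot_savart_curlc[where m = "- m" and v = v and x = "vorticity_rhs v m", OF div] dotc_vorticity_rhs[of v m] by simp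
    qed (simp add: vorticity_rhs_0 curlc_0)
    then show "?l m * (?c (- m) * dotc (vorticity_rhs v m) (crossc (cfreq (- m)) (curlc v (- m)))) = ?l m * dotc (lamb_vector v m) (curlc v (- m))"
      by simp
  qed
  finally show ?thesis by simp
qed

lemma trunc_fourier_helicity_biot_savart:
  assumes div: "\<And>k. dotc (cfreq k) (v k) = 0"
  shows "(\<Sum>m\<in>freq_box (2 * n). \<Sum>j\<in>UNIV. \<Sum>l\<in>UNIV. (complex_of_real (lam n m))\<^sup>2 * (biot_savart (- m) j l *
      (curlc v m $ j * curlc v (- m) $ l))) = trunc_fourier_helicity n v"
  unfolding trunc_fourier_helicity_def sum_distrib_left[symmetric] biot_savart_sum
proof (intro sum.cong refl arg_cong2[where f = "(*)"])
  fix m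
  show "\<i> / (2 * pi * (norm (freq (- m)))\<^sup>2) * dotc (curlc v m) (crossc (cfreq (- m)) (curlc v (- m))) = dotc (curlc v m) (v (- m))"
    using biot_savart_curlc[where m = "- m" and v = v and x = "curlc v m", OF div] by (cases "m = 0") (simp_all add: curlc_0)
qed

section \<open>Time-dependent fields of bounded energy\<close>

lemma countable_freq: "countable (UNIV :: (int^3) set)"
proof -
  have "UNIV = (\<Union>N. freq_box N)"
    using freq_box_exhausts eventually_happens by (metis (no_types, lifting) UNIV_eq_I UN_I UNIV_I sequentially_bot)
  then show ?thesis using countable_UN[of UNIV freq_box] by (simp add: countable_finite finite_freq_box)
qed

text \<open>The energy bounds are demanded at every time, while a solution has them almost
  everywhere; the exceptional times are filled with the zero field when the locale is
  instantiated.\<close>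

locale energy_flow =
  fixes T :: real and V :: "real \<Rightarrow> int^3 \<Rightarrow> complex^3" and E0 :: real
  assumes T: "T > 0"
    and meas: "\<And>k i. (\<lambda>t. V t k $ i) \<in> borel_measurable (lebesgue_on {0<..<T})"
    and summable: "\<And>t. energy_density (V t) summable_on UNIV" and energy: "\<And>t. infsum (energy_density (V t)) UNIV \<le> E0"
begin

lemma E0: "0 \<le> E0"
  using energy[of 0] infsum_nonneg[of UNIV "energy_density (V 0)"] energy_density_nonneg by (meson order_trans)

lemma energy_density_le: "energy_density (V t) k \<le> E0"
proof -
  have "infsum (energy_density (V t)) {k} \<le> infsum (energy_density (V t)) UNIV"
    by (rule infsum_mono_neutral) (use summable energy_density_nonneg in auto)
  then show ?thesis using energy[of t] by simp
qed

lemma norm_V_le: "norm (V t k $ i) \<le> sqrt E0"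
proof -
  have "norm (V t k $ i) \<le> (\<Sum>i\<in>UNIV. norm (V t k $ i))" by (rule member_le_sum) auto
  then have "(norm (V t k $ i))\<^sup>2 \<le> (\<Sum>i\<in>UNIV. norm (V t k $ i))\<^sup>2" by (rule power_mono) simp
  also have "\<dots> \<le> energy_density (V t) k"
    unfolding energy_density_def using mult_right_mono[of 1 "sqrt (1 + (norm (freq k))\<^sup>2)" "(\<Sum>i\<in>UNIV. norm (V t k $ i))\<^sup>2"] by simp
  also have "\<dots> \<le> E0" by (rule energy_density_le)
  finally show ?thesis by (rule real_le_rsqrt)
qed

lemma bounded_meas_V: "bounded_meas T (\<lambda>t. V t k $ i)"
  by (rule bounded_measI[OF meas norm_V_le])

lemma bounded_meas_cmult:
  fixes f :: "real \<Rightarrow> complex"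
  shows "bounded_meas T f \<Longrightarrow> bounded_meas T (\<lambda>t. c * f t)"
  by (rule bounded_meas_mult[OF bounded_meas_const])

lemma bounded_meas_diff:
  fixes f g :: "real \<Rightarrow> complex"
  shows "bounded_meas T f \<Longrightarrow> bounded_meas T g \<Longrightarrow> bounded_meas T (\<lambda>t. f t - g t)"
  using bounded_meas_add[of T f "\<lambda>t. (- 1) * g t"] bounded_meas_cmult[of g "- 1"] by simp

lemma bounded_meas_crossc:
  assumes "\<And>i. bounded_meas T (\<lambda>t. f t $ i)" "\<And>i. bounded_meas T (\<lambda>t. g t $ i)"
  shows "bounded_meas T (\<lambda>t. crossc (f t) (g t) $ j)"
  using exhaust_3[of j]
  by (elim disjE) (simp_all, (intro bounded_meas_diff bounded_meas_mult assms)+)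

lemma bounded_meas_curlc: "bounded_meas T (\<lambda>t. curlc (V t) m $ j)"
  unfolding curlc_def vector_smult_component
  by (intro bounded_meas_cmult bounded_meas_crossc bounded_meas_V bounded_meas_const)

lemma bounded_meas_lamb_vector: "bounded_meas T (\<lambda>t. lamb_vector (V t) m $ j)"
proof (rule bounded_measI[where C = "4 * peetre m * E0"])
  have c: "(\<lambda>t. crossc (V t k) (curlc (V t) (m - k)) $ j) \<in> borel_measurable (lebesgue_on {0<..<T})" for k
    using bounded_meas_crossc[OF bounded_meas_V bounded_meas_curlc, of k "m - k" j] by (simp add: bounded_meas_def)
  show "(\<lambda>t. lamb_vector (V t) m $ j) \<in> borel_measurable (lebesgue_on {0<..<T})"
  proof (rule borel_measurable_LIMSEQ_metric)
    show "(\<lambda>t. \<Sum>k\<in>freq_box N. crossc (V t k) (curlc (V t) (m - k)) $ j) \<in> borel_measurable (lebesgue_on {0<..<T})" for N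
      by (intro borel_measurable_sum c)
    show "(\<lambda>N. \<Sum>k\<in>freq_box N. crossc (V t k) (curlc (V t) (m - k)) $ j) \<longlonglongrightarrow> lamb_vector (V t) m $ j" for t
      unfolding lamb_vector_def vec_lambda_beta
      by (rule infsum_eq_lim_freq_box[OF energy_density_pair_summable[OF summable] norm_crossc_curlc_le])
  qed
  show "norm (lamb_vector (V t) m $ j) \<le> 4 * peetre m * E0" for t
  proof -
    have "4 * peetre m * infsum (energy_density (V t)) UNIV \<le> 4 * peetre m * E0"
      using peetre_nonneg[of m] by (intro mult_left_mono energy) auto
    then show ?thesis using norm_lamb_vector_le[OF summable, of t m j] by linarith
  qed
qed

lemma bounded_meas_vorticity_rhs: "bounded_meas T (\<lambda>t. vorticity_rhs (V t) m $ j)"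
  unfolding vorticity_rhs_def vector_smult_component
  by (intro bounded_meas_cmult bounded_meas_crossc bounded_meas_lamb_vector bounded_meas_const)

lemma bounded_meas_Re_mult:
  fixes f :: "real \<Rightarrow> complex"
  assumes "bounded_meas T f"
  shows "bounded_meas T (\<lambda>t. Re (z * f t))"
  by (rule bounded_meas_bounded_linear[OF bounded_linear_Re bounded_meas_cmult[OF assms]])

end

text \<open>\<open>b\<close> stands for a constant times the cube of the Besov norm and
  \<open>\<rho>\<close> for \<open>4 r^3\<close>. The product form of the bound separates
  integrability in time from decay in the scale.\<close>

locale weak_flow = energy_flow +
  fixes \<rho> :: real and b :: "real \<Rightarrow> real"
  assumes div: "\<And>t k. dotc (cfreq k) (V t k) = 0" and real: "\<And>t k i. V t (- k) $ i = cnj (V t k $ i)"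
    and weak: "\<And>\<eta> \<eta>' m j z. time_test T \<eta> \<eta>' \<Longrightarrow>
      (LINT t|lebesgue_on {0<..<T}. \<eta>' t * Re (z * curlc (V t) m $ j)) + (LINT t|lebesgue_on {0<..<T}. \<eta> t * Re (z * vorticity_rhs (V t) m $ j)) = 0"
    and b: "integrable (lebesgue_on {0<..<T}) b" and \<rho>: "0 \<le> \<rho>" "\<rho> < 1"
    and flux: "\<And>q t. t \<in> {0<..<T} \<Longrightarrow> norm (helicity_flux (2 ^ q) (V t)) \<le> b t * \<rho> ^ q"
begin

text \<open>The amplitudes \<open>z = 1\<close> and \<open>z = - \<i>\<close> give the real and the
  imaginary part of the coefficient, and the real-valued result applies to each.\<close>

lemma vorticity_primitive:
  "\<exists>W. primitive T W (\<lambda>t. vorticity_rhs (V t) m $ j) \<and> (AE t in lebesgue_on {0<..<T}. curlc (V t) m $ j = W t)"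
proof -
  obtain X where X: "primitive T X (\<lambda>t. Re (1 * vorticity_rhs (V t) m $ j))" "AE t in lebesgue_on {0<..<T}. Re (1 * curlc (V t) m $ j) = X t"
    by (rule weak_derivative_imp_primitive[OF T bounded_meas_Re_mult[OF bounded_meas_curlc] bounded_meas_Re_mult[OF bounded_meas_vorticity_rhs] weak])
  obtain Y where Y: "primitive T Y (\<lambda>t. Re (- \<i> * vorticity_rhs (V t) m $ j))" "AE t in lebesgue_on {0<..<T}. Re (- \<i> * curlc (V t) m $ j) = Y t"
    by (rule weak_derivative_imp_primitive[OF T bounded_meas_Re_mult[OF bounded_meas_curlc] bounded_meas_Re_mult[OF bounded_meas_vorticity_rhs] weak])
  have "primitive T (\<lambda>t. complex_of_real (X t) + \<i> * complex_of_real (Y t))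
      (\<lambda>t. complex_of_real (Re (1 * vorticity_rhs (V t) m $ j)) + \<i> * complex_of_real (Re (- \<i> * vorticity_rhs (V t) m $ j)))"
    by (intro primitive_add primitive_bounded_linear[OF bounded_linear_of_real X(1)]
        primitive_bounded_linear[OF bounded_linear_mult_right primitive_bounded_linear[OF bounded_linear_of_real Y(1)]])
  moreover have "complex_of_real (Re (1 * w)) + \<i> * complex_of_real (Re (- \<i> * w)) = w" for w
    by (simp add: complex_eq_iff)
  ultimately have "primitive T (\<lambda>t. complex_of_real (X t) + \<i> * complex_of_real (Y t)) (\<lambda>t. vorticity_rhs (V t) m $ j)" by simp
  moreover have "AE t in lebesgue_on {0<..<T}. curlc (V t) m $ j = complex_of_real (X t) + \<i> * complex_of_real (Y t)"
    using X(2) Y(2) by eventually_elim (simp add: complex_eq_iff)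
  ultimately show ?thesis by blast
qed

text \<open>Between any two times \<open>h q\<close> changes by at most \<open>I \<rho>^q\<close>,
  the time integral of twice the flux. At good times it is the truncated helicity, which converges
  to the full one as \<open>q\<close> grows, so two good times have the same limit.\<close>

theorem fourier_helicity_constant: "AE s in lebesgue_on {0<..<T}. AE t in lebesgue_on {0<..<T}. fourier_helicity (V s) = fourier_helicity (V t)"
proof -
  let ?M = "lebesgue_on {0<..<T}"
  define W where "W m j = (SOME W. primitive T W (\<lambda>t. vorticity_rhs (V t) m $ j) \<and> (AE t in ?M. curlc (V t) m $ j = W t))" for m j
  have "primitive T (W m j) (\<lambda>t. vorticity_rhs (V t) m $ j) \<and> (AE t in ?M. curlc (V t) m $ j = W m j t)" for m j
    unfolding W_def by (rule someI_ex[OF vorticity_primitive])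
  then have W: "\<And>m j. primitive T (W m j) (\<lambda>t. vorticity_rhs (V t) m $ j)" "\<And>m j. AE t in ?M. curlc (V t) m $ j = W m j t"
    by blast+
  define good where "good t \<longleftrightarrow> t \<in> {0<..<T} \<and> (\<forall>m j. curlc (V t) m $ j = W m j t)" for t
  have "AE t in ?M. \<forall>m\<in>UNIV. \<forall>j\<in>UNIV. curlc (V t) m $ j = W m j t"
    by (intro AE_ball_countable' AE_finite_allI countable_freq W(2)) auto
  then have AEgood: "AE t in ?M. good t"
    by (auto simp: good_def elim: AE_mp)
  define coef where "coef n m j l = (complex_of_real (lam n m))\<^sup>2 * biot_savart (- m) j l" for n m j l
  \<comment> \<open>Built from the primitives \<open>W\<close> instead of the curls: this makes
    \<open>h q\<close> absolutely continuous on the whole interval, and it agrees with the truncated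
    helicity at good times, hence almost everywhere.\<close>
  define h where "h q t = (\<Sum>m\<in>freq_box (2 * 2 ^ q). \<Sum>j\<in>UNIV. \<Sum>l\<in>UNIV. coef (2 ^ q) m j l * (W m j t * W (- m) l t))" for q t
  define D where "D q t = (\<Sum>m\<in>freq_box (2 * 2 ^ q). \<Sum>j\<in>UNIV. \<Sum>l\<in>UNIV. coef (2 ^ q) m j l *
      (W m j t * vorticity_rhs (V t) (- m) $ l + vorticity_rhs (V t) m $ j * W (- m) l t))" for q t
  have prim: "primitive T (h q) (D q)" for q
    unfolding h_def[abs_def] D_def[abs_def]
    by (intro primitive_sum primitive_bounded_linear[OF bounded_linear_mult_right] primitive_mult W)
  have hT: "h q t = trunc_fourier_helicity (2 ^ q) (V t)" if "good t" for q t
  proof -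
    have "h q t = (\<Sum>m\<in>freq_box (2 * 2 ^ q). \<Sum>j\<in>UNIV. \<Sum>l\<in>UNIV. coef (2 ^ q) m j l * (curlc (V t) m $ j * curlc (V t) (- m) $ l))"
      using that unfolding h_def good_def by simp
    then show ?thesis
      using trunc_fourier_helicity_biot_savart[of "V t" "2 ^ q", OF div] by (simp only: coef_def mult.assoc)
  qed
  have DF: "D q t = 2 * helicity_flux (2 ^ q) (V t)" if "good t" for q t
  proof -
    have "D q t = (\<Sum>m\<in>freq_box (2 * 2 ^ q). \<Sum>j\<in>UNIV. \<Sum>l\<in>UNIV. coef (2 ^ q) m j l *
      (curlc (V t) m $ j * vorticity_rhs (V t) (- m) $ l + vorticity_rhs (V t) m $ j * curlc (V t) (- m) $ l))"
      using that unfolding D_def good_def by simp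
    then show ?thesis
      using trunc_fourier_helicity_derivative[of "V t" "2 ^ q", OF div] by (simp only: coef_def mult.assoc)
  qed
  define I where "I = 2 * (LINT t|?M. b t)"
  have step: "norm (h q t - h q s) \<le> I * \<rho> ^ q" if st: "0 < s" "s \<le> t" "t < T" for q s t
  proof -
    have bD: "bounded_meas T (D q)" using prim by (simp add: primitive_def)
    have "h q t - h q s = ivl_int T s t (D q)" using prim st by (simp add: primitive_def)
    then have "norm (h q t - h q s) \<le> (LINT \<tau>|?M. norm (indicator {s<..t} \<tau> *\<^sub>R D q \<tau>))"
      unfolding ivl_int_def by (simp only: Bochner_Integration.integral_norm_bound)
    also have "\<dots> \<le> (LINT \<tau>|?M. (2 * \<rho> ^ q) * b \<tau>)"
    proof (rule integral_mono_AE)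
      show "integrable ?M (\<lambda>\<tau>. norm (indicator {s<..t} \<tau> *\<^sub>R D q \<tau>))"
        by (intro integrable_norm ivl_int_integrable bD)
      show "integrable ?M (\<lambda>\<tau>. (2 * \<rho> ^ q) * b \<tau>)" using b by simp
      show "AE \<tau> in ?M. norm (indicator {s<..t} \<tau> *\<^sub>R D q \<tau>) \<le> (2 * \<rho> ^ q) * b \<tau>"
        using AEgood
      proof eventually_elim
        case (elim \<tau>)
        have "norm (indicator {s<..t} \<tau> *\<^sub>R D q \<tau>) \<le> norm (D q \<tau>)" by (simp add: indicator_def)
        also have "\<dots> = 2 * norm (helicity_flux (2 ^ q) (V \<tau>))" unfolding DF[OF elim] by (simp add: norm_mult)
        also have "\<dots> \<le> 2 * (b \<tau> * \<rho> ^ q)" using flux[of \<tau> q] elim by (simp add: good_def)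
        finally show ?case by (simp add: mult_ac)
      qed
    qed
    also have "\<dots> = I * \<rho> ^ q" by (simp add: I_def)
    finally show ?thesis .
  qed
  have eq: "fourier_helicity (V s) = fourier_helicity (V t)" if g: "good s" "good t" and st: "s \<le> t" for s t
  proof -
    have lim: "(\<lambda>q. Re (h q t) - Re (h q s)) \<longlonglongrightarrow> fourier_helicity (V t) - fourier_helicity (V s)"
      unfolding hT[OF g(1)] hT[OF g(2)] by (intro tendsto_diff trunc_fourier_helicity_tendsto summable real)
    have "(\<lambda>q. I * \<rho> ^ q) \<longlonglongrightarrow> I * 0"
      using \<rho> by (intro tendsto_mult tendsto_const LIMSEQ_realpow_zero) auto
    then have I0: "(\<lambda>q. I * \<rho> ^ q) \<longlonglongrightarrow> 0" by simp
    have "(\<lambda>q. Re (h q t) - Re (h q s)) \<longlonglongrightarrow> 0"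
    proof (rule Lim_null_comparison[OF always_eventually I0], rule allI)
      fix q
      have "\<bar>Re (h q t - h q s)\<bar> \<le> norm (h q t - h q s)" by (rule abs_Re_le_cmod)
      also have "\<dots> \<le> I * \<rho> ^ q" using g st by (intro step) (auto simp: good_def)
      finally show "norm (Re (h q t) - Re (h q s)) \<le> I * \<rho> ^ q" by simp
    qed
    from LIMSEQ_unique[OF lim this] show ?thesis by simp
  qed
  have eq': "fourier_helicity (V s) = fourier_helicity (V t)" if "good s" "good t" for s t
  proof (cases "s \<le> t")
    case True
    then show ?thesis by (rule eq[OF that])
  next
    case False
    then have "t \<le> s" by simp
    from eq[OF that(2,1) this] show ?thesis by (rule sym)
  qed
  show ?thesis
    using AEgood
  proof eventually_elim
    case (elim s)
    show ?case using AEgood by eventually_elim (rule eq'[OF elim])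
  qed
qed

end

section \<open>Sobolev and Besov regularity in terms of Fourier coefficients\<close>

text \<open>The factor 3 is Cauchy-Schwarz over the three components; \<open>1/2 \<le> s\<close>
  lowers the Sobolev weight to that of the energy density.\<close>

lemma sobolev_energy:
  assumes f: "f \<in> sobolev s" and s: "1/2 \<le> s"
  shows "energy_density (uhat f) summable_on UNIV" "infsum (energy_density (uhat f)) UNIV \<le> 3 * (sobolev_norm s f)\<^sup>2"
proof -
  let ?w = "\<lambda>k. (1 + (norm (freq k))\<^sup>2) powr s"
  let ?g = "\<lambda>i k. ?w k * (cmod (fourier_coeff (f $ i) k))\<^sup>2"
  have sm: "?g i summable_on UNIV" for i using f by (simp add: sobolev_def)
  have le: "energy_density (uhat f) k \<le> 3 * (?g 1 k + ?g 2 k + ?g 3 k)" for k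
  proof -
    have "sqrt (1 + (norm (freq k))\<^sup>2) = (1 + (norm (freq k))\<^sup>2) powr (1/2)"
      by (rule powr_half_sqrt[symmetric]) simp
    also have "\<dots> \<le> ?w k" using s by (intro powr_mono) auto
    finally have w: "sqrt (1 + (norm (freq k))\<^sup>2) \<le> ?w k" .
    have sq: "(\<Sum>i\<in>UNIV. norm (uhat f k $ i))\<^sup>2 \<le> 3 * (\<Sum>i\<in>UNIV. (norm (uhat f k $ i))\<^sup>2)"
      using sum_squares_bound[of "norm (uhat f k $ 1)" "norm (uhat f k $ 2)"]
        sum_squares_bound[of "norm (uhat f k $ 1)" "norm (uhat f k $ 3)"]
        sum_squares_bound[of "norm (uhat f k $ 2)" "norm (uhat f k $ 3)"]
      by (simp add: sum_3 power2_eq_square algebra_simps)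
    have "energy_density (uhat f) k \<le> ?w k * (3 * (\<Sum>i\<in>UNIV. (norm (uhat f k $ i))\<^sup>2))"
      unfolding energy_density_def by (intro mult_mono w sq) auto
    then show ?thesis by (simp add: uhat_def sum_3 algebra_simps)
  qed
  have sm3: "(\<lambda>k. 3 * (?g 1 k + ?g 2 k + ?g 3 k)) summable_on UNIV"
    by (intro summable_on_cmult_right summable_on_add sm)
  show 1: "energy_density (uhat f) summable_on UNIV"
    by (rule summable_on_comparison_test[OF sm3]) (use le energy_density_nonneg in auto)
  have "infsum (energy_density (uhat f)) UNIV \<le> (\<Sum>\<^sub>\<infinity>k. 3 * (?g 1 k + ?g 2 k + ?g 3 k))"
    by (rule infsum_mono[OF 1 sm3 le])
  also have "\<dots> = 3 * (\<Sum>i\<in>UNIV. infsum (?g i) UNIV)"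
    by (simp only: infsum_cmult_right' sum_3 infsum_add[OF summable_on_add[OF sm sm] sm] infsum_add[OF sm sm])
  also have "\<dots> = 3 * (sobolev_norm s f)\<^sup>2"
    unfolding sobolev_norm_def by (subst real_sqrt_pow2) (auto intro!: sum_nonneg infsum_nonneg)
  finally show "infsum (energy_density (uhat f)) UNIV \<le> 3 * (sobolev_norm s f)\<^sup>2" .
qed

lemma sobolev_distribution: "f \<in> sobolev s \<Longrightarrow> \<forall>i. torus_distribution (f $ i)"
  by (simp add: sobolev_def)

lemma torus_distribution_diff:
  assumes "torus_distribution f" "torus_distribution g"
  shows "torus_distribution (f - g)"
proof -
  from assms obtain C m C' m' where
    C: "\<And>\<phi> M. torus_test \<phi> \<Longrightarrow> (\<forall>vs x. set vs \<subseteq> Basis \<longrightarrow> length vs \<le> m \<longrightarrow> \<bar>iter_deriv vs \<phi> x\<bar> \<le> M) \<Longrightarrow> \<bar>f \<phi>\<bar> \<le> C * M"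
    and C': "\<And>\<phi> M. torus_test \<phi> \<Longrightarrow> (\<forall>vs x. set vs \<subseteq> Basis \<longrightarrow> length vs \<le> m' \<longrightarrow> \<bar>iter_deriv vs \<phi> x\<bar> \<le> M) \<Longrightarrow> \<bar>g \<phi>\<bar> \<le> C' * M"
    unfolding torus_distribution_def by metis
  have "\<bar>(f - g) \<phi>\<bar> \<le> (C + C') * M" if "torus_test \<phi>"
    "\<forall>vs x. set vs \<subseteq> Basis \<longrightarrow> length vs \<le> max m m' \<longrightarrow> \<bar>iter_deriv vs \<phi> x\<bar> \<le> M" for \<phi> M
  proof -
    have "\<bar>f \<phi>\<bar> \<le> C * M" "\<bar>g \<phi>\<bar> \<le> C' * M" using that by (auto intro!: C C')
    then show ?thesis by (simp add: distrib_right)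
  qed
  moreover have "(f - g) (\<lambda>x. a * \<phi> x + b * \<psi> x) = a * (f - g) \<phi> + b * (f - g) \<psi>"
    if "torus_test \<phi>" "torus_test \<psi>" for \<phi> \<psi> a b
    using torus_distribution_linear[OF assms(1) that, of a b] torus_distribution_linear[OF assms(2) that, of a b]
    by (simp add: algebra_simps)
  ultimately show ?thesis unfolding torus_distribution_def by blast
qed

lemma fourier_coeff_diff: "fourier_coeff (f - g) k = fourier_coeff f k - fourier_coeff g k"
  by (simp add: fourier_coeff_def complex_eq_iff)

lemma sobolev_diff:
  assumes "f \<in> sobolev s" "g \<in> sobolev s"
  shows "f - g \<in> sobolev s"
proof -
  let ?w = "\<lambda>k. (1 + (norm (freq k))\<^sup>2) powr s"
  have "(\<lambda>k. ?w k * (cmod (fourier_coeff ((f - g) $ i) k))\<^sup>2) summable_on UNIV" for i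
  proof (rule summable_on_comparison_test)
    show "(\<lambda>k. 2 * (?w k * (cmod (fourier_coeff (f $ i) k))\<^sup>2 + ?w k * (cmod (fourier_coeff (g $ i) k))\<^sup>2)) summable_on UNIV"
      using assms by (intro summable_on_cmult_right summable_on_add) (simp_all add: sobolev_def)
    fix k
    have "(cmod (fourier_coeff ((f - g) $ i) k))\<^sup>2 \<le> (cmod (fourier_coeff (f $ i) k) + cmod (fourier_coeff (g $ i) k))\<^sup>2"
      by (intro power_mono) (simp_all add: fourier_coeff_diff norm_triangle_ineq4)
    also have "\<dots> \<le> 2 * ((cmod (fourier_coeff (f $ i) k))\<^sup>2 + (cmod (fourier_coeff (g $ i) k))\<^sup>2)"
      using sum_squares_bound[of "cmod (fourier_coeff (f $ i) k)" "cmod (fourier_coeff (g $ i) k)"] by (simp add: power2_sum)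
    finally have "?w k * (cmod (fourier_coeff ((f - g) $ i) k))\<^sup>2 \<le> ?w k * (2 * ((cmod (fourier_coeff (f $ i) k))\<^sup>2 + (cmod (fourier_coeff (g $ i) k))\<^sup>2))"
      by (intro mult_left_mono) auto
    then show "?w k * (cmod (fourier_coeff ((f - g) $ i) k))\<^sup>2 \<le> 2 * (?w k * (cmod (fourier_coeff (f $ i) k))\<^sup>2 + ?w k * (cmod (fourier_coeff (g $ i) k))\<^sup>2)"
      by (simp add: algebra_simps)
  qed auto
  moreover have "torus_distribution ((f - g) $ i)" for i
    using assms by (simp add: sobolev_def torus_distribution_diff)
  ultimately show ?thesis by (simp add: sobolev_def)
qed

text \<open>Coefficients are continuous in the Sobolev norm, so strong measurability of
  \<open>u\<close> passes to each coefficient as a limit of simple functions.\<close>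

lemma fourier_coeff_le_sobolev_norm:
  assumes f: "f \<in> sobolev s" and s: "0 \<le> s"
  shows "cmod (fourier_coeff (f $ i) k) \<le> sobolev_norm s f"
proof -
  let ?g = "\<lambda>i k. (1 + (norm (freq k))\<^sup>2) powr s * (cmod (fourier_coeff (f $ i) k))\<^sup>2"
  have sm: "?g i summable_on UNIV" for i using f by (simp add: sobolev_def)
  have "1 \<le> (1 + (norm (freq k))\<^sup>2) powr s" using s by (intro ge_one_powr_ge_zero) auto
  then have "(cmod (fourier_coeff (f $ i) k))\<^sup>2 \<le> ?g i k"
    using mult_right_mono[of 1 "(1 + (norm (freq k))\<^sup>2) powr s" "(cmod (fourier_coeff (f $ i) k))\<^sup>2"] by simp
  also have "\<dots> = infsum (?g i) {k}" by simp
  also have "\<dots> \<le> infsum (?g i) UNIV"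
    by (rule infsum_mono_neutral) (use sm in auto)
  also have "\<dots> \<le> (\<Sum>i\<in>UNIV. infsum (?g i) UNIV)"
    by (rule member_le_sum) (auto intro!: infsum_nonneg)
  finally show ?thesis unfolding sobolev_norm_def by (rule real_le_rsqrt)
qed

lemma n3_of_real_le_Lp_norm:
  fixes F :: "real^3 \<Rightarrow> real^3"
  assumes c: "continuous_on UNIV F"
  shows "n3 (\<lambda>x. complex_of_real (F x $ i)) \<le> Lp_norm 3 F"
proof -
  have c3: "continuous_on UNIV (\<lambda>x. norm (F x) ^ 3)" by (intro continuous_intros c)
  have ci: "continuous_on UNIV (\<lambda>x. complex_of_real (F x $ i))" by (intro continuous_intros c)
  have cn: "continuous_on UNIV (\<lambda>x. complex_of_real (norm (F x)))" by (intro continuous_intros c)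
  have p: "norm y powr 3 = norm y ^ 3" for y :: "real^3"
    by (cases "y = 0") (simp_all add: powr_numeral)
  have I: "(LINT x:cell|lborel. norm (F x) powr 3) = integral cell (\<lambda>x. norm (F x) ^ 3)"
    unfolding p
  proof (rule set_borel_integral_eq_integral(2))
    show "set_integrable lborel cell (\<lambda>x. norm (F x) ^ 3)"
      unfolding set_integrable_def
      by (rule borel_integrable_compact[OF compact_cbox continuous_on_subset[OF c3]]) simp
  qed
  have "n3 (\<lambda>x. complex_of_real (F x $ i)) \<le> n3 (\<lambda>x. complex_of_real (norm (F x)))"
    using component_le_norm_cart[of "F _" i] by (intro n3_mono ci cn) simp
  also have "\<dots> = root 3 (integral cell (\<lambda>x. norm (F x) ^ 3))" by (simp add: n3_def)
  also have "\<dots> = (integral cell (\<lambda>x. norm (F x) ^ 3)) powr (1 / 3)"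
  proof (cases "integral cell (\<lambda>x. norm (F x) ^ 3) = 0")
    case False
    moreover have "0 \<le> integral cell (\<lambda>x. norm (F x) ^ 3)"
      by (intro integral_nonneg continuous_integrable_cbox c3) auto
    ultimately show ?thesis by (simp add: root_powr_inverse)
  qed simp
  finally show ?thesis unfolding Lp_norm_def I .
qed

lemma continuous_on_lp_block:
  assumes \<theta>: "dyadic_cutoff \<theta>" and f: "torus_distribution f"
  shows "continuous_on UNIV (lp_block \<theta> n f)"
proof -
  have "lp_block \<theta> n f = (\<lambda>x. Re (trig (2 ^ (n + 1)) (\<lambda>k. complex_of_real (block_symbol \<theta> n k) * fourier_coeff f k) x))"
    using lp_block_eq_trig[OF \<theta> fourier_coeff_uminus[OF f] order_refl, of n] by (metis Re_complex_of_real)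
  then show ?thesis by (auto intro!: continuous_intros)
qed

lemma besov_block_bound:
  assumes \<theta>: "dyadic_cutoff \<theta>" and f: "f \<in> besov_inf \<theta> s 3" and N: "2 ^ (n + 1) \<le> N"
  shows "n3 (trig N (\<lambda>k. complex_of_real (block_symbol \<theta> n k) * uhat f k $ i)) \<le> besov_inf_norm \<theta> s 3 f * (2 powr (- s)) ^ n"
proof -
  have fd: "torus_distribution (f $ i)" for i using f by (simp add: besov_inf_def)
  let ?F = "\<lambda>x. \<chi> i. lp_block \<theta> n (f $ i) x"
  have cF: "continuous_on UNIV ?F"
    by (intro continuous_on_vec_lambda continuous_on_lp_block \<theta> fd)
  have "trig N (\<lambda>k. complex_of_real (block_symbol \<theta> n k) * uhat f k $ i) = (\<lambda>x. complex_of_real (?F x $ i))"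
    using lp_block_eq_trig[OF \<theta> fourier_coeff_uminus[OF fd] N] by (simp add: uhat_def fun_eq_iff)
  then have "n3 (trig N (\<lambda>k. complex_of_real (block_symbol \<theta> n k) * uhat f k $ i)) \<le> Lp_norm 3 ?F"
    using n3_of_real_le_Lp_norm[OF cF, of i] by simp
  also have "\<dots> = 2 powr (- (real n * s)) * besov_weight \<theta> s 3 f n"
    by (simp add: besov_weight_def powr_minus)
  also have "\<dots> \<le> 2 powr (- (real n * s)) * besov_inf_norm \<theta> s 3 f"
    unfolding besov_inf_norm_def using f
    by (intro mult_left_mono cSUP_upper) (auto simp: besov_inf_def)
  also have "2 powr (- (real n * s)) = (2 powr (- s)) ^ n"
    by (simp add: powr_powr[symmetric] powr_realpow[symmetric] mult.commute powr_powr)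
  finally show ?thesis by (simp add: mult.commute)
qed

lemma besov_inf_norm_nonneg:
  assumes "f \<in> besov_inf \<theta> s 3"
  shows "0 \<le> besov_inf_norm \<theta> s 3 f"
proof -
  have "0 \<le> besov_weight \<theta> s 3 f 0" by (simp add: besov_weight_def Lp_norm_def)
  also have "\<dots> \<le> besov_inf_norm \<theta> s 3 f"
    unfolding besov_inf_norm_def using assms by (intro cSUP_upper) (auto simp: besov_inf_def)
  finally show ?thesis .
qed

lemma helicity_flux_besov_bound:
  assumes \<theta>: "dyadic_cutoff \<theta>" and f: "f \<in> besov_inf \<theta> s 3" and r: "1/2 < r" "r < 1" "2 powr (- s) \<le> r"
    and div: "\<And>k. dotc (cfreq k) (uhat f k) = 0" and sm: "energy_density (uhat f) summable_on UNIV"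
  shows "norm (helicity_flux (2 ^ q) (uhat f)) \<le> flux_const r * besov_inf_norm \<theta> s 3 f ^ 3 * (4 * r ^ 3) ^ q"
proof (rule LIMSEQ_le_const2[OF tendsto_norm[OF flux_tendsto_helicity_flux[OF \<theta> sm]]], rule exI[of _ 0], intro allI impI)
  fix M :: nat
  \<comment> \<open>Blocks above \<open>M\<close> are replaced by 0: the locale asks for a bound at
    every \<open>n\<close>, while only blocks up to \<open>M\<close> fit into the degree
    \<open>2 ^ (M + 1)\<close>.\<close>
  define c where "c n k = (if n \<le> M then complex_of_real (block_symbol \<theta> n k) *s uhat f k else 0)" for n k
  have sum: "(\<Sum>n\<le>M. c n k) = complex_of_real (cutoff_symbol \<theta> M k) *s uhat f k" for k
    by (simp add: c_def vec_eq_iff sum_block_symbol[symmetric] sum_distrib_right)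
  have dd: "dyadic_decomposition r (besov_inf_norm \<theta> s 3 f) (2 ^ (M + 1)) c"
  proof
    show "c n k = 0" if "k \<notin> freq_box (2 ^ (n + 1))" for n k
      using block_symbol_support[OF \<theta> that] by (simp add: c_def)
    fix n i
    show "n3 (trig (2 ^ (M + 1)) (\<lambda>k. c n k $ i)) \<le> besov_inf_norm \<theta> s 3 f * r ^ n"
    proof (cases "n \<le> M")
      case True
      then have "(2::nat) ^ (n + 1) \<le> 2 ^ (M + 1)" by (intro power_increasing) auto
      from besov_block_bound[OF \<theta> f this, of i]
      have "n3 (trig (2 ^ (M + 1)) (\<lambda>k. c n k $ i)) \<le> besov_inf_norm \<theta> s 3 f * (2 powr (- s)) ^ n"
        using True by (simp add: c_def)
      also have "\<dots> \<le> besov_inf_norm \<theta> s 3 f * r ^ n"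
        by (intro mult_left_mono power_mono r besov_inf_norm_nonneg[OF f]) auto
      finally show ?thesis .
    next
      case False
      have "trig (2 ^ (M + 1)) (\<lambda>k. c n k $ i) = (\<lambda>x. 0)" using False by (simp add: c_def trig_def fun_eq_iff)
      then show ?thesis using r besov_inf_norm_nonneg[OF f] by (simp add: n3_zero)
    qed
  qed (use r besov_inf_norm_nonneg[OF f] in auto)
  have "dotc (cfreq k) (c n k) = 0" for n k by (simp add: c_def dotc_smult_right div)
  from flux_bound[OF dd this order_refl]
  show "norm (flux (2 ^ (M + 1)) (\<lambda>k. (complex_of_real (lam (2 ^ q) k))\<^sup>2) (\<lambda>k. complex_of_real (cutoff_symbol \<theta> M k) *s uhat f k))
      \<le> flux_const r * besov_inf_norm \<theta> s 3 f ^ 3 * (4 * r ^ 3) ^ q"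
    unfolding sum .
qed

section \<open>Testing the weak formulation with a single Fourier mode\<close>

definition mode_test :: "(real \<Rightarrow> real) \<Rightarrow> int^3 \<Rightarrow> complex \<Rightarrow> 3 \<Rightarrow> (real^3) \<times> real \<Rightarrow> real^3" where
  "mode_test \<eta> m z j p = (\<eta> (snd p) * wave m z (fst p)) *\<^sub>R axis j 1"

lemma mode_test_has_derivative:
  assumes "(\<eta> has_real_derivative \<eta>' t) (at t)"
  shows "(mode_test \<eta> m z j has_derivative (\<lambda>v.
    (\<eta>' t * snd v * wave m z x + \<eta> t * wave m (- (2 * pi * (freq m \<bullet> fst v)) * \<i> * z) x) *\<^sub>R axis j 1)) (at (x, t))"
proof -
  have d: "(\<eta> has_derivative (\<lambda>h. \<eta>' t * h)) (at (snd (x, t)))"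
    using assms by (simp add: has_field_derivative_def)
  have 1: "((\<lambda>p. \<eta> (snd p)) has_derivative (\<lambda>v. \<eta>' t * snd v)) (at (x, t))"
    using diff_chain_at[OF has_derivative_snd[OF has_derivative_ident] d] by (simp add: o_def)
  have 2: "((\<lambda>p. wave m z (fst p)) has_derivative (\<lambda>v. wave m (- (2 * pi * (freq m \<bullet> fst v)) * \<i> * z) x)) (at (x, t))"
    using diff_chain_at[OF has_derivative_fst[OF has_derivative_ident] wave_has_derivative[of m z "fst (x, t)"]]
    by (simp add: o_def)
  show ?thesis
    unfolding mode_test_def[abs_def]
    using has_derivative_scaleR_left[OF has_derivative_mult[OF 1 2], of "axis j 1"]
    by (simp add: add.commute)
qed

lemma wave_add_scale: "r * wave m z x = wave m (of_real r * z) x"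
  by (simp add: wave_eq algebra_simps)

lemma wave_zero [simp]: "wave m 0 x = 0"
  by (simp add: wave_eq)

lemma time_deriv_mode_test:
  assumes "\<And>t. (\<eta> has_real_derivative \<eta>' t) (at t)"
  shows "(\<lambda>x. time_deriv (mode_test \<eta> m z j) t x $ i) = wave m (if i = j then of_real (\<eta>' t) * z else 0)"
proof
  fix x
  have "time_deriv (mode_test \<eta> m z j) t x = (\<eta>' t * wave m z x + \<eta> t * wave m 0 x) *\<^sub>R axis j 1"
    unfolding time_deriv_def
    using frechet_derivative_at[OF mode_test_has_derivative[where \<eta> = \<eta> and \<eta>' = \<eta>' and t = t and m = m and z = z and j = j and x = x, OF assms[of t]], symmetric] by simp
  then show "time_deriv (mode_test \<eta> m z j) t x $ i = wave m (if i = j then of_real (\<eta>' t) * z else 0) x"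
    by (simp add: wave_add_scale axis_def)
qed

lemma space_grad_mode_test:
  assumes "\<And>t. (\<eta> has_real_derivative \<eta>' t) (at t)"
  shows "(\<lambda>x. space_grad (mode_test \<eta> m z j) t x $ i $ l)
    = wave m (if l = j then of_real (\<eta> t) * (- (2 * pi * \<i> * of_int (m $ i)) * z) else 0)"
proof
  fix x
  have m: "freq m \<bullet> axis i 1 = real_of_int (m $ i)" by (simp add: inner_axis freq_def)
  have "frechet_derivative (mode_test \<eta> m z j) (at (x, t)) (axis i 1, 0)
      = (\<eta> t * wave m (- (2 * pi * (freq m \<bullet> axis i 1)) * \<i> * z) x) *\<^sub>R axis j 1"
    using frechet_derivative_at[OF mode_test_has_derivative[where \<eta> = \<eta> and \<eta>' = \<eta>' and t = t and m = m and z = z and j = j and x = x, OF assms[of t]], symmetric] by simp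
  then show "space_grad (mode_test \<eta> m z j) t x $ i $ l
    = wave m (if l = j then of_real (\<eta> t) * (- (2 * pi * \<i> * of_int (m $ i)) * z) else 0) x"
    unfolding space_grad_def m by (simp add: wave_add_scale axis_def mult_ac)
qed

lemma spacetime_test_mode_test:
  assumes "time_test T \<eta> \<eta>'"
  shows "spacetime_test T (mode_test \<eta> m z j)"
proof -
  obtain a b where ab: "0 < a" "a < b" "b < T" "\<And>t. t \<notin> {a..b} \<Longrightarrow> \<eta> t = 0" and s: "smooth \<eta>"
    using assms unfolding time_test_def by blast
  have "smooth (mode_test \<eta> m z j)"
    unfolding mode_test_def[abs_def]
    by (intro smooth_scaleR smooth_mult smooth_const smooth_compose_linear[OF bounded_linear_snd s]
        smooth_compose_linear[OF bounded_linear_fst smooth_wave])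
  moreover have "mode_test \<eta> m z j (x + axis i 1, t) = mode_test \<eta> m z j (x, t)" for x i t
    using periodic_fexp[of m] by (simp add: mode_test_def wave_def periodic_def)
  moreover have "\<forall>x t. t \<notin> {a..b} \<longrightarrow> mode_test \<eta> m z j (x, t) = 0"
    by (simp add: mode_test_def ab(4))
  ultimately show ?thesis unfolding spacetime_test_def using ab(1-3) by blast
qed

lemma curlc_uminus:
  assumes "\<And>i. v (- k) $ i = cnj (v k $ i)"
  shows "curlc v (- k) $ j = cnj (curlc v k $ j)"
  using exhaust_3[of j]
  by (elim disjE) (simp_all add: curlc_def cfreq_def assms algebra_simps)

context
  fixes f w :: "functional^3" and \<theta> :: "real^3 \<Rightarrow> real"
  assumes \<theta>: "dyadic_cutoff \<theta>" and f: "\<forall>i. torus_distribution (f $ i)"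
    and w: "\<forall>i. dist_eq (w $ i) (dist_curl f $ i)" and sm: "energy_density (uhat f) summable_on UNIV"
begin

lemma vorticity_wave: "(w $ i) (wave m z) = Re (z * curlc (uhat f) m $ i)"
  using w dist_curl_wave[OF f] torus_test_wave unfolding dist_eq_def by metis

lemma vorticity_coeff: "fourier_coeff (w $ i) k = curlc (uhat f) k $ i"
  by (rule fourier_coeff_eqI[OF vorticity_wave])

lemma uhat_uminus: "uhat f (- k) $ i = cnj (uhat f k $ i)"
  using f by (simp add: uhat_def fourier_coeff_uminus)

lemma bracket_vec_mode_test:
  assumes "\<And>t. (\<eta> has_real_derivative \<eta>' t) (at t)"
  shows "bracket_vec w (time_deriv (mode_test \<eta> m z j) t) = \<eta>' t * Re (z * curlc (uhat f) m $ j)"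
proof -
  have "bracket_vec w (time_deriv (mode_test \<eta> m z j) t)
      = (\<Sum>i\<in>UNIV. if i = j then Re (of_real (\<eta>' t) * z * curlc (uhat f) m $ i) else 0)"
    unfolding bracket_vec_def time_deriv_mode_test[OF assms] vorticity_wave by (intro sum.cong refl) simp
  then show ?thesis by (simp add: sum.delta algebra_simps)
qed

lemma bony_tensor_wave:
  "(bony_tensor \<theta> f w - bony_tensor \<theta> w f) $ i $ j = (\<lambda>\<phi>. bony_product \<theta> (f $ i) (w $ j) \<phi> - bony_product \<theta> (w $ i) (f $ j) \<phi>)"
  by (simp add: bony_tensor_def fun_eq_iff)

lemma bony_wave:
  "bony_product \<theta> (f $ i) (w $ j) (wave m z) = Re (z * (\<Sum>\<^sub>\<infinity>k. uhat f k $ i * curlc (uhat f) (m - k) $ j))"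
  "bony_product \<theta> (w $ i) (f $ j) (wave m z) = Re (z * (\<Sum>\<^sub>\<infinity>k. curlc (uhat f) k $ i * uhat f (m - k) $ j))"
proof -
  have fu: "fourier_coeff (f $ i) k = uhat f k $ i" for i k by (simp add: uhat_def)
  have rf: "fourier_coeff (f $ i) (- k) = cnj (fourier_coeff (f $ i) k)" for i k
    using f by (simp add: fourier_coeff_uminus)
  have rw: "fourier_coeff (w $ i) (- k) = cnj (fourier_coeff (w $ i) k)" for i k
    unfolding vorticity_coeff by (rule curlc_uminus) (rule uhat_uminus)
  have sp: "(\<lambda>k. peetre m * (energy_density (uhat f) k + energy_density (uhat f) (m - k))) summable_on UNIV"
    by (rule energy_density_pair_summable[OF sm])
  show "bony_product \<theta> (f $ i) (w $ j) (wave m z) = Re (z * (\<Sum>\<^sub>\<infinity>k. uhat f k $ i * curlc (uhat f) (m - k) $ j))"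
  proof -
    have "norm (fourier_coeff (f $ i) k * fourier_coeff (w $ j) (m - k)) \<le> peetre m * (energy_density (uhat f) k + energy_density (uhat f) (m - k))" for k
      unfolding fu vorticity_coeff by (rule norm_product_curlc_le)
    from bony_product_wave[OF \<theta> rf rw sp this, of z] show ?thesis by (simp add: fu vorticity_coeff)
  qed
  have "norm (fourier_coeff (w $ i) k * fourier_coeff (f $ j) (m - k)) \<le> peetre m * (energy_density (uhat f) k + energy_density (uhat f) (m - k))" for k
    using norm_product_curlc_le[of "uhat f" "m - k" j m i] by (simp add: fu vorticity_coeff mult.commute add.commute)
  from bony_product_wave[OF \<theta> rw rf sp this, of z]
  show "bony_product \<theta> (w $ i) (f $ j) (wave m z) = Re (z * (\<Sum>\<^sub>\<infinity>k. curlc (uhat f) k $ i * uhat f (m - k) $ j))"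
    by (simp add: fu vorticity_coeff)
qed

text \<open>The wave contains the conjugate exponential, so its \<open>i\<close>-th derivative
  contributes \<open>- 2 pi i m_i\<close>; contracted with the difference of the two Bony products,
  this is the component form of \<open>curl (u x \<omega>)\<close>.\<close>

lemma bracket_mat_mode_test:
  assumes "\<And>t. (\<eta> has_real_derivative \<eta>' t) (at t)"
  shows "bracket_mat (bony_tensor \<theta> f w - bony_tensor \<theta> w f) (space_grad (mode_test \<eta> m z j) t)
    = \<eta> t * Re (z * vorticity_rhs (uhat f) m $ j)"
proof -
  define C where "C i l = (\<Sum>\<^sub>\<infinity>k. uhat f k $ i * curlc (uhat f) (m - k) $ l) - (\<Sum>\<^sub>\<infinity>k. curlc (uhat f) k $ i * uhat f (m - k) $ l)" for i l
  have "bracket_mat (bony_tensor \<theta> f w - bony_tensor \<theta> w f) (space_grad (mode_test \<eta> m z j) t)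
      = (\<Sum>i\<in>UNIV. \<Sum>l\<in>UNIV. if l = j then Re (of_real (\<eta> t) * (- (2 * pi * \<i> * of_int (m $ i)) * z) * C i l) else 0)"
    unfolding bracket_mat_def space_grad_mode_test[OF assms] bony_tensor_wave bony_wave C_def
    by (intro sum.cong refl) (simp add: algebra_simps)
  also have "\<dots> = (\<Sum>i\<in>UNIV. Re (of_real (\<eta> t) * (- (2 * pi * \<i> * of_int (m $ i)) * z) * C i j))"
    by (simp add: sum.delta)
  also have "\<dots> = Re (of_real (\<eta> t) * (z * (\<Sum>i\<in>UNIV. - (2 * pi * \<i> * of_int (m $ i)) * C i j)))"
    unfolding sum_distrib_left Re_sum by (intro sum.cong refl arg_cong[where f = Re]) (simp only: mult_ac)
  also have "(\<Sum>i\<in>UNIV. - (2 * pi * \<i> * of_int (m $ i)) * C i j) = vorticity_rhs (uhat f) m $ j"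
    unfolding C_def by (rule vorticity_rhs_component[OF sm, symmetric])
  finally show ?thesis by simp
qed

lemma sobolev_pairing_eq_fourier_helicity: "sobolev_pairing w f = fourier_helicity (uhat f)"
  by (simp add: sobolev_pairing_def fourier_helicity_def vorticity_coeff) (simp add: uhat_def)

end

section \<open>Measurability in time\<close>

lemma simple_map_measurable:
  fixes F :: "'v \<Rightarrow> complex"
  assumes "simple_map T X s"
  shows "(\<lambda>t. F (s t)) \<in> borel_measurable (lebesgue_on {0<..<T})"
proof (rule measurableI)
  fix A :: "complex set"
  have "(\<lambda>t. F (s t)) -` A \<inter> space (lebesgue_on {0<..<T}) = (\<Union>v\<in>{v \<in> s ` {0<..<T}. F v \<in> A}. {t \<in> {0<..<T}. s t = v})"
    by auto
  moreover have "(\<Union>v\<in>{v \<in> s ` {0<..<T}. F v \<in> A}. {t \<in> {0<..<T}. s t = v}) \<in> sets (lebesgue_on {0<..<T})"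
  proof (rule sets.finite_UN)
    show "finite {v \<in> s ` {0<..<T}. F v \<in> A}" using assms by (simp add: simple_map_def)
    show "{t \<in> {0<..<T}. s t = v} \<in> sets (lebesgue_on {0<..<T})" for v
      using assms by (subst sets_restrict_space_iff) (auto simp: simple_map_def)
  qed
  ultimately show "(\<lambda>t. F (s t)) -` A \<inter> space (lebesgue_on {0<..<T}) \<in> sets (lebesgue_on {0<..<T})" by simp
qed simp

text \<open>Completeness of Lebesgue measure. It makes the brackets with \<open>\<omega> t\<close>
  measurable, as they are known through almost everywhere equal expressions in the
  coefficients.\<close>

lemma borel_measurable_AE_lebesgue_on:
  fixes f g :: "real \<Rightarrow> real"
  assumes S: "S \<in> sets lebesgue" and f: "f \<in> borel_measurable (lebesgue_on S)" and ae: "AE t in lebesgue_on S. f t = g t"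
  shows "g \<in> borel_measurable (lebesgue_on S)"
proof -
  have "(\<lambda>t. indicator S t *\<^sub>R f t) \<in> borel_measurable lebesgue"
    using f S by (subst (asm) borel_measurable_restrict_space_iff) auto
  moreover have "AE t in lebesgue. indicator S t *\<^sub>R f t = indicator S t *\<^sub>R g t"
    using ae S by (subst (asm) AE_restrict_space_iff) (auto simp: indicator_def elim: AE_mp)
  ultimately have "(\<lambda>t. indicator S t *\<^sub>R g t) \<in> borel_measurable lebesgue" by (rule borel_measurable_AE)
  then show ?thesis using S by (subst borel_measurable_restrict_space_iff) auto
qed

section \<open>Conservation of helicity for functional vorticity solutions\<close>

lemma flux_const_nonneg: "1/2 < r \<Longrightarrow> r < 1 \<Longrightarrow> 0 \<le> flux_const r"
  unfolding flux_const_def by (intro mult_nonneg_nonneg add_nonneg_nonneg divide_nonneg_nonneg) auto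

lemma helicity_flux_zero: "helicity_flux n (\<lambda>k. 0) = 0"
  by (simp add: helicity_flux_def curlc_eq_0)

lemma energy_density_zero: "energy_density (\<lambda>k. 0) = (\<lambda>k. 0)"
  by (simp add: energy_density_def fun_eq_iff)

theorem proposition2p12:
  fixes T :: real and \<theta> :: "real^3 \<Rightarrow> real" and u \<omega> :: "real \<Rightarrow> functional^3"
  assumes "T > 0"
    and "dyadic_cutoff \<theta>"
    and "functional_vorticity_solution \<theta> T u \<omega>"
    and "\<exists>\<epsilon>\<^sub>0>0. u \<in> bochner_Lr 3 T (besov_inf \<theta> (2/3 + \<epsilon>\<^sub>0) 3) (besov_inf_norm \<theta> (2/3 + \<epsilon>\<^sub>0) 3)"
  shows "AE t\<^sub>1 in lebesgue_on {0<..<T}. AE t\<^sub>2 in lebesgue_on {0<..<T}.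
           helicity u \<omega> t\<^sub>1 = helicity u \<omega> t\<^sub>2"
proof -
  let ?M = "lebesgue_on {0<..<T}"
  note T = assms(1) and \<theta> = assms(2)
  note sol = assms(3)[unfolded functional_vorticity_solution_def]
  obtain \<epsilon> where \<epsilon>: "\<epsilon> > 0" and uL: "u \<in> bochner_Linf T (sobolev (1/2 + \<epsilon>)) (sobolev_norm (1/2 + \<epsilon>))"
    using sol by blast
  define s1 where "s1 = 1/2 + \<epsilon>"
  obtain s C where s: "\<And>n::nat. simple_map T (sobolev s1) (s n)"
    and A1: "AE t in ?M. u t \<in> sobolev s1"
    and A2: "AE t in ?M. (\<lambda>n. sobolev_norm s1 (s n t - u t)) \<longlonglongrightarrow> 0"
    and A3: "AE t in ?M. sobolev_norm s1 (u t) \<le> C"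
    using uL unfolding bochner_Linf_def strongly_measurable_def s1_def by blast
  have A4: "AE t in ?M. \<forall>i. dist_eq (\<omega> t $ i) (dist_curl (u t) $ i)"
    and A5: "AE t in ?M. dist_eq (dist_div (u t)) (\<lambda>\<phi>. 0)" using sol by blast+
  have weak: "(LINT t|?M. bracket_vec (\<omega> t) (time_deriv \<psi> t)) +
      (LINT t|?M. bracket_mat (bony_tensor \<theta> (u t) (\<omega> t) - bony_tensor \<theta> (\<omega> t) (u t)) (space_grad \<psi> t)) = 0"
    if "spacetime_test T \<psi>" for \<psi> using sol that by blast
  obtain \<epsilon>0 where \<epsilon>0: "\<epsilon>0 > 0" and uB: "u \<in> bochner_Lr 3 T (besov_inf \<theta> (2/3 + \<epsilon>0) 3) (besov_inf_norm \<theta> (2/3 + \<epsilon>0) 3)"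
    using assms(4) by blast
  define s2 where "s2 = 2/3 + \<epsilon>0"
  define N3 where "N3 t = besov_inf_norm \<theta> s2 3 (u t)" for t
  have A6: "AE t in ?M. u t \<in> besov_inf \<theta> s2 3" and ib: "integrable ?M (\<lambda>t. N3 t powr 3)"
    using uB unfolding bochner_Lr_def strongly_measurable_def s2_def N3_def by blast+
  define good where "good t \<longleftrightarrow> u t \<in> sobolev s1 \<and> (\<lambda>n. sobolev_norm s1 (s n t - u t)) \<longlonglongrightarrow> 0 \<and>
    sobolev_norm s1 (u t) \<le> C \<and> (\<forall>i. dist_eq (\<omega> t $ i) (dist_curl (u t) $ i)) \<and>
    dist_eq (dist_div (u t)) (\<lambda>\<phi>. 0) \<and> u t \<in> besov_inf \<theta> s2 3" for t
  have "AE t in ?M. good t"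
    using A1 A2 A3 A4 A5 A6 by eventually_elim (simp add: good_def)
  \<comment> \<open>The bad times are enclosed in a measurable null set; modifying the field on this
    set preserves measurability.\<close>
  then obtain N where N: "{t \<in> space ?M. \<not> good t} \<subseteq> N" "N \<in> sets ?M" "emeasure ?M N = 0"
    by (elim AE_E) blast
  define G where "G = {0<..<T} - N"
  have good: "good t" if "t \<in> G" for t using that N(1) by (auto simp: G_def)
  have AEG: "AE t in ?M. t \<in> G"
  proof -
    have "N \<in> null_sets ?M" using N by (simp add: null_sets_def)
    then have "AE t in ?M. t \<notin> N" by (rule AE_not_in)
    moreover have "AE t in ?M. t \<in> {0<..<T}" by (rule AE_I2) simp
    ultimately show ?thesis by eventually_elim (simp add: G_def)
  qed
  \<comment> \<open>The zero field meets every requirement of the locales at an exceptional time, so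
    these hold at all times.\<close>
  define V where "V t = (if t \<in> G then uhat (u t) else (\<lambda>k. 0))" for t
  have ud: "\<forall>i. torus_distribution (u t $ i)" if "t \<in> G" for t
    using good[OF that] sobolev_distribution[of "u t" s1] unfolding good_def by blast
  have s1: "1/2 \<le> s1" "0 \<le> s1" using \<epsilon> by (simp_all add: s1_def)
  have sm: "energy_density (uhat (u t)) summable_on UNIV" if "t \<in> G" for t
    using good[OF that] by (intro sobolev_energy(1)[OF _ s1(1)]) (simp add: good_def)
  have curl: "\<forall>i. dist_eq (\<omega> t $ i) (dist_curl (u t) $ i)" if "t \<in> G" for t
    using good[OF that] by (simp add: good_def)
  interpret energy_flow T V "3 * C\<^sup>2"
  proof
    show "T > 0" by (rule T)
    show "(\<lambda>t. V t k $ i) \<in> borel_measurable ?M" for k i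
    proof (rule borel_measurable_LIMSEQ_metric)
      \<comment> \<open>The simple approximants are switched off on \<open>N\<close>, so that they
        converge to the coefficient of \<open>V\<close> at every time of the interval.\<close>
      show "(\<lambda>t. if t \<in> N then 0 else fourier_coeff (s n t $ i) k) \<in> borel_measurable ?M" for n
        by (rule measurable_If_set) (use N(2) simple_map_measurable[OF s, of "\<lambda>v. fourier_coeff (v $ i) k" n] in \<open>auto simp: Int_absorb2 sets.sets_into_space\<close>)
      fix t assume t: "t \<in> space ?M"
      show "(\<lambda>n. if t \<in> N then 0 else fourier_coeff (s n t $ i) k) \<longlonglongrightarrow> V t k $ i"
      proof (cases "t \<in> N")
        case True
        then show ?thesis by (simp add: V_def G_def)
      next
        case False
        then have tG: "t \<in> G" using t by (simp add: G_def)
        have us: "u t \<in> sobolev s1" and l: "(\<lambda>n. sobolev_norm s1 (s n t - u t)) \<longlonglongrightarrow> 0"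
          using good[OF tG] by (simp_all add: good_def)
        have sn: "s n t \<in> sobolev s1" for n using s[of n] t by (auto simp: simple_map_def)
        have "norm (fourier_coeff (s n t $ i) k - fourier_coeff (u t $ i) k) \<le> sobolev_norm s1 (s n t - u t)" for n
          using fourier_coeff_le_sobolev_norm[OF sobolev_diff[OF sn us] s1(2), of n i k] by (simp add: fourier_coeff_diff)
        then have "(\<lambda>n. fourier_coeff (s n t $ i) k - fourier_coeff (u t $ i) k) \<longlonglongrightarrow> 0"
          by (intro Lim_null_comparison[OF always_eventually l]) blast
        then have "(\<lambda>n. fourier_coeff (s n t $ i) k) \<longlonglongrightarrow> fourier_coeff (u t $ i) k" by (simp add: LIM_zero_iff)
        then show ?thesis using False tG by (simp add: V_def uhat_def)
      qed
    qed
    show "energy_density (V t) summable_on UNIV" for t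
      using good[of t] sobolev_energy(1)[OF _ s1(1)] by (cases "t \<in> G") (auto simp: V_def good_def energy_density_zero)
    show "infsum (energy_density (V t)) UNIV \<le> 3 * C\<^sup>2" for t
    proof (cases "t \<in> G")
      case True
      then have u: "u t \<in> sobolev s1" "sobolev_norm s1 (u t) \<le> C" using good by (simp_all add: good_def)
      have "0 \<le> sobolev_norm s1 (u t)" unfolding sobolev_norm_def by (intro real_sqrt_ge_zero sum_nonneg infsum_nonneg) auto
      then have "(sobolev_norm s1 (u t))\<^sup>2 \<le> C\<^sup>2" using u by (intro power_mono) auto
      then show ?thesis using sobolev_energy(2)[OF u(1) s1(1)] True by (simp add: V_def)
    qed (simp add: V_def energy_density_zero)
  qed
  have divV: "dotc (cfreq k) (V t k) = 0" for t k
    using good[of t] uhat_div_free[OF ud, of t k] by (cases "t \<in> G") (auto simp: V_def good_def)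
  have realV: "V t (- k) $ i = cnj (V t k $ i)" for t k i
    using ud[of t] by (cases "t \<in> G") (auto simp: V_def uhat_def fourier_coeff_uminus)
  have weakV: "(LINT t|?M. \<eta>' t * Re (z * curlc (V t) m $ j)) + (LINT t|?M. \<eta> t * Re (z * vorticity_rhs (V t) m $ j)) = 0"
    if tt: "time_test T \<eta> \<eta>'" for \<eta> \<eta>' m j z
  proof -
    have d: "\<And>t. (\<eta> has_real_derivative \<eta>' t) (at t)" and sm\<eta>: "smooth \<eta>" "smooth \<eta>'"
      using tt by (simp_all add: time_test_def)
    have b\<eta>: "bounded_meas T \<eta>" "bounded_meas T \<eta>'"
      using sm\<eta> by (auto intro!: bounded_meas_continuous smooth_imp_continuous_on)
    have m1: "(\<lambda>t. \<eta>' t * Re (z * curlc (V t) m $ j)) \<in> borel_measurable ?M"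
      using bounded_meas_mult[OF b\<eta>(2) bounded_meas_Re_mult[OF bounded_meas_curlc, of z m j]] by (simp add: bounded_meas_def)
    have m2: "(\<lambda>t. \<eta> t * Re (z * vorticity_rhs (V t) m $ j)) \<in> borel_measurable ?M"
      using bounded_meas_mult[OF b\<eta>(1) bounded_meas_Re_mult[OF bounded_meas_vorticity_rhs, of z m j]] by (simp add: bounded_meas_def)
    let ?\<psi> = "mode_test \<eta> m z j"
    have a1: "AE t in ?M. \<eta>' t * Re (z * curlc (V t) m $ j) = bracket_vec (\<omega> t) (time_deriv ?\<psi> t)"
      using AEG
    proof eventually_elim
      case (elim t)
      show ?case
        using bracket_vec_mode_test[OF \<theta> ud[OF elim] curl[OF elim] sm[OF elim] d, of m z j t] elim by (simp add: V_def)
    qed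
    have a2: "AE t in ?M. \<eta> t * Re (z * vorticity_rhs (V t) m $ j)
        = bracket_mat (bony_tensor \<theta> (u t) (\<omega> t) - bony_tensor \<theta> (\<omega> t) (u t)) (space_grad ?\<psi> t)"
      using AEG
    proof eventually_elim
      case (elim t)
      show ?case
        using bracket_mat_mode_test[OF \<theta> ud[OF elim] curl[OF elim] sm[OF elim] d, of m z j t] elim by (simp add: V_def)
    qed
    have S: "{0<..<T} \<in> sets lebesgue" by simp
    have "(LINT t|?M. \<eta>' t * Re (z * curlc (V t) m $ j)) = (LINT t|?M. bracket_vec (\<omega> t) (time_deriv ?\<psi> t))"
      by (rule integral_cong_AE[OF m1 borel_measurable_AE_lebesgue_on[OF S m1 a1] a1])
    moreover have "(LINT t|?M. \<eta> t * Re (z * vorticity_rhs (V t) m $ j))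
        = (LINT t|?M. bracket_mat (bony_tensor \<theta> (u t) (\<omega> t) - bony_tensor \<theta> (\<omega> t) (u t)) (space_grad ?\<psi> t))"
      by (rule integral_cong_AE[OF m2 borel_measurable_AE_lebesgue_on[OF S m2 a2] a2])
    ultimately show ?thesis using weak[OF spacetime_test_mode_test[OF tt, of m z j]] by simp
  qed
  \<comment> \<open>Capping the smoothness at \<open>5/6\<close> keeps \<open>s' < 1\<close> and so
    \<open>r > 1/2\<close>, as the dyadic sums require, while \<open>s' > 2/3\<close> still gives
    \<open>4 r^3 < 1\<close>.\<close>
  define s' where "s' = 2/3 + min \<epsilon>0 (1/6)"
  define r where "r = 2 powr (- s')"
  have s': "2/3 < s'" "s' < 1" "s' \<le> s2" using \<epsilon>0 by (auto simp: s'_def s2_def)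
  have r: "1/2 < r" "r < 1" "2 powr (- s2) \<le> r"
  proof -
    have "2 powr (- 1) < r" unfolding r_def using s' by (intro powr_less_mono) auto
    then show "1/2 < r" by (simp add: powr_minus)
    show "r < 1" unfolding r_def using s' by (simp add: powr_minus powr_less_one inverse_less_1_iff)
    show "2 powr (- s2) \<le> r" unfolding r_def using s' by (intro powr_mono) auto
  qed
  have \<rho>: "0 \<le> 4 * r ^ 3" "4 * r ^ 3 < 1"
  proof -
    show "0 \<le> 4 * r ^ 3" using r by simp
    have "r ^ 3 = 2 powr (- (3 * s'))"
      unfolding r_def by (simp add: powr_powr mult.commute[of s'] flip: powr_numeral)
    also have "\<dots> < 2 powr (- 2)" using s' by (intro powr_less_mono) auto
    also have "\<dots> = 1/4" by (simp add: powr_minus)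
    finally show "4 * r ^ 3 < 1" by simp
  qed
  interpret weak_flow T V "3 * C\<^sup>2" "4 * r ^ 3" "\<lambda>t. flux_const r * N3 t powr 3"
  proof
    show "norm (helicity_flux (2 ^ q) (V t)) \<le> flux_const r * N3 t powr 3 * (4 * r ^ 3) ^ q" for q t
    proof (cases "t \<in> G")
      case True
      have ub: "u t \<in> besov_inf \<theta> s2 3" using good[OF True] by (simp add: good_def)
      have dv: "dotc (cfreq k) (uhat (u t) k) = 0" for k using divV[of k t] True by (simp add: V_def)
      have "N3 t ^ 3 = N3 t powr 3"
        using besov_inf_norm_nonneg[OF ub] by (cases "N3 t = 0") (simp_all add: N3_def powr_numeral)
      then show ?thesis
        using helicity_flux_besov_bound[OF \<theta> ub r dv sm[OF True], of q] True by (simp add: V_def N3_def)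
    next
      case False
      then show ?thesis using flux_const_nonneg[OF r(1,2)] \<rho>(1) by (simp add: V_def helicity_flux_zero)
    qed
  qed (use divV realV weakV \<rho> ib in auto)
  have heq: "helicity u \<omega> t = fourier_helicity (V t)" if "t \<in> G" for t
    using sobolev_pairing_eq_fourier_helicity[OF \<theta> ud[OF that] curl[OF that] sm[OF that]] that by (simp add: helicity_def V_def)
  show ?thesis
    using fourier_helicity_constant AEG
  proof eventually_elim
    case (elim t1)
    show ?case
      using elim(1) AEG
    proof eventually_elim
      case (elim t2)
      then show ?case using heq \<open>t1 \<in> G\<close> by simp
    qed
  qed
qed

end
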